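(* Let $X=(X_t)_{t\in T}$ be a separable in probability infinitely divisible process with a separant $T_0$ and the generating triplet $(\Sigma,\nu,b)$. Assume that the probability space is rich enough to support a standard uniform random variable independent of $X$. Then, given a representation $V=(V_t)_{t\in T}$ of $\nu$ defined on a $\sigma$-finite measure space $(S,\mathcal{S},n)$, where $\mathcal{S}$ is countably generated (modulo $n$), there exist a centered Gaussian process $G=(G_t)_{t\in T}$ with covariance $\Sigma$ and a Poisson random measure $N$ on $(S,\mathcal{S})$ with intensity measure $n$, independent of $G$ (both on the probability space of $X$), such that for every $t\in T$ $$X_t=G_t+\int_SV_t(s)\,\big(N(ds)-\chi(V_t(s))\,n(ds)\big)+b(t)\quad\text{a.s.}$$
   Context: $T$ is an arbitrary nonempty set, $\mathbb{R}^T$ the space of all functions $x:T\to\mathbb{R}$, $\mathcal{B}^T$ its cylindrical (product) $\sigma$-algebra, $x_I$ the restriction of $x$ to $I\subset T$, $0_I$ the origin of $\mathbb{R}^I$, $\pi_I(x)=x_I$, and $\mathcal{B}_0^I=\{B\in\mathcal{B}^I:0_I\notin B\}$. A measure $\nu$ on $(\mathbb{R}^T,\mathcal{B}^T)$ is a Lévy measure if (L1) $\int|x(t)|^2\wedge1\,\nu(dx)<\infty$ for every $t\in T$, and (L2) $\nu(A)=\nu_*(A\setminus\{0_T\})$ for every $A\in\mathcal{B}^T$, where $\nu_*(E)=\sup\{\nu(D):D\subset E,\ D\in\mathcal{B}^T\}$. Cutoff function: a fixed bounded measurable $\chi:\mathbb{R}\to\mathbb{R}$ with $\chi(v)=1+o(|v|)$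 as $v\to0$ and $\chi(v)=O(|v|^{-1})$ as $|v|\to\infty$. Truncation: $[[y]](s)=y(s)\chi(y(s))$ for $y\in\mathbb{R}^S$. A process $X$ is infinitely divisible if all its finite-dimensional distributions are. It has a unique generating triplet $(\Sigma,\nu,b)$: $\Sigma$ a (symmetric) non-negative definite function on $T\times T$, $\nu$ a Lévy measure on $(\mathbb{R}^T,\mathcal{B}^T)$, $b\in\mathbb{R}^T$, with $$\mathbb{E}e^{i\sum_{t\in I}a_tX_t}=\exp\Big\{-\tfrac12\langle a,\Sigma_Ia\rangle+\int_{\mathbb{R}^T}(e^{i\langle a,x_I\rangle}-1-i\langle a,[[x_I]]\rangle)\,\nu(dx)+i\langle a,b_I\rangle\Big\}$$ for all finite nonempty $I\subset T$ and $a\in\mathbb{R}^I$, where $\Sigma_I$ is the restriction of $\Sigma$ to $I\times I$. $X$ is separable in probability, with separant $T_0$, if $T_0\subset T$ is nonempty countable and for every $t\in T$ there is a sequence $(s_k)\subset T_0$ with $X_{s_k}\to X_t$ in probability. A representation of $\nu$ is a collection $V=(V_t)_{t\in T}$ of measurable real functions on a measure space $(S,\mathcal{S},n)$ such that $n\{s:V_I(s)\in B\}=\nu(\pi_I^{-1}(B))$ for every finite nonempty $I\subset T$ and $B\in\mathcal{B}_0^I$, where $V_I=(V_t)_{t\in I}$. $\mathcal{S}$ is countably generated modulo $n$ if there is a countable family $\mathcal{S}_0\subset\mathcal{S}$ such that every set in $\mathcal{S}$ differs from a set in $\sigma(\mathcal{S}_0)$ by an $n$-null set. A Poisson random measure $N$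 on $(S,\mathcal{S})$ with intensity $n$ is a family $(N(A))_{A\in\mathcal{S}}$ with $N(A)$ Poisson with mean $n(A)$ ($N(A)=\infty$ a.s. if $n(A)=\infty$), independent over disjoint sets, and countably additive a.s. For measurable $f:S\to\mathbb{R}$ with $\int f^2\wedge1\,dn<\infty$, the integral $\int_Sf\,(dN-\chi(f)\,dn)$ is the Poissonian infinitely divisible random variable $\int f\mathbf{1}_{\{|f|\le1\}}d(N-n)+\int f\mathbf{1}_{\{|f|>1\}}dN+\int f(\mathbf{1}_{\{|f|\le1\}}-\chi(f))\,dn$, where the first term is the $L^2$-limit of integrals of simple functions. *)

theory Defs
  imports "HOL-Probability.Probability" "HOL-Library.Landau_Symbols"
begin

text \<open>
  The space of real functions on \<open>T\<close> with its cylindrical sigma-algebra is \<open>PiM T (\<lambda>_. borel)\<close>;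
  its points are the functions that are \<open>undefined\<close> outside \<open>T\<close>, so that \<open>restrict x I\<close> is the
  projection of \<open>x\<close> to \<open>I\<close> and \<open>origin I\<close> below is the zero of the space indexed by \<open>I\<close>.
\<close>

abbreviation path_space :: "'t set \<Rightarrow> ('t \<Rightarrow> real) measure" where
  "path_space T \<equiv> Pi\<^sub>M T (\<lambda>_. borel)"

abbreviation origin :: "'t set \<Rightarrow> 't \<Rightarrow> real" where
  "origin I \<equiv> (\<lambda>t\<in>I. 0)"

definition joint :: "'t set \<Rightarrow> ('t \<Rightarrow> 'w \<Rightarrow> 'a) \<Rightarrow> 'w \<Rightarrow> 't \<Rightarrow> 'a" where
  "joint I X = (\<lambda>w. \<lambda>t\<in>I. X t w)"

subsection \<open>Probabilistic preliminaries\<close>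

definition real_process :: "'w measure \<Rightarrow> 't set \<Rightarrow> ('t \<Rightarrow> 'w \<Rightarrow> real) \<Rightarrow> bool" where
  "real_process M T X \<longleftrightarrow> (\<forall>t\<in>T. X t \<in> borel_measurable M)"

text \<open>Unlike \<^const>\<open>prob_space.indep_var\<close>, the two random elements may have different types.\<close>

definition indep_elements ::
  "'w measure \<Rightarrow> 'a measure \<Rightarrow> ('w \<Rightarrow> 'a) \<Rightarrow> 'b measure \<Rightarrow> ('w \<Rightarrow> 'b) \<Rightarrow> bool" where
  "indep_elements M Ma f Mb g \<longleftrightarrow>
     f \<in> measurable M Ma \<and> g \<in> measurable M Mb \<and>
     prob_space.indep_set M {f -` A \<inter> space M | A. A \<in> sets Ma} {g -` B \<inter> space M | B. B \<in> sets Mb}"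

definition tendsto_in_prob :: "'w measure \<Rightarrow> (nat \<Rightarrow> 'w \<Rightarrow> real) \<Rightarrow> ('w \<Rightarrow> real) \<Rightarrow> bool" where
  "tendsto_in_prob M Y Z \<longleftrightarrow>
     (\<forall>\<epsilon>>0. (\<lambda>k. measure M {w \<in> space M. \<bar>Y k w - Z w\<bar> > \<epsilon>}) \<longlonglongrightarrow> 0)"

definition separable_in_prob :: "'w measure \<Rightarrow> 't set \<Rightarrow> ('t \<Rightarrow> 'w \<Rightarrow> real) \<Rightarrow> 't set \<Rightarrow> bool" where
  "separable_in_prob M T X T0 \<longleftrightarrow>
     T0 \<subseteq> T \<and> T0 \<noteq> {} \<and> countable T0 \<and>
     (\<forall>t\<in>T. \<exists>s :: nat \<Rightarrow> 't. range s \<subseteq> T0 \<and> tendsto_in_prob M (\<lambda>k. X (s k)) (X t))"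

definition supports_independent_uniform ::
  "'w measure \<Rightarrow> 't set \<Rightarrow> ('t \<Rightarrow> 'w \<Rightarrow> real) \<Rightarrow> bool" where
  "supports_independent_uniform M T X \<longleftrightarrow>
     (\<exists>U :: 'w \<Rightarrow> real. indep_elements M borel U (path_space T) (joint T X) \<and>
        distr M borel U = uniform_measure lborel {0..1})"

subsection \<open>Infinite divisibility and generating triplets\<close>

text \<open>For every \<open>k \<ge> 1\<close>, \<open>\<mu>\<close> is the law of the sum of \<open>k\<close> independent vectors with law \<open>\<rho>\<close>,
  i.e. the \<open>k\<close>-fold convolution power of \<open>\<rho>\<close>.\<close>

definition infinitely_divisible_law :: "'t set \<Rightarrow> ('t \<Rightarrow> real) measure \<Rightarrow> bool" where
  "infinitely_divisible_law I \<mu> \<longleftrightarrow>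
     (\<forall>k::nat. k \<ge> 1 \<longrightarrow>
        (\<exists>\<rho>. prob_space \<rho> \<and> sets \<rho> = sets (path_space I) \<and>
             \<mu> = distr (Pi\<^sub>M {..<k} (\<lambda>_. \<rho>)) (path_space I) (\<lambda>y. \<lambda>t\<in>I. \<Sum>j<k. y j t)))"

definition infinitely_divisible_process :: "'w measure \<Rightarrow> 't set \<Rightarrow> ('t \<Rightarrow> 'w \<Rightarrow> real) \<Rightarrow> bool" where
  "infinitely_divisible_process M T X \<longleftrightarrow>
     real_process M T X \<and>
     (\<forall>I. I \<subseteq> T \<and> finite I \<and> I \<noteq> {} \<longrightarrow>
        infinitely_divisible_law I (distr M (path_space I) (joint I X)))"

definition nonneg_definite_on :: "'t set \<Rightarrow> ('t \<Rightarrow> 't \<Rightarrow> real) \<Rightarrow> bool" where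
  "nonneg_definite_on T K \<longleftrightarrow>
     (\<forall>s\<in>T. \<forall>t\<in>T. K s t = K t s) \<and>
     (\<forall>I (a :: 't \<Rightarrow> real). I \<subseteq> T \<and> finite I \<longrightarrow> (\<Sum>s\<in>I. \<Sum>t\<in>I. a s * K s t * a t) \<ge> 0)"

definition inner_emeasure :: "'a measure \<Rightarrow> 'a set \<Rightarrow> ennreal" where
  "inner_emeasure \<nu> E = (SUP D \<in> {D \<in> sets \<nu>. D \<subseteq> E}. emeasure \<nu> D)"

definition levy_measure :: "'t set \<Rightarrow> ('t \<Rightarrow> real) measure \<Rightarrow> bool" where
  "levy_measure T \<nu> \<longleftrightarrow>
     sets \<nu> = sets (path_space T) \<and>
     (\<forall>t\<in>T. (\<integral>\<^sup>+ x. ennreal (min (\<bar>x t\<bar>\<^sup>2) 1) \<partial>\<nu>) < \<infinity>) \<and>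
     (\<forall>A\<in>sets \<nu>. emeasure \<nu> A = inner_emeasure \<nu> (A - {origin T}))"

text \<open>The filter \<open>at 0\<close> is punctured. The value of \<open>\<chi>\<close> at 0 plays no role, because \<open>\<chi> v\<close> is only
  ever used multiplied by \<open>v\<close>.\<close>

definition cutoff :: "(real \<Rightarrow> real) \<Rightarrow> bool" where
  "cutoff chi \<longleftrightarrow>
     chi \<in> borel_measurable borel \<and> bounded (range chi) \<and>
     (\<lambda>v. chi v - 1) \<in> o[at 0](\<lambda>v. \<bar>v\<bar>) \<and>
     chi \<in> O[at_infinity](\<lambda>v. inverse \<bar>v\<bar>)"

definition truncation :: "(real \<Rightarrow> real) \<Rightarrow> ('t \<Rightarrow> real) \<Rightarrow> 't \<Rightarrow> real" where
  "truncation chi y = (\<lambda>s. y s * chi (y s))"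

definition generating_triplet ::
  "(real \<Rightarrow> real) \<Rightarrow> 'w measure \<Rightarrow> 't set \<Rightarrow> ('t \<Rightarrow> 'w \<Rightarrow> real) \<Rightarrow>
   ('t \<Rightarrow> 't \<Rightarrow> real) \<Rightarrow> ('t \<Rightarrow> real) measure \<Rightarrow> ('t \<Rightarrow> real) \<Rightarrow> bool" where
  "generating_triplet chi M T X K \<nu> b \<longleftrightarrow>
     nonneg_definite_on T K \<and> levy_measure T \<nu> \<and>
     (\<forall>I (a :: 't \<Rightarrow> real). I \<subseteq> T \<and> finite I \<and> I \<noteq> {} \<longrightarrow>
        (\<integral>w. iexp (\<Sum>t\<in>I. a t * X t w) \<partial>M) =
        exp (- (1/2) * complex_of_real (\<Sum>s\<in>I. \<Sum>t\<in>I. a s * K s t * a t)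
             + (\<integral>x. (iexp (\<Sum>t\<in>I. a t * x t) - 1
                      - \<i> * complex_of_real (\<Sum>t\<in>I. a t * truncation chi x t)) \<partial>\<nu>)
             + \<i> * complex_of_real (\<Sum>t\<in>I. a t * b t)))"

subsection \<open>Representations of a measure on path space\<close>

definition representation_of ::
  "'t set \<Rightarrow> ('t \<Rightarrow> real) measure \<Rightarrow> 's measure \<Rightarrow> ('t \<Rightarrow> 's \<Rightarrow> real) \<Rightarrow> bool" where
  "representation_of T \<nu> n V \<longleftrightarrow>
     (\<forall>t\<in>T. V t \<in> borel_measurable n) \<and>
     (\<forall>I B. I \<subseteq> T \<and> finite I \<and> I \<noteq> {} \<and> B \<in> sets (path_space I) \<and> origin I \<notin> B \<longrightarrow>
        emeasure n {s \<in> space n. joint I V s \<in> B} = emeasure \<nu> {x \<in> space \<nu>. restrict x I \<in> B})"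

definition countably_generated_mod :: "'s measure \<Rightarrow> bool" where
  "countably_generated_mod n \<longleftrightarrow>
     (\<exists>S0. S0 \<subseteq> sets n \<and> countable S0 \<and>
        (\<forall>A\<in>sets n. \<exists>B\<in>sigma_sets (space n) S0. sym_diff A B \<in> null_sets n))"

subsection \<open>Gaussian processes\<close>

text \<open>Point masses count as (degenerate) normal laws.\<close>

definition gaussian_rv :: "'w measure \<Rightarrow> ('w \<Rightarrow> real) \<Rightarrow> bool" where
  "gaussian_rv M Y \<longleftrightarrow>
     Y \<in> borel_measurable M \<and>
     ((\<exists>m \<sigma>. \<sigma> > 0 \<and> distributed M lborel Y (normal_density m \<sigma>)) \<or> (\<exists>m. AE w in M. Y w = m))"

definition gaussian_process :: "'w measure \<Rightarrow> 't set \<Rightarrow> ('t \<Rightarrow> 'w \<Rightarrow> real) \<Rightarrow> bool" where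
  "gaussian_process M T G \<longleftrightarrow>
     real_process M T G \<and>
     (\<forall>I (a :: 't \<Rightarrow> real). I \<subseteq> T \<and> finite I \<and> I \<noteq> {} \<longrightarrow> gaussian_rv M (\<lambda>w. \<Sum>t\<in>I. a t * G t w))"

definition centered_gaussian_process ::
  "'w measure \<Rightarrow> 't set \<Rightarrow> ('t \<Rightarrow> 'w \<Rightarrow> real) \<Rightarrow> ('t \<Rightarrow> 't \<Rightarrow> real) \<Rightarrow> bool" where
  "centered_gaussian_process M T G K \<longleftrightarrow>
     gaussian_process M T G \<and>
     (\<forall>t\<in>T. prob_space.expectation M (G t) = 0) \<and>
     (\<forall>s\<in>T. \<forall>t\<in>T. prob_space.expectation M
        (\<lambda>w. (G s w - prob_space.expectation M (G s)) * (G t w - prob_space.expectation M (G t))) = K s t)"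

subsection \<open>Poisson random measures and the Poissonian integral\<close>

text \<open>
  Countable additivity holds almost surely for each disjoint sequence, the exceptional null set
  being allowed to depend on the sequence. On a general measurable space a version of \<open>N\<close>
  whose paths are measures need not exist on the given probability space.
\<close>

definition poisson_random_measure ::
  "'w measure \<Rightarrow> 's measure \<Rightarrow> ('s set \<Rightarrow> 'w \<Rightarrow> ennreal) \<Rightarrow> bool" where
  "poisson_random_measure M n N \<longleftrightarrow>
     (\<forall>A\<in>sets n. N A \<in> borel_measurable M) \<and>
     (\<forall>A\<in>sets n. emeasure n A < \<infinity> \<longrightarrow>
        (\<forall>k::nat. measure M {w \<in> space M. N A w = of_nat k} =
                  measure n A ^ k / fact k * exp (- measure n A))) \<and>
     (\<forall>A\<in>sets n. emeasure n A = \<infinity> \<longrightarrow> (AE w in M. N A w = \<infinity>)) \<and>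
     (\<forall>\<A>. \<A> \<subseteq> sets n \<and> disjoint \<A> \<longrightarrow> prob_space.indep_vars M (\<lambda>_. borel) N \<A>) \<and>
     (\<forall>A :: nat \<Rightarrow> 's set. range A \<subseteq> sets n \<and> disjoint_family A \<longrightarrow>
        (AE w in M. N (\<Union>i. A i) w = (\<Sum>i. N (A i) w)))"

text \<open>Integrands vanishing outside a set of finite measure, on which \<open>N\<close> is almost surely finite.\<close>

definition finite_simple :: "'s measure \<Rightarrow> ('s \<Rightarrow> real) \<Rightarrow> bool" where
  "finite_simple n g \<longleftrightarrow> simple_function n g \<and> emeasure n {s \<in> space n. g s \<noteq> 0} < \<infinity>"

definition simple_integral_N ::
  "'s measure \<Rightarrow> ('s set \<Rightarrow> 'w \<Rightarrow> ennreal) \<Rightarrow> ('s \<Rightarrow> real) \<Rightarrow> 'w \<Rightarrow> real" where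
  "simple_integral_N n N g w =
     (\<Sum>y \<in> g ` space n - {0}. y * enn2real (N (g -` {y} \<inter> space n) w))"

definition simple_integral_compensated ::
  "'s measure \<Rightarrow> ('s set \<Rightarrow> 'w \<Rightarrow> ennreal) \<Rightarrow> ('s \<Rightarrow> real) \<Rightarrow> 'w \<Rightarrow> real" where
  "simple_integral_compensated n N g w =
     (\<Sum>y \<in> g ` space n - {0}.
        y * (enn2real (N (g -` {y} \<inter> space n) w) - measure n (g -` {y} \<inter> space n)))"

text \<open>
  Stochastic integrals are determined only up to a null event, so they are given as relations:
  \<open>Y\<close> is a version of the integral. The first is the integral with respect to \<open>N - n\<close> of a
  square-integrable \<open>h\<close>, obtained by \<open>L\<^sup>2\<close>-approximation.
\<close>

definition compensated_integral ::
  "'w measure \<Rightarrow> 's measure \<Rightarrow> ('s set \<Rightarrow> 'w \<Rightarrow> ennreal) \<Rightarrow> ('s \<Rightarrow> real) \<Rightarrow> ('w \<Rightarrow> real) \<Rightarrow> bool" where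
  "compensated_integral M n N h Y \<longleftrightarrow>
     Y \<in> borel_measurable M \<and>
     (\<exists>g :: nat \<Rightarrow> 's \<Rightarrow> real.
        (\<forall>k. finite_simple n (g k)) \<and>
        (\<lambda>k. \<integral>\<^sup>+ s. ennreal ((g k s - h s)\<^sup>2) \<partial>n) \<longlonglongrightarrow> 0 \<and>
        (\<lambda>k. \<integral>\<^sup>+ w. ennreal ((simple_integral_compensated n N (g k) w - Y w)\<^sup>2) \<partial>M) \<longlonglongrightarrow> 0)"

text \<open>
  Integral with respect to \<open>N\<close> of an \<open>h\<close> vanishing outside a set of finite measure. As the paths of
  \<open>N\<close> need not be measures, it is the limit in probability of integrals of simple functions.
\<close>

definition N_integral ::
  "'w measure \<Rightarrow> 's measure \<Rightarrow> ('s set \<Rightarrow> 'w \<Rightarrow> ennreal) \<Rightarrow> ('s \<Rightarrow> real) \<Rightarrow> ('w \<Rightarrow> real) \<Rightarrow> bool" where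
  "N_integral M n N h Y \<longleftrightarrow>
     Y \<in> borel_measurable M \<and>
     emeasure n {s \<in> space n. h s \<noteq> 0} < \<infinity> \<and>
     (\<exists>g :: nat \<Rightarrow> 's \<Rightarrow> real.
        (\<forall>k. finite_simple n (g k)) \<and>
        (\<forall>k. \<forall>s\<in>space n. h s = 0 \<longrightarrow> g k s = 0) \<and>
        (\<forall>s\<in>space n. (\<lambda>k. g k s) \<longlonglongrightarrow> h s) \<and>
        tendsto_in_prob M (\<lambda>k. simple_integral_N n N (g k)) Y)"

text \<open>\<open>Y\<close> is a version of the integral of \<open>f\<close> with respect to \<open>dN - \<chi>(f) dn\<close>.\<close>

definition poissonian_integral ::
  "(real \<Rightarrow> real) \<Rightarrow> 'w measure \<Rightarrow> 's measure \<Rightarrow> ('s set \<Rightarrow> 'w \<Rightarrow> ennreal) \<Rightarrow>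
   ('s \<Rightarrow> real) \<Rightarrow> ('w \<Rightarrow> real) \<Rightarrow> bool" where
  "poissonian_integral chi M n N f Y \<longleftrightarrow>
     f \<in> borel_measurable n \<and>
     (\<integral>\<^sup>+ s. ennreal (min ((f s)\<^sup>2) 1) \<partial>n) < \<infinity> \<and>
     Y \<in> borel_measurable M \<and>
     (\<exists>Y1 Y2.
        compensated_integral M n N (\<lambda>s. f s * indicator {s. \<bar>f s\<bar> \<le> 1} s) Y1 \<and>
        N_integral M n N (\<lambda>s. f s * indicator {s. \<bar>f s\<bar> > 1} s) Y2 \<and>
        (AE w in M. Y w = Y1 w + Y2 w
           + (\<integral>s. f s * (indicator {s. \<bar>f s\<bar> \<le> 1} s - chi (f s)) \<partial>n)))"

end

theory Submission
  imports Defs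
begin

text \<open>
  On a probability space of one's own choice the decomposition is a construction, so the proof builds it
  there and then carries it over to the space of \<open>X\<close>.

  The auxiliary space is a product. Its first factor is the law \<open>\<Gamma>\<close> on path space of a centered Gaussian
  process with covariance \<open>K\<close> (\<open>gaussian_law_exists\<close>). Its second factor is a countable product of laws on
  the real line, from which a Poisson random measure with intensity \<open>n\<close> is read off: \<open>S\<close> is cut into blocks
  of finite measure, and in each block a Poisson number of independent points is placed, each point being
  recorded by a real number that decides, up to null sets, to which measurable sets it belongs
  (\<open>N_poisson_random_measure\<close>). If \<open>H t\<close> is the Poissonian integral of \<open>V t\<close>, then \<open>g t + H t + b t\<close> has the
  characteristic functions prescribed by the triplet. Indeed the exponent belonging to \<open>H\<close> is an integral
  with respect to \<open>n\<close> of a function of \<open>V\<close> that vanishes at the origin (\<open>poissonian_integrals_exist\<close>), and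
  away from the origin a representation identifies the image of \<open>n\<close> with \<open>\<nu>\<close>
  (\<open>representation_integral\<close>). As characteristic functions determine laws on path space
  (\<open>path_law_eqI\<close>), this process has the law of \<open>X\<close>.

  The second factor is a space of sequences of reals, so its points can be coded by single numbers in the
  unit interval. The conditional distribution of this number, given the process, is simulated on the space
  of \<open>X\<close> from the independent uniform variable (\<open>transfer_real\<close>). This yields a variable \<open>\<eta>\<close> such that
  \<open>(X, \<eta>)\<close> has the law of the process together with the code of its noise. Only a real number is
  conditioned, hence Radon-Nikodym derivatives at countably many levels suffice, however large \<open>T\<close> is.

  Let \<open>p\<close> be the decoded \<open>\<eta>\<close>, let \<open>N\<close> be the random measure read off from \<open>p\<close>, and define \<open>G\<close> to be
  \<open>X - H p - b\<close>. Then the decomposition holds by definition, and all other claims concern the law of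
  \<open>(G, p)\<close>. Being the image of the law of \<open>(X, \<eta>)\<close> under a measurable map, this is the product law of the
  auxiliary space: \<open>G\<close> is Gaussian with covariance \<open>K\<close>, \<open>N\<close> is Poisson, and they are independent.
  Finally \<open>H p\<close> is the Poissonian integral with respect to \<open>N\<close>, because \<open>p\<close> preserves measure and the
  integral is a limit of functions of the random measure (\<open>pull_poissonian_integral\<close>).
\<close>

section \<open>Characteristic functions determine joint laws\<close>

lemma same_law_transfer:
  fixes X :: "'w \<Rightarrow> real" and X' :: "'v \<Rightarrow> real" and f :: "real \<Rightarrow> 'b::{banach, second_countable_topology}"
  assumes law: "distr M borel X = distr M' borel X'" and X: "X \<in> borel_measurable M" and X': "X' \<in> borel_measurable M'"
    and f: "f \<in> borel_measurable borel"
  shows "integrable M (\<lambda>w. f (X w)) \<longleftrightarrow> integrable M' (\<lambda>v. f (X' v))"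
    "(\<integral>w. f (X w) \<partial>M) = (\<integral>v. f (X' v) \<partial>M')"
proof -
  show "integrable M (\<lambda>w. f (X w)) \<longleftrightarrow> integrable M' (\<lambda>v. f (X' v))"
    using integrable_distr_eq[OF X f] integrable_distr_eq[OF X' f] unfolding law by blast
  show "(\<integral>w. f (X w) \<partial>M) = (\<integral>v. f (X' v) \<partial>M')"
    using integral_distr[OF X f] integral_distr[OF X' f] unfolding law by argo
qed

lemma integrable_scaled_iexp:
  fixes h X :: "'w \<Rightarrow> real"
  assumes [measurable]: "integrable M h" "X \<in> borel_measurable M"
  shows "integrable M (\<lambda>w. h w *\<^sub>R iexp (X w))"
  by (rule Bochner_Integration.integrable_bound[OF assms(1)]) auto

lemma integrable_mult_bounded:
  fixes h c :: "'w \<Rightarrow> real"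
  assumes h: "integrable M h" and [measurable]: "c \<in> borel_measurable M" and c: "\<And>w. \<bar>c w\<bar> \<le> B"
  shows "integrable M (\<lambda>w. h w * c w)"
proof (rule Bochner_Integration.integrable_bound)
  show "integrable M (\<lambda>w. B * h w)" using h by simp
  show "AE w in M. norm (h w * c w) \<le> norm (B * h w)"
    using c by (auto simp: abs_mult mult.commute[of "\<bar>h _\<bar>"] intro!: AE_I2 mult_right_mono intro: order_trans[OF _ abs_ge_self])
qed (use h in measurable)

lemma abs_one_plus_cos_le: "\<bar>1 + cos (x::real)\<bar> \<le> 2"
  using cos_ge_minus_one[of x] cos_le_one[of x] by linarith

text \<open>
  Apart from the case of total mass zero, dividing by the common mass \<open>c\<close> (the transform at \<open>0\<close>) turns the
  two weighted measures into probability measures, to which Levy's uniqueness theorem applies.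
\<close>

lemma weighted_char_unique:
  fixes f X :: "'w \<Rightarrow> real" and f' X' :: "'v \<Rightarrow> real"
  assumes f[measurable]: "integrable M f" "X \<in> borel_measurable M"
    and f'[measurable]: "integrable M' f'" "X' \<in> borel_measurable M'"
    and nonneg: "\<And>w. 0 \<le> f w" "\<And>v. 0 \<le> f' v"
    and eq: "\<And>u. (\<integral>w. f w *\<^sub>R iexp (u * X w) \<partial>M) = (\<integral>v. f' v *\<^sub>R iexp (u * X' v) \<partial>M')"
    and A[measurable]: "A \<in> sets borel"
  shows "(\<integral>w. f w * indicator A (X w) \<partial>M) = (\<integral>v. f' v * indicator A (X' v) \<partial>M')"
proof -
  define c where "c = (\<integral>w. f w \<partial>M)"
  have "complex_of_real c = complex_of_real (\<integral>v. f' v \<partial>M')"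
    using eq[of 0] by (simp add: c_def scaleR_conv_of_real)
  then have c': "(\<integral>v. f' v \<partial>M') = c" by simp
  show ?thesis
  proof (cases "c = 0")
    case True
    have "AE w in M. f w = 0"
      using integral_nonneg_eq_0_iff_AE[OF f(1)] nonneg True by (simp add: c_def)
    then have "(\<integral>w. f w * indicator A (X w) \<partial>M) = (\<integral>w. 0 \<partial>M)"
      by (intro integral_cong_AE) auto
    moreover have "AE w in M'. f' w = 0"
      using integral_nonneg_eq_0_iff_AE[OF f'(1)] nonneg True c' by simp
    then have "(\<integral>w. f' w * indicator A (X' w) \<partial>M') = (\<integral>w. 0 \<partial>M')"
      by (intro integral_cong_AE) auto
    ultimately show ?thesis by simp
  next
    case False
    then have cpos: "c > 0"
      using integral_nonneg_AE[of f M] nonneg by (simp add: c_def order_less_le)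
    have *: "real_distribution (distr (density M (\<lambda>w. ennreal (f w / c))) borel X) \<and>
        char (distr (density M (\<lambda>w. ennreal (f w / c))) borel X) u
          = (1 / c) *\<^sub>R (\<integral>w. f w *\<^sub>R iexp (u * X w) \<partial>M) \<and>
        measure (distr (density M (\<lambda>w. ennreal (f w / c))) borel X) A
          = (1 / c) * (\<integral>w. f w * indicator A (X w) \<partial>M)"
      if f[measurable]: "integrable M f" "X \<in> borel_measurable M"
        and nonneg: "\<And>w. 0 \<le> f w" and c: "(\<integral>w. f w \<partial>M) = c"
      for M :: "'x measure" and f X :: "'x \<Rightarrow> real" and u
    proof -
      let ?D = "density M (\<lambda>w. ennreal (f w / c))"
      have "emeasure ?D (space ?D) = (\<integral>\<^sup>+ w. ennreal (f w / c) \<partial>M)"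
        by (subst space_density, subst emeasure_density) (auto intro!: nn_integral_cong)
      also have "\<dots> = ennreal (\<integral>w. f w / c \<partial>M)"
        using nonneg cpos f by (intro nn_integral_eq_integral) (auto)
      also have "\<dots> = 1" using c cpos by simp
      finally have D: "prob_space ?D" by (rule prob_spaceI)
      then interpret D: prob_space ?D .
      have [measurable]: "X \<in> borel_measurable ?D" by simp
      have 1: "real_distribution (distr ?D borel X)"
        by (rule D.real_distribution_distr) simp
      have 2: "char (distr ?D borel X) u = (1 / c) *\<^sub>R (\<integral>w. f w *\<^sub>R iexp (u * X w) \<partial>M)"
        unfolding char_def
        by (subst integral_distr, simp, simp, subst integral_density)
           (use nonneg cpos in \<open>auto simp flip: integral_scaleR_right\<close>)
      have "measure (distr ?D borel X) A = measure ?D (X -` A \<inter> space M)"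
        by (subst measure_distr) auto
      also have "\<dots> = (\<integral>w. indicator (X -` A \<inter> space M) w \<partial>?D)"
        by simp
      also have "\<dots> = (\<integral>w. (f w / c) *\<^sub>R indicator (X -` A \<inter> space M) w \<partial>M)"
        using nonneg cpos by (intro integral_density) auto
      also have "\<dots> = (\<integral>w. (1 / c) * (f w * indicator A (X w)) \<partial>M)"
        by (intro Bochner_Integration.integral_cong) (auto simp: indicator_def)
      finally show ?thesis using 1 2 by simp
    qed
    note a = *[OF f nonneg(1) c_def[symmetric]] and b = *[OF f' nonneg(2) c']
    have "distr (density M (\<lambda>w. ennreal (f w / c))) borel X = distr (density M' (\<lambda>w. ennreal (f' w / c))) borel X'"
      by (rule Levy_uniqueness) (use a b eq in \<open>auto simp: fun_eq_iff\<close>)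
    then have "(1 / c) * (\<integral>w. f w * indicator A (X w) \<partial>M) = (1 / c) * (\<integral>w. f' w * indicator A (X' w) \<partial>M')"
      using a b by metis
    then show ?thesis using cpos by simp
  qed
qed

text \<open>
  The factor \<open>1 + cos (th + ph)\<close> is a nonnegative weight and a trigonometric polynomial at the same time:
  multiplying by it keeps a measure positive, and its effect on a transform is a combination of shifts of
  the exponent by \<open>th\<close>.
\<close>

lemma cos_weight_iexp:
  "(h * (1 + cos (th + ph))) *\<^sub>R iexp x =
     h *\<^sub>R iexp x + (iexp ph / 2) * (h *\<^sub>R iexp (x + th)) + (iexp (- ph) / 2) * (h *\<^sub>R iexp (x - th))"
proof -
  have "complex_of_real (cos (th + ph)) = (iexp (th + ph) + iexp (- (th + ph))) / 2"
    by (simp only: cos_of_real[symmetric] cos_exp_eq of_real_minus mult_minus_right mult_minus_left)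
  moreover have "iexp ph * iexp (x + th) = iexp (th + ph) * iexp x"
    "iexp (- ph) * iexp (x - th) = iexp (- (th + ph)) * iexp x"
    by (simp_all flip: exp_add add: algebra_simps)
  ultimately show ?thesis
    by (simp only: scaleR_conv_of_real of_real_mult of_real_add of_real_1) (simp only: mult_1_left algebra_simps add_divide_distrib times_divide_eq_left times_divide_eq_right)
qed

lemma integral_cos_weight_iexp:
  fixes h th X :: "'w \<Rightarrow> real"
  assumes h: "integrable M h" and [measurable]: "th \<in> borel_measurable M" "X \<in> borel_measurable M"
  shows "(\<integral>w. (h w * (1 + cos (th w + ph))) *\<^sub>R iexp (X w) \<partial>M) =
      (\<integral>w. h w *\<^sub>R iexp (X w) \<partial>M) + (iexp ph / 2) * (\<integral>w. h w *\<^sub>R iexp (X w + th w) \<partial>M)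
      + (iexp (- ph) / 2) * (\<integral>w. h w *\<^sub>R iexp (X w - th w) \<partial>M)"
proof -
  have i: "integrable M (\<lambda>w. h w *\<^sub>R iexp (X w))" "integrable M (\<lambda>w. h w *\<^sub>R iexp (X w + th w))"
    "integrable M (\<lambda>w. h w *\<^sub>R iexp (X w - th w))"
    by (intro integrable_scaled_iexp h; measurable)+
  show ?thesis
    unfolding cos_weight_iexp
    by (subst Bochner_Integration.integral_add, intro Bochner_Integration.integrable_add integrable_mult_right i,
        intro integrable_mult_right i, subst Bochner_Integration.integral_add, intro i,
        intro integrable_mult_right i, simp only: integral_mult_right_zero)
qed

text \<open>
  A multivariate uniqueness theorem is derived from the one-dimensional one by replacing the exponentials
  by indicators, one coordinate at a time. In a step the factor \<open>exp (i th)\<close> of the coordinates still to come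
  would be a complex weight, whereas uniqueness is available for positive weights only. Hence it is replaced
  by the weights \<open>1 + cos (th + ph)\<close>, whose transforms are known from the induction hypothesis, and
  recovered afterwards from the phases \<open>ph = 0\<close> and \<open>ph = - pi / 2\<close>, which give its real and imaginary parts.
\<close>

lemma char_mixed_eq:
  fixes X :: "'t \<Rightarrow> 'w \<Rightarrow> real" and X' :: "'t \<Rightarrow> 'v \<Rightarrow> real"
  assumes M: "prob_space M" "prob_space M'" and fin: "finite I"
    and X: "\<And>t. t \<in> I \<Longrightarrow> X t \<in> borel_measurable M"
    and X': "\<And>t. t \<in> I \<Longrightarrow> X' t \<in> borel_measurable M'"
    and eq: "\<And>a :: 't \<Rightarrow> real. (\<integral>w. iexp (\<Sum>t\<in>I. a t * X t w) \<partial>M) = (\<integral>w. iexp (\<Sum>t\<in>I. a t * X' t w) \<partial>M')"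
    and A: "\<And>t. t \<in> I \<Longrightarrow> A t \<in> sets borel"
    and J: "J \<subseteq> I"
  shows "(\<integral>w. (\<Prod>t\<in>J. indicator (A t) (X t w) :: real) *\<^sub>R iexp (\<Sum>t\<in>I - J. a t * X t w) \<partial>M)
       = (\<integral>w. (\<Prod>t\<in>J. indicator (A t) (X' t w) :: real) *\<^sub>R iexp (\<Sum>t\<in>I - J. a t * X' t w) \<partial>M')"
  using finite_subset[OF J fin] J
proof (induction J arbitrary: a rule: finite_induct)
  case empty
  then show ?case using eq by simp
next
  case (insert j J)
  then have j: "j \<in> I" "j \<notin> J" and JI: "J \<subseteq> I" by auto
  have split: "I - J = insert j (I - insert j J)" using j by auto
  define h where "h = (\<lambda>w. \<Prod>t\<in>J. indicator (A t) (X t w) :: real)"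
  define h' where "h' = (\<lambda>w. \<Prod>t\<in>J. indicator (A t) (X' t w) :: real)"
  define th where "th = (\<lambda>w. \<Sum>t\<in>I - insert j J. a t * X t w)"
  define th' where "th' = (\<lambda>w. \<Sum>t\<in>I - insert j J. a t * X' t w)"
  note [measurable] = X[OF j(1)] X'[OF j(1)] A[OF j(1)]
  have [measurable]: "th \<in> borel_measurable M" "th' \<in> borel_measurable M'"
    unfolding th_def th'_def using X X' by (auto intro!: borel_measurable_sum borel_measurable_times)
  have hm [measurable]: "h \<in> borel_measurable M" "h' \<in> borel_measurable M'"
    unfolding h_def h'_def using JI X X' A
    by (auto intro!: borel_measurable_prod measurable_compose[OF _ borel_measurable_indicator])
  have h01: "0 \<le> h w" "h w \<le> 1" "0 \<le> h' v" "h' v \<le> 1" for w v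
    unfolding h_def h'_def by (auto intro!: prod_nonneg prod_le_1)
  interpret M: prob_space M by fact
  interpret M': prob_space M' by fact
  have hi: "integrable M h" "integrable M' h'"
    using h01 by (auto intro!: M.integrable_const_bound[of _ 1] M'.integrable_const_bound[of _ 1])
  \<comment> \<open>the induction hypothesis, with the coefficients of the remaining coordinates scaled by \<open>c\<close>\<close>
  have base: "(\<integral>w. h w *\<^sub>R iexp (u * X j w + c * th w) \<partial>M) = (\<integral>w. h' w *\<^sub>R iexp (u * X' j w + c * th' w) \<partial>M')"
    for u c :: real
  proof -
    have "(\<Sum>t\<in>I - insert j J. (if t = j then u else c * a t) * f t) = c * (\<Sum>t\<in>I - insert j J. a t * f t)" for f
      by (subst sum_distrib_left, intro sum.cong) auto
    then show ?thesis
      using insert.IH[OF JI, of "\<lambda>t. if t = j then u else c * a t", unfolded split] fin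
      by (simp add: h_def h'_def th_def th'_def)
  qed
  have w: "(\<integral>w. (h w * (1 + cos (th w + ph))) * indicator (A j) (X j w) \<partial>M)
         = (\<integral>w. (h' w * (1 + cos (th' w + ph))) * indicator (A j) (X' j w) \<partial>M')" for ph
  proof (rule weighted_char_unique)
    show "integrable M (\<lambda>w. h w * (1 + cos (th w + ph)))" "integrable M' (\<lambda>w. h' w * (1 + cos (th' w + ph)))"
      by (intro integrable_mult_bounded[where B = 2] hi abs_one_plus_cos_le; measurable)+
    show "0 \<le> h w * (1 + cos (th w + ph))" "0 \<le> h' v * (1 + cos (th' v + ph))" for w v
      using cos_ge_minus_one[of "th w + ph"] cos_ge_minus_one[of "th' v + ph"]
      by (intro mult_nonneg_nonneg h01; linarith)+
    show "(\<integral>w. (h w * (1 + cos (th w + ph))) *\<^sub>R iexp (u * X j w) \<partial>M)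
        = (\<integral>w. (h' w * (1 + cos (th' w + ph))) *\<^sub>R iexp (u * X' j w) \<partial>M')" for u
      using base[of u 0] base[of u 1] base[of u "-1"]
      by (simp add: integral_cos_weight_iexp[OF hi(1)] integral_cos_weight_iexp[OF hi(2)] del: of_real_mult)
  qed auto
  have w0: "(\<integral>w. h w * indicator (A j) (X j w) \<partial>M) = (\<integral>w. h' w * indicator (A j) (X' j w) \<partial>M')"
    by (rule weighted_char_unique[OF hi(1) _ hi(2)]) (use h01 base[of _ 0] in auto)
  define g where "g = (\<lambda>w. h w * indicator (A j) (X j w))"
  define g' where "g' = (\<lambda>w. h' w * indicator (A j) (X' j w))"
  have g01: "0 \<le> g w" "g w \<le> 1" "0 \<le> g' v" "g' v \<le> 1" for w v
    using h01 by (auto simp: g_def g'_def indicator_def)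
  have [measurable]: "g \<in> borel_measurable M" "g' \<in> borel_measurable M'"
    unfolding g_def g'_def by measurable
  have gi: "integrable M g" "integrable M' g'"
    using g01 by (auto intro!: M.integrable_const_bound[of _ 1] M'.integrable_const_bound[of _ 1])
  have gc: "integrable M (\<lambda>w. g w * cos (th w + ph))" "integrable M' (\<lambda>w. g' w * cos (th' w + ph))" for ph
    by (auto intro!: integrable_mult_bounded[where B = 1] gi)
  have gw: "(\<integral>w. g w * cos (th w + ph) \<partial>M) = (\<integral>w. g' w * cos (th' w + ph) \<partial>M')" for ph
  proof -
    have "(\<integral>w. g w + g w * cos (th w + ph) \<partial>M) = (\<integral>w. g' w + g' w * cos (th' w + ph) \<partial>M')"
      using w[of ph] by (simp add: g_def g'_def algebra_simps)
    then show ?thesis using w0 gi gc by (simp add: g_def[symmetric] g'_def[symmetric])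
  qed
  have int: "(\<integral>w. g w *\<^sub>R iexp (th w) \<partial>M) = Complex (\<integral>w. g w * cos (th w + 0) \<partial>M) (\<integral>w. g w * cos (th w + - (pi/2)) \<partial>M)"
    if [measurable]: "integrable M g" "th \<in> borel_measurable M" for M :: "'x measure" and g th
  proof -
    have i: "integrable M (\<lambda>w. g w *\<^sub>R iexp (th w))"
      by (rule integrable_scaled_iexp) fact+
    have 1: "Re (\<integral>w. g w *\<^sub>R iexp (th w) \<partial>M) = (\<integral>w. g w * cos (th w + 0) \<partial>M)"
      by (subst integral_Re[OF i, symmetric]) (simp add: Re_exp)
    have 2: "Im (\<integral>w. g w *\<^sub>R iexp (th w) \<partial>M) = (\<integral>w. g w * cos (th w + - (pi/2)) \<partial>M)"
      by (subst integral_Im[OF i, symmetric]) (simp add: Im_exp cos_diff)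
    show ?thesis using 1 2 by (simp add: complex_eq_iff)
  qed
  have "(\<integral>w. g w *\<^sub>R iexp (th w) \<partial>M) = (\<integral>w. g' w *\<^sub>R iexp (th' w) \<partial>M')"
    by (subst int[OF gi(1)], simp, subst int[OF gi(2)], simp, simp only: gw)
  then show ?case
    using insert.hyps by (simp add: g_def g'_def h_def h'_def th_def th'_def mult.commute)
qed

lemma char_determines_joint_law:
  fixes X :: "'t \<Rightarrow> 'w \<Rightarrow> real" and X' :: "'t \<Rightarrow> 'v \<Rightarrow> real"
  assumes M: "prob_space M" "prob_space M'" and fin: "finite I"
    and X: "\<And>t. t \<in> I \<Longrightarrow> X t \<in> borel_measurable M"
    and X': "\<And>t. t \<in> I \<Longrightarrow> X' t \<in> borel_measurable M'"
    and eq: "\<And>a :: 't \<Rightarrow> real. (\<integral>w. iexp (\<Sum>t\<in>I. a t * X t w) \<partial>M) = (\<integral>w. iexp (\<Sum>t\<in>I. a t * X' t w) \<partial>M')"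
    and A: "\<And>t. t \<in> I \<Longrightarrow> A t \<in> sets borel"
  shows "measure M {w \<in> space M. \<forall>t\<in>I. X t w \<in> A t} = measure M' {w \<in> space M'. \<forall>t\<in>I. X' t w \<in> A t}"
proof -
  have *: "(\<integral>w. (\<Prod>t\<in>I. indicator (A t) (X t w) :: real) *\<^sub>R iexp (\<Sum>t\<in>I - I. a t * X t w) \<partial>M)
      = complex_of_real (measure M {w \<in> space M. \<forall>t\<in>I. X t w \<in> A t})"
    if "prob_space M" and X: "\<And>t. t \<in> I \<Longrightarrow> X t \<in> borel_measurable M"
    for M :: "'x measure" and X :: "'t \<Rightarrow> 'x \<Rightarrow> real" and a
  proof -
    have "(\<Prod>t\<in>I. indicator (A t) (X t w) :: real) = indicator {w \<in> space M. \<forall>t\<in>I. X t w \<in> A t} w"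
      if "w \<in> space M" for w
      using fin that by (cases "\<forall>t\<in>I. X t w \<in> A t") (auto simp: indicator_def)
    then have "(\<integral>w. (\<Prod>t\<in>I. indicator (A t) (X t w) :: real) *\<^sub>R iexp (\<Sum>t\<in>I - I. a t * X t w) \<partial>M)
        = (\<integral>w. complex_of_real (indicator {w \<in> space M. \<forall>t\<in>I. X t w \<in> A t} w) \<partial>M)"
      by (intro Bochner_Integration.integral_cong) (auto simp: scaleR_conv_of_real)
    also have "\<dots> = complex_of_real (measure M ({w \<in> space M. \<forall>t\<in>I. X t w \<in> A t} \<inter> space M))"
      by simp
    also have "{w \<in> space M. \<forall>t\<in>I. X t w \<in> A t} \<inter> space M = {w \<in> space M. \<forall>t\<in>I. X t w \<in> A t}" by auto
    finally show ?thesis .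
  qed
  have "(\<integral>w. (\<Prod>t\<in>I. indicator (A t) (X t w) :: real) *\<^sub>R iexp (\<Sum>t\<in>I - I. 0 * X t w) \<partial>M)
      = (\<integral>w. (\<Prod>t\<in>I. indicator (A t) (X' t w) :: real) *\<^sub>R iexp (\<Sum>t\<in>I - I. 0 * X' t w) \<partial>M')" (is "?L = ?R")
    by (rule char_mixed_eq[OF M fin _ _ eq]) (use X X' A in auto)
  then have "complex_of_real (measure M {w \<in> space M. \<forall>t\<in>I. X t w \<in> A t})
      = complex_of_real (measure M' {w \<in> space M'. \<forall>t\<in>I. X' t w \<in> A t})"
  proof -
    assume "?L = ?R"
    moreover have "?L = complex_of_real (measure M {w \<in> space M. \<forall>t\<in>I. X t w \<in> A t})"
      by (rule *[OF M(1)]) (rule X)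
    moreover have "?R = complex_of_real (measure M' {w \<in> space M'. \<forall>t\<in>I. X' t w \<in> A t})"
      by (rule *[OF M(2)]) (rule X')
    ultimately show ?thesis by simp
  qed
  then show ?thesis by simp
qed

lemma measurable_joint:
  assumes "real_process M T X"
  shows "joint T X \<in> measurable M (path_space T)"
  unfolding joint_def using assms by (intro measurable_restrict) (auto simp: real_process_def)

lemma path_law_eqI:
  fixes X :: "'t \<Rightarrow> 'w \<Rightarrow> real" and X' :: "'t \<Rightarrow> 'v \<Rightarrow> real"
  assumes M: "prob_space M" "prob_space M'"
    and X: "real_process M T X" and X': "real_process M' T X'"
    and eq: "\<And>I (a :: 't \<Rightarrow> real). finite I \<Longrightarrow> I \<subseteq> T \<Longrightarrow> I \<noteq> {} \<Longrightarrow>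
      (\<integral>w. iexp (\<Sum>t\<in>I. a t * X t w) \<partial>M) = (\<integral>w. iexp (\<Sum>t\<in>I. a t * X' t w) \<partial>M')"
  shows "distr M (path_space T) (joint T X) = distr M' (path_space T) (joint T X')"
proof -
  interpret M: prob_space M by fact
  interpret M': prob_space M' by fact
  note [measurable] = measurable_joint[OF X] measurable_joint[OF X']
  show ?thesis
  proof (rule measure_eqI_PiM_infinite)
    fix A :: "'t \<Rightarrow> real set" and J assume J: "finite J" "J \<subseteq> T" and A: "\<And>i. i \<in> J \<Longrightarrow> A i \<in> sets borel"
    have "measure M {w \<in> space M. \<forall>t\<in>J. X t w \<in> A t} = measure M' {w \<in> space M'. \<forall>t\<in>J. X' t w \<in> A t}"
    proof (cases "J = {}")
      case True then show ?thesis by (simp add: M.prob_space M'.prob_space)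
    next
      case False
      with J X X' A show ?thesis
        by (intro char_determines_joint_law M eq) (auto simp: real_process_def)
    qed
    moreover have "joint T X -` prod_emb T (\<lambda>_. borel) J (Pi\<^sub>E J A) \<inter> space M = {w \<in> space M. \<forall>t\<in>J. X t w \<in> A t}"
      "joint T X' -` prod_emb T (\<lambda>_. borel) J (Pi\<^sub>E J A) \<inter> space M' = {w \<in> space M'. \<forall>t\<in>J. X' t w \<in> A t}"
      using J by (auto simp: prod_emb_def joint_def PiE_iff subset_iff)
    moreover have "prod_emb T (\<lambda>_. borel) J (Pi\<^sub>E J A) \<in> sets (path_space T)"
      using J A by (intro sets_PiM_I) auto
    ultimately show "emeasure (distr M (path_space T) (joint T X)) (prod_emb T (\<lambda>_. borel) J (Pi\<^sub>E J A)) =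
       emeasure (distr M' (path_space T) (joint T X')) (prod_emb T (\<lambda>_. borel) J (Pi\<^sub>E J A))"
      by (simp add: emeasure_distr M.emeasure_eq_measure M'.emeasure_eq_measure)
  qed (auto intro!: prob_space.finite_measure M.prob_space_distr)
qed

lemma (in prob_space) integrable_iexp_real:
  "(X :: 'a \<Rightarrow> real) \<in> borel_measurable M \<Longrightarrow> integrable M (\<lambda>w. iexp (X w))"
  by (rule integrable_const_bound[where B=1]) auto

text \<open>
  The product of the marginal laws has a factorizing transform as well, so it is the joint law.
\<close>

lemma (in prob_space) indep_of_char:
  fixes Z :: "'k \<Rightarrow> 'a \<Rightarrow> real"
  assumes fin: "finite I" and Z: "\<And>k. k \<in> I \<Longrightarrow> Z k \<in> borel_measurable M"
    and eq: "\<And>a :: 'k \<Rightarrow> real. (\<integral>w. iexp (\<Sum>k\<in>I. a k * Z k w) \<partial>M) = (\<Prod>k\<in>I. \<integral>w. iexp (a k * Z k w) \<partial>M)"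
    and A: "\<And>k. k \<in> I \<Longrightarrow> A k \<in> sets borel"
  shows "prob {w \<in> space M. \<forall>k\<in>I. Z k w \<in> A k} = (\<Prod>k\<in>I. prob {w \<in> space M. Z k w \<in> A k})"
proof -
  \<comment> \<open>a product measure needs a law at every index; outside \<open>I\<close> it does not matter which\<close>
  define D where "D = (\<lambda>k. if k \<in> I then distr M borel (Z k) else return borel 0)"
  have D: "prob_space (D k)" "sets (D k) = sets borel" for k
    unfolding D_def using Z by (auto intro!: prob_space_distr prob_space_return)
  have spD: "space (D k) = UNIV" for k
    using sets_eq_imp_space_eq[OF D(2)] by simp
  interpret D: product_prob_space D I
    using D(1) by (auto simp: product_prob_space_def product_prob_space_axioms_def product_sigma_finite_def
        intro: prob_space_imp_sigma_finite)
  have comp: "(\<lambda>x. x k) \<in> borel_measurable (PiM I D)" if "k \<in> I" for k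
    using measurable_component_singleton[OF that, of D] D(2) by (simp cong: measurable_cong_sets)
  have "prob {w \<in> space M. \<forall>k\<in>I. Z k w \<in> A k} = measure (PiM I D) {x \<in> space (PiM I D). \<forall>k\<in>I. x k \<in> A k}"
  proof (rule char_determines_joint_law[OF prob_space_axioms D.P.prob_space_axioms fin Z comp _ A])
    fix a :: "'k \<Rightarrow> real"
    have "(\<integral>x. iexp (\<Sum>k\<in>I. a k * x k) \<partial>PiM I D) = (\<integral>x. (\<Prod>k\<in>I. iexp (a k * x k)) \<partial>PiM I D)"
      by (simp add: sum_distrib_left exp_sum fin)
    also have "\<dots> = (\<Prod>k\<in>I. \<integral>x. iexp (a k * x) \<partial>D k)"
      using D(2) by (intro D.product_integral_prod fin prob_space.integrable_iexp_real D(1))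
        (auto simp: cong: measurable_cong_sets)
    also have "\<dots> = (\<Prod>k\<in>I. \<integral>w. iexp (a k * Z k w) \<partial>M)"
      using Z by (intro prod.cong refl) (simp add: D_def integral_distr)
    finally show "(\<integral>w. iexp (\<Sum>k\<in>I. a k * Z k w) \<partial>M) = (\<integral>x. iexp (\<Sum>k\<in>I. a k * x k) \<partial>PiM I D)"
      using eq by simp
  qed auto
  also have "{x \<in> space (PiM I D). \<forall>k\<in>I. x k \<in> A k} = prod_emb I D I (Pi\<^sub>E I A)"
    by (auto simp: prod_emb_def space_PiM PiE_iff spD extensional_def)
  also have "measure (PiM I D) \<dots> = (\<Prod>k\<in>I. measure (D k) (A k))"
    using A D(2) fin by (intro D.measure_PiM_emb) auto
  also have "\<dots> = (\<Prod>k\<in>I. prob {w \<in> space M. Z k w \<in> A k})"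
    using Z A by (intro prod.cong refl) (auto simp: D_def measure_distr intro!: arg_cong[where f=prob])
  finally show ?thesis .
qed

section \<open>Gaussian processes\<close>

lemma nonneg_definite_on_subset: "nonneg_definite_on T K \<Longrightarrow> I \<subseteq> T \<Longrightarrow> nonneg_definite_on I K"
  unfolding nonneg_definite_on_def by (meson order_trans subsetD)

lemma quadratic_form_insert:
  fixes a :: "'t \<Rightarrow> real"
  assumes "finite J" "p \<notin> J" and sym: "\<And>s. s \<in> J \<Longrightarrow> K p s = K s p"
  shows "(\<Sum>s\<in>insert p J. \<Sum>t\<in>insert p J. a s * K s t * a t) =
    (a p)\<^sup>2 * K p p + 2 * a p * (\<Sum>s\<in>J. a s * K s p) + (\<Sum>s\<in>J. \<Sum>t\<in>J. a s * K s t * a t)"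
proof -
  have "(\<Sum>t\<in>J. a p * K p t * a t) = a p * (\<Sum>s\<in>J. a s * K s p)"
    "(\<Sum>s\<in>J. a s * K s p * a p) = a p * (\<Sum>s\<in>J. a s * K s p)"
    using sym by (auto simp: sum_distrib_left intro!: sum.cong)
  then show ?thesis
    using assms(1,2) by (simp add: sum.distrib power2_eq_square algebra_simps)
qed

lemma sum_square_quadratic_form:
  fixes a r :: "'t \<Rightarrow> real"
  shows "(\<Sum>s\<in>J. \<Sum>t\<in>J. a s * (K s t - r s * r t) * a t) =
    (\<Sum>s\<in>J. \<Sum>t\<in>J. a s * K s t * a t) - (\<Sum>s\<in>J. a s * r s)\<^sup>2"
proof -
  have "(\<Sum>s\<in>J. a s * r s)\<^sup>2 = (\<Sum>s\<in>J. \<Sum>t\<in>J. a s * (r s * r t) * a t)"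
    by (simp add: power2_eq_square sum_product mult_ac)
  then show ?thesis by (simp add: algebra_simps sum_subtractf)
qed

text \<open>
  Induction on \<open>I\<close> by Schur complements. With \<open>r = K(.,p) / sqrt (K p p)\<close>, the kernel
  \<open>K s t - r s * r t\<close> vanishes in the row and column of \<open>p\<close> and is nonnegative definite on the other indices.
  If \<open>K p p = 0\<close>, then the whole column \<open>K(.,p)\<close> vanishes, and \<open>r = 0\<close>, the value that division by zero
  gives, is the right choice.
\<close>

lemma nonneg_definite_factorization:
  fixes K :: "'t \<Rightarrow> 't \<Rightarrow> real"
  assumes "finite I" "nonneg_definite_on I K"
  shows "\<exists>c. \<forall>s\<in>I. \<forall>t\<in>I. K s t = (\<Sum>j\<in>I. c j s * c j t)"
  using assms
proof (induction I arbitrary: K rule: finite_induct)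
  case empty
  then show ?case by simp
next
  case (insert p I)
  have sym: "K s t = K t s" if "s \<in> insert p I" "t \<in> insert p I" for s t
    using insert.prems that unfolding nonneg_definite_on_def by blast
  have pos: "0 \<le> (\<Sum>s\<in>J. \<Sum>t\<in>J. a s * K s t * a t)" if "J \<subseteq> insert p I" for J a
    using insert.prems insert.hyps that unfolding nonneg_definite_on_def by (meson finite_insert finite_subset)
  define d where "d = K p p"
  have d: "0 \<le> d" using pos[of "{p}" "\<lambda>_. 1"] by (simp add: d_def)
  define r where "r = (\<lambda>s. K s p / sqrt d)"
  have two: "0 \<le> x\<^sup>2 * d + 2 * x * K s p + K s s" if "s \<in> I" for s x
  proof -
    have sp: "s \<noteq> p" using that insert.hyps by auto
    then show ?thesis
      using pos[of "insert p {s}" "\<lambda>t. if t = p then x else 1"] that insert.hyps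
        quadratic_form_insert[of "{s}" p K "\<lambda>t. if t = p then x else 1"] sym[of p s]
      by (simp add: d_def power2_eq_square algebra_simps)
  qed
  have rp: "r s * r p = K s p" if "s \<in> insert p I" for s
  proof (cases "d = 0")
    case True
    have "K s p = 0" if s: "s \<in> I" for s
    proof (rule ccontr)
      assume "K s p \<noteq> 0"
      then show False
        \<comment> \<open>for \<open>d = 0\<close> the quadratic polynomial \<open>two\<close> is affine in \<open>x\<close>, with value \<open>-1\<close> at this point\<close>
        using two[OF s, of "- (K s s + 1) / (2 * K s p)"] True by (simp add: field_simps)
    qed
    then show ?thesis using that True by (auto simp: r_def d_def)
  next
    case False
    then show ?thesis using d by (simp add: r_def d_def[symmetric] flip: real_sqrt_mult)
  qed
  have "nonneg_definite_on I (\<lambda>s t. K s t - r s * r t)"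
    unfolding nonneg_definite_on_def
  proof (intro conjI ballI allI impI; (elim conjE)?)
    fix s t assume "s \<in> I" "t \<in> I"
    then show "K s t - r s * r t = K t s - r t * r s" using sym by simp
  next
    fix J and a :: "'t \<Rightarrow> real" assume J: "J \<subseteq> I" "finite J"
    then have pJ: "p \<notin> J" using insert.hyps by auto
    define B where "B = (\<Sum>s\<in>J. a s * K s p)"
    have ar: "(\<Sum>s\<in>J. a s * r s) = B / sqrt d"
      by (simp add: B_def r_def sum_divide_distrib)
    show "0 \<le> (\<Sum>s\<in>J. \<Sum>t\<in>J. a s * (K s t - r s * r t) * a t)"
    proof (cases "d = 0")
      case True
      then show ?thesis using pos[of J a] J by (subst sum_square_quadratic_form) (auto simp: ar)
    next
      case False
      \<comment> \<open>the value at \<open>p\<close> that minimizes the quadratic form\<close>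
      define a' where "a' = a(p := - B / d)"
      have BS: "(\<Sum>s\<in>J. a' s * K s p) = B" "(\<Sum>s\<in>J. \<Sum>t\<in>J. a' s * K s t * a' t) = (\<Sum>s\<in>J. \<Sum>t\<in>J. a s * K s t * a t)"
        using pJ by (auto simp: a'_def B_def intro!: sum.cong)
      have "0 \<le> (\<Sum>s\<in>insert p J. \<Sum>t\<in>insert p J. a' s * K s t * a' t)"
        using J by (intro pos) auto
      also have "\<dots> = (\<Sum>s\<in>J. \<Sum>t\<in>J. a s * K s t * a t) - (B / sqrt d)\<^sup>2"
      proof -
        have p: "a' p = - B / d" by (simp add: a'_def)
        have KS: "\<And>s. s \<in> J \<Longrightarrow> K p s = K s p" using sym[of p] J by auto
        have "(\<Sum>s\<in>insert p J. \<Sum>t\<in>insert p J. a' s * K s t * a' t) =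
            (- B / d)\<^sup>2 * d + 2 * (- B / d) * B + (\<Sum>s\<in>J. \<Sum>t\<in>J. a s * K s t * a t)"
          using quadratic_form_insert[of J p K a', OF J(2) pJ KS] by (simp only: BS p d_def)
        also have "(- B / d)\<^sup>2 * d + 2 * (- B / d) * B = - (B / sqrt d)\<^sup>2"
          using False d by (simp add: power_divide power2_eq_square field_simps)
        finally show ?thesis by simp
      qed
      finally show ?thesis by (simp add: sum_square_quadratic_form ar)
    qed
  qed
  then obtain c where c: "\<And>s t. s \<in> I \<Longrightarrow> t \<in> I \<Longrightarrow> K s t - r s * r t = (\<Sum>j\<in>I. c j s * c j t)"
    using insert.IH by blast
  \<comment> \<open>the vector indexed by \<open>p\<close> is \<open>r\<close>; the vectors of the induction hypothesis are extended by zero to \<open>p\<close>\<close>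
  define c' where "c' = (\<lambda>j s. if j = p then r s else if s = p then 0 else c j s)"
  have sum_c': "(\<Sum>j\<in>insert p I. c' j s * c' j t) = r s * r t + (if s = p \<or> t = p then 0 else \<Sum>j\<in>I. c j s * c j t)" for s t
  proof -
    have "(\<Sum>j\<in>I. c' j s * c' j t) = (\<Sum>j\<in>I. if s = p \<or> t = p then 0 else c j s * c j t)"
      using insert.hyps by (intro sum.cong) (auto simp: c'_def)
    then show ?thesis using insert.hyps by (simp add: c'_def)
  qed
  have "K s t = (\<Sum>j\<in>insert p I. c' j s * c' j t)" if "s \<in> insert p I" "t \<in> insert p I" for s t
    using that c[of s t] rp[of s] rp[of t] sym[of p t] unfolding sum_c' by (auto simp: mult.commute)
  then show ?case by blast
qed

lemma iexp_sum: "finite I \<Longrightarrow> iexp (\<Sum>k\<in>I. f k) = (\<Prod>k\<in>I. iexp (f k))"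
  by (simp add: sum_distrib_left exp_sum)

text \<open>
  With \<open>K s t = (\<Sum>j. c j s * c j t)\<close>, the law is the image of independent standard normal variables \<open>z\<close>
  under the linear map \<open>t \<mapsto> (\<Sum>j. c j t * z j)\<close>.
\<close>

lemma finite_gaussian_law_exists:
  fixes K :: "'t \<Rightarrow> 't \<Rightarrow> real"
  assumes fin: "finite I" and K: "nonneg_definite_on I K"
  shows "\<exists>P. prob_space P \<and> sets P = sets (path_space I) \<and>
    (\<forall>a :: 't \<Rightarrow> real. (\<integral>x. iexp (\<Sum>t\<in>I. a t * x t) \<partial>P)
       = exp (- (1/2) * complex_of_real (\<Sum>s\<in>I. \<Sum>t\<in>I. a s * K s t * a t)))"
proof -
  obtain c where c: "\<And>s t. s \<in> I \<Longrightarrow> t \<in> I \<Longrightarrow> K s t = (\<Sum>j\<in>I. c j s * c j t)"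
    using nonneg_definite_factorization[OF fin K] by blast
  interpret N: real_distribution std_normal_distribution by (rule real_dist_normal_dist)
  interpret D: product_prob_space "\<lambda>_. std_normal_distribution" I ..
  let ?Q = "\<Pi>\<^sub>M _\<in>I. std_normal_distribution"
  let ?g = "\<lambda>z. \<lambda>t\<in>I. \<Sum>j\<in>I. c j t * z j"
  have [measurable]: "(\<lambda>z. z j) \<in> borel_measurable ?Q" if "j \<in> I" for j
    using measurable_component_singleton[OF that, of "\<lambda>_. std_normal_distribution"] by simp
  have g[measurable]: "?g \<in> measurable ?Q (path_space I)"
    by (intro measurable_restrict) measurable
  let ?P = "distr ?Q (path_space I) ?g"
  have "(\<integral>x. iexp (\<Sum>t\<in>I. a t * x t) \<partial>?P) = exp (- (1/2) * complex_of_real (\<Sum>s\<in>I. \<Sum>t\<in>I. a s * K s t * a t))"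
    for a :: "'t \<Rightarrow> real"
  proof -
    have [measurable]: "(\<lambda>x. x t) \<in> borel_measurable (path_space I)" if "t \<in> I" for t
      using that by measurable
    have "(\<integral>x. iexp (\<Sum>t\<in>I. a t * x t) \<partial>?P) = (\<integral>z. iexp (\<Sum>t\<in>I. a t * ?g z t) \<partial>?Q)"
      by (intro integral_distr g) measurable
    also have "\<dots> = (\<integral>z. (\<Prod>j\<in>I. iexp ((\<Sum>t\<in>I. a t * c j t) * z j)) \<partial>?Q)"
    proof (intro Bochner_Integration.integral_cong refl)
      fix z :: "'t \<Rightarrow> real"
      have "(\<Sum>t\<in>I. a t * ?g z t) = (\<Sum>t\<in>I. \<Sum>j\<in>I. a t * c j t * z j)"
        by (simp add: sum_distrib_left mult_ac)
      also have "\<dots> = (\<Sum>j\<in>I. (\<Sum>t\<in>I. a t * c j t) * z j)"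
        by (subst sum.swap) (simp add: sum_distrib_right)
      finally show "iexp (\<Sum>t\<in>I. a t * ?g z t) = (\<Prod>j\<in>I. iexp ((\<Sum>t\<in>I. a t * c j t) * z j))"
        by (simp only: iexp_sum[OF fin])
    qed
    also have "\<dots> = (\<Prod>j\<in>I. \<integral>z. iexp ((\<Sum>t\<in>I. a t * c j t) * z) \<partial>std_normal_distribution)"
      by (intro D.product_integral_prod fin N.integrable_iexp_real) simp
    also have "\<dots> = (\<Prod>j\<in>I. exp (complex_of_real (- (1/2) * (\<Sum>t\<in>I. a t * c j t)\<^sup>2)))"
    proof -
      have "(\<integral>z. iexp (u * z) \<partial>std_normal_distribution) = exp (complex_of_real (- (1/2) * u\<^sup>2))" for u :: real
        using fun_cong[OF char_std_normal_distribution, of u] by (simp add: char_def flip: exp_of_real)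
      then show ?thesis by (simp only:)
    qed
    also have "\<dots> = exp (complex_of_real (- (1/2) * (\<Sum>j\<in>I. (\<Sum>t\<in>I. a t * c j t)\<^sup>2)))"
      by (simp add: exp_sum[OF fin, symmetric] sum_distrib_left)
    also have "(\<Sum>j\<in>I. (\<Sum>t\<in>I. a t * c j t)\<^sup>2) = (\<Sum>j\<in>I. \<Sum>s\<in>I. \<Sum>t\<in>I. a s * (c j s * c j t) * a t)"
      by (simp add: power2_eq_square sum_product mult_ac)
    also have "\<dots> = (\<Sum>s\<in>I. \<Sum>t\<in>I. \<Sum>j\<in>I. a s * (c j s * c j t) * a t)"
    proof -
      have "(\<Sum>j\<in>I. \<Sum>s\<in>I. \<Sum>t\<in>I. a s * (c j s * c j t) * a t) = (\<Sum>s\<in>I. \<Sum>j\<in>I. \<Sum>t\<in>I. a s * (c j s * c j t) * a t)"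
        by (rule sum.swap)
      also have "\<dots> = (\<Sum>s\<in>I. \<Sum>t\<in>I. \<Sum>j\<in>I. a s * (c j s * c j t) * a t)"
        by (intro sum.cong refl sum.swap)
      finally show ?thesis .
    qed
    also have "\<dots> = (\<Sum>s\<in>I. \<Sum>t\<in>I. a s * K s t * a t)"
      by (intro sum.cong refl) (simp add: c sum_distrib_left sum_distrib_right)
    finally show ?thesis
      by (simp only: of_real_mult of_real_minus of_real_divide of_real_1 of_real_numeral)
  qed
  moreover have "prob_space ?P"
    by (rule D.P.prob_space_distr) (rule g)
  ultimately show ?thesis by (intro exI[of _ ?P]) simp
qed

lemma joint_eval: "x \<in> space (path_space I) \<Longrightarrow> joint I (\<lambda>t x. x t) x = x"
  by (auto simp: joint_def space_PiM PiE_def extensional_def fun_eq_iff)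

lemma path_measure_eqI:
  fixes P Q :: "('t \<Rightarrow> real) measure"
  assumes "prob_space P" "prob_space Q" and sets: "sets P = sets (path_space I)" "sets Q = sets (path_space I)"
    and eq: "\<And>J (a :: 't \<Rightarrow> real). finite J \<Longrightarrow> J \<subseteq> I \<Longrightarrow> J \<noteq> {} \<Longrightarrow>
      (\<integral>x. iexp (\<Sum>t\<in>J. a t * x t) \<partial>P) = (\<integral>x. iexp (\<Sum>t\<in>J. a t * x t) \<partial>Q)"
  shows "P = Q"
proof -
  have rp: "real_process R I (\<lambda>t x. x t)" if "sets R = sets (path_space I)" for R
    unfolding real_process_def using measurable_component_singleton[of _ I "\<lambda>_. borel"] that
    by (simp cong: measurable_cong_sets)
  have id: "distr R (path_space I) (joint I (\<lambda>t x. x t)) = R" if R: "sets R = sets (path_space I)" for R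
  proof -
    have "distr R (path_space I) (joint I (\<lambda>t x. x t)) = distr R R (\<lambda>x. x)"
      by (rule distr_cong) (use R joint_eval sets_eq_imp_space_eq[OF R] in auto)
    then show ?thesis by (simp add: distr_id2)
  qed
  have "distr P (path_space I) (joint I (\<lambda>t x. x t)) = distr Q (path_space I) (joint I (\<lambda>t x. x t))"
    by (rule path_law_eqI[OF assms(1,2) rp[OF sets(1)] rp[OF sets(2)]]) (rule eq)
  then show ?thesis by (simp add: id sets)
qed

text \<open>
  Kolmogorov's extension theorem. The finite-dimensional laws are consistent because setting some of the
  coefficients \<open>a t\<close> to zero turns the transform on \<open>H\<close> into the one on a subset \<open>J\<close>.
\<close>

lemma gaussian_law_exists:
  fixes K :: "'t \<Rightarrow> 't \<Rightarrow> real"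
  assumes K: "nonneg_definite_on T K"
  shows "\<exists>\<Gamma>. prob_space \<Gamma> \<and> sets \<Gamma> = sets (path_space T) \<and>
    (\<forall>I (a :: 't \<Rightarrow> real). finite I \<and> I \<subseteq> T \<longrightarrow> (\<integral>x. iexp (\<Sum>t\<in>I. a t * x t) \<partial>\<Gamma>)
       = exp (- (1/2) * complex_of_real (\<Sum>s\<in>I. \<Sum>t\<in>I. a s * K s t * a t)))"
proof -
  define law where "law I P \<longleftrightarrow> prob_space P \<and> sets P = sets (path_space I) \<and>
    (\<forall>a :: 't \<Rightarrow> real. (\<integral>x. iexp (\<Sum>t\<in>I. a t * x t) \<partial>P)
       = exp (- (1/2) * complex_of_real (\<Sum>s\<in>I. \<Sum>t\<in>I. a s * K s t * a t)))" for I and P :: "('t \<Rightarrow> real) measure"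
  define P where "P I = (SOME P. law I P)" for I
  have "law I (P I)" if "finite I" "I \<subseteq> T" for I
    unfolding P_def
    by (rule someI_ex) (use finite_gaussian_law_exists[OF that(1) nonneg_definite_on_subset[OF K that(2)]] in \<open>unfold law_def\<close>)
  then have Pl: "\<And>I. finite I \<Longrightarrow> I \<subseteq> T \<Longrightarrow> prob_space (P I)"
      "\<And>I. finite I \<Longrightarrow> I \<subseteq> T \<Longrightarrow> sets (P I) = sets (path_space I)"
      "\<And>I (a :: 't \<Rightarrow> real). finite I \<Longrightarrow> I \<subseteq> T \<Longrightarrow> (\<integral>x. iexp (\<Sum>t\<in>I. a t * x t) \<partial>P I)
       = exp (- (1/2) * complex_of_real (\<Sum>s\<in>I. \<Sum>t\<in>I. a s * K s t * a t))"
    unfolding law_def by blast+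
  have P_sub: "(\<integral>x. iexp (\<Sum>t\<in>J. a t * x t) \<partial>P H)
       = exp (- (1/2) * complex_of_real (\<Sum>s\<in>J. \<Sum>t\<in>J. a s * K s t * a t))"
    if JH: "J \<subseteq> H" "finite H" "H \<subseteq> T" for J H and a :: "'t \<Rightarrow> real"
  proof -
    define a' where "a' = (\<lambda>t. if t \<in> J then a t else 0)"
    have 1: "(\<Sum>t\<in>H. a' t * x t) = (\<Sum>t\<in>J. a t * x t)" for x
      using JH by (intro sum.mono_neutral_cong_right) (auto simp: a'_def)
    have "(\<Sum>s\<in>H. \<Sum>t\<in>H. a' s * K s t * a' t) = (\<Sum>s\<in>J. \<Sum>t\<in>H. a' s * K s t * a' t)"
      using JH by (intro sum.mono_neutral_right) (auto simp: a'_def)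
    also have "\<dots> = (\<Sum>s\<in>J. \<Sum>t\<in>J. a s * K s t * a t)"
      using JH by (intro sum.cong refl sum.mono_neutral_cong_right) (auto simp: a'_def)
    finally show ?thesis using Pl(3)[of H a'] JH by (simp add: 1)
  qed
  interpret polish_projective T P
  proof (rule polish_projective.intro, rule projective_family.intro)
    fix J H assume JH: "J \<subseteq> H" "finite H" "H \<subseteq> T"
    then have J: "finite J" "J \<subseteq> T" by (auto intro: finite_subset)
    have m: "(\<lambda>f. restrict f J) \<in> measurable (P H) (path_space J)"
      using measurable_restrict_subset[OF JH(1), of "\<lambda>_. borel"] Pl(2)[OF JH(2,3)] by (simp cong: measurable_cong_sets)
    show "P J = distr (P H) (path_space J) (\<lambda>f. restrict f J)"
    proof (rule path_measure_eqI[where I = J])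
      fix I and a :: "'t \<Rightarrow> real" assume I: "finite I" "I \<subseteq> J"
      have meas: "(\<lambda>x. iexp (\<Sum>t\<in>I. a t * x t)) \<in> borel_measurable (path_space J)"
      proof -
        have [measurable]: "(\<lambda>x. x t) \<in> borel_measurable (path_space J)" if "t \<in> I" for t
          using that I(2) by (intro measurable_component_singleton) auto
        show ?thesis by measurable
      qed
      have "(\<integral>x. iexp (\<Sum>t\<in>I. a t * x t) \<partial>distr (P H) (path_space J) (\<lambda>f. restrict f J))
          = (\<integral>x. iexp (\<Sum>t\<in>I. a t * restrict x J t) \<partial>P H)"
        by (intro integral_distr m meas)
      also have "(\<lambda>x :: 't \<Rightarrow> real. \<Sum>t\<in>I. a t * restrict x J t) = (\<lambda>x. \<Sum>t\<in>I. a t * x t)"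
        by (rule ext, rule sum.cong) (use I in auto)
      finally show "(\<integral>x. iexp (\<Sum>t\<in>I. a t * x t) \<partial>P J) =
         (\<integral>x. iexp (\<Sum>t\<in>I. a t * x t) \<partial>distr (P H) (path_space J) (\<lambda>f. restrict f J))"
        using P_sub[OF I(2) J, of a] P_sub[OF subset_trans[OF I(2) JH(1)] JH(2,3), of a] by (simp only:)
    qed (use Pl(1,2)[OF J] Pl(1)[OF JH(2,3)] m in \<open>auto intro!: prob_space.prob_space_distr\<close>)
  qed (rule Pl(1))
  have "(\<integral>x. iexp (\<Sum>t\<in>I. a t * x t) \<partial>lim)
       = exp (- (1/2) * complex_of_real (\<Sum>s\<in>I. \<Sum>t\<in>I. a s * K s t * a t))"
    if I: "finite I" "I \<subseteq> T" for I and a :: "'t \<Rightarrow> real"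
  proof -
    have m: "(\<lambda>f. restrict f I) \<in> measurable lim (path_space I)"
      unfolding measurable_cong_sets[OF sets_lim refl] by (rule measurable_restrict_subset[OF I(2)])
    have eq: "distr lim (path_space I) (\<lambda>f. restrict f I) = P I"
    proof (rule measure_eqI)
      fix A assume A: "A \<in> sets (distr lim (path_space I) (\<lambda>f. restrict f I))"
      have "(\<lambda>f. restrict f I) -` A \<inter> space lim = prod_emb T (\<lambda>_. borel) I A"
        by (auto simp: prod_emb_def space_PiM)
      then show "emeasure (distr lim (path_space I) (\<lambda>f. restrict f I)) A = emeasure (P I) A"
        using A m I by (simp add: emeasure_distr emeasure_lim_emb)
    qed (simp add: Pl(2)[OF I])
    have meas: "(\<lambda>x. iexp (\<Sum>t\<in>I. a t * x t)) \<in> borel_measurable (path_space I)"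
      by measurable
    have "(\<integral>x. iexp (\<Sum>t\<in>I. a t * x t) \<partial>P I) = (\<integral>x. iexp (\<Sum>t\<in>I. a t * restrict x I t) \<partial>lim)"
      unfolding eq[symmetric] by (intro integral_distr m meas)
    also have "(\<lambda>x :: 't \<Rightarrow> real. \<Sum>t\<in>I. a t * restrict x I t) = (\<lambda>x. \<Sum>t\<in>I. a t * x t)"
      by (rule ext, rule sum.cong) auto
    finally show ?thesis unfolding Pl(3)[OF I, of a] by (rule sym)
  qed
  then show ?thesis
    by (intro exI[of _ lim] conjI allI impI P.prob_space_axioms sets_lim) blast
qed

lemma (in prob_space) centered_normal_of_char:
  fixes Y :: "'a \<Rightarrow> real"
  assumes Y[measurable]: "Y \<in> borel_measurable M" and v: "0 \<le> v"
    and ch: "\<And>u::real. (\<integral>w. iexp (u * Y w) \<partial>M) = exp (- (1/2) * complex_of_real (u\<^sup>2 * v))"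
  shows "gaussian_rv M Y" "integrable M Y" "expectation Y = 0"
    "integrable M (\<lambda>w. (Y w)\<^sup>2)" "expectation (\<lambda>w. (Y w)\<^sup>2) = v"
proof -
  let ?N = std_normal_distribution
  interpret N: real_distribution ?N by (rule real_dist_normal_dist)
  have law: "distr M borel Y = distr ?N borel (\<lambda>x. sqrt v * x)"
  proof (rule Levy_uniqueness)
    show "char (distr M borel Y) = char (distr ?N borel (\<lambda>x. sqrt v * x))"
    proof
      fix u
      have "char (distr ?N borel (\<lambda>x. sqrt v * x)) u = char ?N (u * sqrt v)"
        by (simp add: char_def integral_distr mult_ac)
      also have "\<dots> = exp (complex_of_real (- (1/2) * (u\<^sup>2 * v)))"
        unfolding char_std_normal_distribution using v by (simp add: power_mult_distrib flip: exp_of_real)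
      finally show "char (distr M borel Y) u = char (distr ?N borel (\<lambda>x. sqrt v * x)) u"
        using ch[of u] by (simp add: char_def integral_distr)
    qed
  qed (auto intro!: real_distribution_distr N.real_distribution_distr)
  have moments: "integrable ?N (\<lambda>x. x)" "integral\<^sup>L ?N (\<lambda>x. x) = 0" "integrable ?N (\<lambda>x. x\<^sup>2)" "integral\<^sup>L ?N (\<lambda>x. x\<^sup>2) = 1"
    using integrable_std_normal_distribution_moment[of 1] integral_std_normal_distribution_moment_odd[of 1]
      integrable_std_normal_distribution_moment[of 2] std_normal_distribution_even_moments(1)[of 1]
    by (auto simp: fact_numeral)
  have m: "(\<lambda>x. sqrt v * x) \<in> borel_measurable ?N" by simp
  note tr = same_law_transfer[OF law Y m]
  have idm: "(\<lambda>x::real. x) \<in> borel_measurable borel" by simp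
  show "integrable M Y"
    by (rule iffD2[OF tr(1)[OF idm]]) (rule integrable_mult_right[OF moments(1)])
  show "expectation Y = 0" using tr(2)[OF idm] by (simp only: integral_mult_right_zero moments(2) mult_zero_right)
  show "integrable M (\<lambda>w. (Y w)\<^sup>2)" "expectation (\<lambda>w. (Y w)\<^sup>2) = v"
  proof -
    have "(\<lambda>x. (sqrt v * x)\<^sup>2) = (\<lambda>x. v * x\<^sup>2)" using v by (simp add: power_mult_distrib fun_eq_iff)
    then show "integrable M (\<lambda>w. (Y w)\<^sup>2)" "expectation (\<lambda>w. (Y w)\<^sup>2) = v"
      using tr[where f = "\<lambda>x. x\<^sup>2"] integrable_mult_right[OF moments(3), of v]
      by (simp_all only: integral_mult_right_zero moments(4) mult_1_right borel_measurable_power idm)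
  qed
  \<comment> \<open>variance zero is the degenerate case of a constant\<close>
  show "gaussian_rv M Y"
  proof (cases "v = 0")
    case True
    have "AE x in distr ?N borel (\<lambda>x. sqrt v * x). x = 0"
      by (subst AE_distr_iff) (simp_all add: True)
    then have "AE w in M. Y w = 0"
      unfolding law[symmetric] by (subst (asm) AE_distr_iff) simp_all
    then show ?thesis unfolding gaussian_rv_def using Y by blast
  next
    case False
    have lborel: "distr A lborel f = distr A borel f" for A :: "'z measure" and f :: "'z \<Rightarrow> real"
      by (rule distr_cong) simp_all
    have "distr ?N lborel (\<lambda>x. x) = ?N" by (rule distr_id2) simp
    then have "distributed ?N lborel (\<lambda>x. x) (normal_density 0 1)"
      unfolding distributed_def by simp
    then have "distributed ?N lborel (\<lambda>x. 0 + sqrt v * x) (normal_density (0 + sqrt v * 0) (\<bar>sqrt v\<bar> * 1))"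
      using False by (intro N.normal_density_affine) auto
    then have "distr ?N borel (\<lambda>x. sqrt v * x) = density lborel (normal_density 0 (sqrt v))"
      using v unfolding distributed_def lborel by simp
    then have "distributed M lborel Y (normal_density 0 (sqrt v))"
      unfolding distributed_def lborel law by simp
    then show ?thesis using False v Y unfolding gaussian_rv_def by (metis order_less_le real_sqrt_gt_zero)
  qed
qed

text \<open>
  Every linear combination is centered normal with the variance read off from its transform, and the
  covariances follow from the variances of \<open>G s + G t\<close> by polarization.
\<close>

lemma centered_gaussian_process_of_char:
  fixes G :: "'t \<Rightarrow> 'w \<Rightarrow> real"
  assumes M: "prob_space M" and G: "real_process M T G" and K: "nonneg_definite_on T K"
    and ch: "\<And>I (a :: 't \<Rightarrow> real). finite I \<Longrightarrow> I \<subseteq> T \<Longrightarrow> (\<integral>w. iexp (\<Sum>t\<in>I. a t * G t w) \<partial>M)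
       = exp (- (1/2) * complex_of_real (\<Sum>s\<in>I. \<Sum>t\<in>I. a s * K s t * a t))"
  shows "centered_gaussian_process M T G K"
proof -
  interpret prob_space M by fact
  have Gm[measurable]: "G t \<in> borel_measurable M" if "t \<in> T" for t
    using G that by (simp add: real_process_def)
  have main: "gaussian_rv M (\<lambda>w. \<Sum>t\<in>I. a t * G t w)"
    "expectation (\<lambda>w. \<Sum>t\<in>I. a t * G t w) = 0"
    "integrable M (\<lambda>w. (\<Sum>t\<in>I. a t * G t w)\<^sup>2)"
    "expectation (\<lambda>w. (\<Sum>t\<in>I. a t * G t w)\<^sup>2) = (\<Sum>s\<in>I. \<Sum>t\<in>I. a s * K s t * a t)"
    if I: "finite I" "I \<subseteq> T" for I and a :: "'t \<Rightarrow> real"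
  proof -
    have m: "(\<lambda>w. \<Sum>t\<in>I. a t * G t w) \<in> borel_measurable M"
      using I by (auto intro!: borel_measurable_sum borel_measurable_times)
    have p: "0 \<le> (\<Sum>s\<in>I. \<Sum>t\<in>I. a s * K s t * a t)"
      using K I by (simp add: nonneg_definite_on_def)
    have c: "(\<integral>w. iexp (u * (\<Sum>t\<in>I. a t * G t w)) \<partial>M) = exp (- (1/2) * complex_of_real (u\<^sup>2 * (\<Sum>s\<in>I. \<Sum>t\<in>I. a s * K s t * a t)))" for u
    proof -
      have "(\<Sum>t\<in>I. (u * a t) * G t w) = u * (\<Sum>t\<in>I. a t * G t w)" for w
        by (simp add: sum_distrib_left mult.assoc)
      moreover have "(\<Sum>s\<in>I. \<Sum>t\<in>I. (u * a s) * K s t * (u * a t)) = u\<^sup>2 * (\<Sum>s\<in>I. \<Sum>t\<in>I. a s * K s t * a t)"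
        by (simp add: sum_distrib_left power2_eq_square mult_ac)
      ultimately show ?thesis using ch[OF I, of "\<lambda>t. u * a t"] by (simp only:)
    qed
    show "gaussian_rv M (\<lambda>w. \<Sum>t\<in>I. a t * G t w)"
    "expectation (\<lambda>w. \<Sum>t\<in>I. a t * G t w) = 0"
    "integrable M (\<lambda>w. (\<Sum>t\<in>I. a t * G t w)\<^sup>2)"
    "expectation (\<lambda>w. (\<Sum>t\<in>I. a t * G t w)\<^sup>2) = (\<Sum>s\<in>I. \<Sum>t\<in>I. a s * K s t * a t)"
      using centered_normal_of_char[OF m p c] by auto
  qed
  have mean: "expectation (G t) = 0" and sq: "integrable M (\<lambda>w. (G t w)\<^sup>2)" "expectation (\<lambda>w. (G t w)\<^sup>2) = K t t"
    if "t \<in> T" for t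
    using main[of "{t}" "\<lambda>_. 1"] that by auto
  have cov: "expectation (\<lambda>w. G s w * G t w) = K s t" if st: "s \<in> T" "t \<in> T" for s t
  proof (cases "s = t")
    case True
    then show ?thesis using sq[OF st(2)] by (simp add: power2_eq_square)
  next
    case False
    have i: "integrable M (\<lambda>w. (G s w + G t w)\<^sup>2)"
      "expectation (\<lambda>w. (G s w + G t w)\<^sup>2) = K s s + K s t + (K t s + K t t)"
      using main(3,4)[of "{s,t}" "\<lambda>_. 1"] st False by auto
    have "expectation (\<lambda>w. G s w * G t w) = expectation (\<lambda>w. ((G s w + G t w)\<^sup>2 - (G s w)\<^sup>2 - (G t w)\<^sup>2) / 2)"
      by (intro Bochner_Integration.integral_cong refl) (simp add: power2_eq_square algebra_simps)
    also have "\<dots> = (K s s + K s t + (K t s + K t t) - K s s - K t t) / 2"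
      using i sq[OF st(1)] sq[OF st(2)] by simp
    also have "K t s = K s t" using K st by (simp add: nonneg_definite_on_def)
    finally show ?thesis by simp
  qed
  show ?thesis
    unfolding centered_gaussian_process_def gaussian_process_def
  proof (intro conjI allI ballI impI G; (elim conjE)?)
    show "gaussian_rv M (\<lambda>w. \<Sum>t\<in>I. a t * G t w)" if "I \<subseteq> T" "finite I" for I and a :: "'t \<Rightarrow> real"
      using main(1) that by blast
    show "expectation (G t) = 0" if "t \<in> T" for t by (rule mean[OF that])
    show "expectation (\<lambda>w. (G s w - expectation (G s)) * (G t w - expectation (G t))) = K s t"
      if "s \<in> T" "t \<in> T" for s t
      using cov[OF that] mean[OF that(1)] mean[OF that(2)] by simp
  qed
qed

section \<open>Coding countably many real numbers in one\<close>

text \<open>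
  The ternary digits \<open>0\<close> and \<open>2\<close> are used, since binary digits are not determined by the number. Codes
  with first digit \<open>0\<close> are at most \<open>1/3\<close> and those with first digit \<open>2\<close> are at least \<open>2/3\<close>, which is why
  \<open>cantor_tail\<close> compares with \<open>1/2\<close>.
\<close>

definition cantor_code :: "(nat \<Rightarrow> bool) \<Rightarrow> real" where
  "cantor_code b = (\<Sum>k. (if b k then 2 else 0) / 3 ^ Suc k)"

primrec cantor_tail :: "nat \<Rightarrow> real \<Rightarrow> real" where
  "cantor_tail 0 y = y"
| "cantor_tail (Suc k) y = 3 * cantor_tail k y - (if cantor_tail k y > 1/2 then 2 else 0)"

definition cantor_bit :: "nat \<Rightarrow> real \<Rightarrow> bool" where
  "cantor_bit k y \<longleftrightarrow> cantor_tail k y > 1/2"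

lemma summable_cantor: "summable (\<lambda>k. (if b k then 2 else 0) / 3 ^ Suc k :: real)"
proof (rule summable_comparison_test')
  show "summable (\<lambda>k. (2/3) * (1/3) ^ k :: real)" by (intro summable_mult summable_geometric) simp
  show "norm ((if b k then 2 else 0) / 3 ^ Suc k :: real) \<le> (2/3) * (1/3) ^ k" for k
    by (simp add: field_simps)
qed

lemma cantor_code_bounds: "0 \<le> cantor_code b" "cantor_code b \<le> 1"
proof -
  show "0 \<le> cantor_code b"
    unfolding cantor_code_def by (intro suminf_nonneg summable_cantor) auto
  have "cantor_code b \<le> (\<Sum>k. (2/3) * (1/3) ^ k :: real)"
    unfolding cantor_code_def
    by (intro suminf_le summable_cantor summable_mult summable_geometric) (auto simp: field_simps)
  also have "\<dots> = 1" by (subst suminf_mult) (auto simp: suminf_geometric)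
  finally show "cantor_code b \<le> 1" .
qed

lemma cantor_code_Suc: "cantor_code b = (if b 0 then 2 else 0) / 3 + cantor_code (\<lambda>k. b (Suc k)) / 3"
proof -
  have "cantor_code b = (if b 0 then 2 else 0) / 3 + (\<Sum>k. (if b (Suc k) then 2 else 0) / 3 ^ Suc (Suc k))"
    using suminf_split_head[OF summable_cantor, of b] unfolding cantor_code_def by simp
  also have "(\<Sum>k. (if b (Suc k) then 2 else 0) / 3 ^ Suc (Suc k) :: real) = (\<Sum>k. (1/3) * ((if b (Suc k) then 2 else 0) / 3 ^ Suc k))"
    by (intro suminf_cong) simp
  also have "\<dots> = (1/3) * cantor_code (\<lambda>k. b (Suc k))"
    unfolding cantor_code_def by (rule suminf_mult[OF summable_cantor])
  finally show ?thesis by simp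
qed

lemma cantor_code_gt_half: "cantor_code b > 1/2 \<longleftrightarrow> b 0"
  using cantor_code_Suc[of b] cantor_code_bounds[of "\<lambda>k. b (Suc k)"] by auto

lemma cantor_tail_code: "cantor_tail k (cantor_code b) = cantor_code (\<lambda>i. b (i + k))"
proof (induction k)
  case (Suc k)
  show ?case
    using cantor_code_Suc[of "\<lambda>i. b (i + k)"] cantor_code_gt_half[of "\<lambda>i. b (i + k)"] by (simp add: Suc)
qed simp

lemma cantor_bit_code: "cantor_bit k (cantor_code b) = b k"
  unfolding cantor_bit_def cantor_tail_code cantor_code_gt_half by simp

lemma measurable_cantor_bit[measurable]: "Measurable.pred borel (cantor_bit k)"
proof -
  have [measurable]: "cantor_tail k \<in> borel_measurable borel" for k
    by (induction k) (auto simp: fun_eq_iff cong: measurable_cong)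
  show ?thesis unfolding cantor_bit_def by measurable
qed

lemma measurable_cantor_code[measurable (raw)]:
  assumes [measurable]: "\<And>k. Measurable.pred M (\<lambda>x. b x k)"
  shows "(\<lambda>x. cantor_code (b x)) \<in> borel_measurable M"
  unfolding cantor_code_def by measurable

text \<open>
  A real number is determined by the rationals above it, so a countable family is determined by countably
  many bits.
\<close>

definition encode_reals :: "('i::countable \<Rightarrow> real) \<Rightarrow> real" where
  "encode_reals x = cantor_code (\<lambda>k. case from_nat k :: 'i \<times> rat of (i, q) \<Rightarrow> x i \<le> of_rat q)"

text \<open>
  The infimum is taken in the extended reals, so that decoding is a measurable total function, also on
  numbers that are not codes.
\<close>

definition decode_reals :: "real \<Rightarrow> 'i::countable \<Rightarrow> real" where
  "decode_reals y = (\<lambda>i. real_of_ereal (INF q::rat. if cantor_bit (to_nat (i, q)) y then ereal (of_rat q) else \<infinity>))"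

lemma decode_encode_reals: "decode_reals (encode_reals x) = x"
proof
  fix i
  have "(INF q::rat. if x i \<le> of_rat q then ereal (of_rat q) else \<infinity>) = ereal (x i)"
  proof (rule antisym)
    show "(INF q::rat. if x i \<le> of_rat q then ereal (of_rat q) else \<infinity>) \<le> ereal (x i)"
    proof (rule ereal_le_epsilon2)
      fix e :: real assume "0 < e"
      then obtain q :: rat where "x i < of_rat q" "of_rat q < x i + e"
        using of_rat_dense[of "x i" "x i + e"] by auto
      then show "(INF q::rat. if x i \<le> of_rat q then ereal (of_rat q) else \<infinity>) \<le> ereal (x i) + ereal e"
        by (intro INF_lower2[of q]) auto
    qed
  qed (rule INF_greatest, simp)
  then show "decode_reals (encode_reals x) i = x i"
    by (simp add: decode_reals_def encode_reals_def cantor_bit_code)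
qed

lemma encode_reals_bounds: "0 \<le> encode_reals x" "encode_reals x \<le> 1"
  unfolding encode_reals_def by (rule cantor_code_bounds)+

lemma measurable_encode_reals: "encode_reals \<in> borel_measurable (\<Pi>\<^sub>M i\<in>(UNIV :: 'i::countable set). borel)"
proof -
  have "Measurable.pred (\<Pi>\<^sub>M i\<in>(UNIV :: 'i set). borel) (\<lambda>x :: 'i \<Rightarrow> real. case from_nat k :: 'i \<times> rat of (i, q) \<Rightarrow> x i \<le> of_rat q)" for k
    by (cases "from_nat k :: 'i \<times> rat") (simp, measurable)
  then show ?thesis unfolding encode_reals_def by measurable
qed

lemma measurable_decode_reals: "decode_reals \<in> measurable borel (\<Pi>\<^sub>M i\<in>(UNIV :: 'i::countable set). borel)"
proof (rule measurable_PiM_single')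
  show "(\<lambda>y. decode_reals y i) \<in> borel_measurable borel" for i :: 'i
    unfolding decode_reals_def by measurable
qed (auto simp: space_PiM)

text \<open>
  The map codes the sequence of indicators of the generators. A generator is the preimage of the set where
  one bit is true, and the preimages of Borel sets form a sigma-algebra.
\<close>

lemma countably_generated_separating_map:
  assumes "countably_generated_mod n"
  obtains h :: "'s \<Rightarrow> real" where "h \<in> borel_measurable n"
    "\<And>A. A \<in> sets n \<Longrightarrow> \<exists>D\<in>sets borel. sym_diff A (h -` D \<inter> space n) \<in> null_sets n"
proof -
  obtain S0 where S0: "S0 \<subseteq> sets n" "countable S0"
    "\<And>A. A \<in> sets n \<Longrightarrow> \<exists>B\<in>sigma_sets (space n) S0. sym_diff A B \<in> null_sets n"
    using assms unfolding countably_generated_mod_def by blast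
  define C where "C = from_nat_into (insert {} S0)"
  have C: "range C = insert {} S0"
    unfolding C_def using S0(2) by (intro range_from_nat_into) auto
  then have [measurable]: "C k \<in> sets n" for k using S0(1) by (metis insert_subset rangeI sets.empty_sets subsetD)
  define h where "h = (\<lambda>s. cantor_code (\<lambda>k. s \<in> C k))"
  have h[measurable]: "h \<in> borel_measurable n" unfolding h_def by measurable
  have "\<exists>D\<in>sets borel. B = h -` D \<inter> space n" if "B \<in> sigma_sets (space n) S0" for B
    using that
  proof induction
    case (Basic a)
    then obtain k where k: "a = C k" using C by (metis imageE insertCI)
    have "a = h -` {y. cantor_bit k y} \<inter> space n"
      using sets.sets_into_space[of a n] Basic S0(1) by (auto simp: h_def cantor_bit_code k)
    moreover have "{y. cantor_bit k y} \<in> sets borel" by measurable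
    ultimately show ?case by blast
  next
    case Empty
    then show ?case by (intro bexI[of _ "{}"]) auto
  next
    case (Compl a)
    then obtain D where "D \<in> sets borel" "a = h -` D \<inter> space n" by blast
    then show ?case by (intro bexI[of _ "- D"]) auto
  next
    case (Union a)
    then have "\<forall>i. \<exists>D. D \<in> sets borel \<and> a i = h -` D \<inter> space n" by blast
    then obtain D where D: "\<And>i. D i \<in> sets borel" "\<And>i. a i = h -` D i \<inter> space n" by metis
    then show ?case by (intro bexI[of _ "\<Union>i. D i"]) auto
  qed
  with S0(3) h show thesis by (metis that)
qed

section \<open>Transferring a random variable to another space\<close>

lemma AE_le_of_set_nn_integral_le:
  fixes f g :: "'a \<Rightarrow> ennreal"
  assumes [measurable]: "f \<in> borel_measurable L" "g \<in> borel_measurable L"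
    and fin: "(\<integral>\<^sup>+ x. g x \<partial>L) < \<infinity>"
    and le: "\<And>A. A \<in> sets L \<Longrightarrow> (\<integral>\<^sup>+ x\<in>A. f x \<partial>L) \<le> (\<integral>\<^sup>+ x\<in>A. g x \<partial>L)"
  shows "AE x in L. f x \<le> g x"
proof -
  define A where "A = {x \<in> space L. g x < f x}"
  have [measurable]: "A \<in> sets L" unfolding A_def by measurable
  have gA: "(\<integral>\<^sup>+ x\<in>A. g x \<partial>L) < \<infinity>"
    using fin by (rule order.strict_trans1[rotated]) (auto intro!: nn_integral_mono simp: indicator_def)
  have "(\<integral>\<^sup>+ x. f x * indicator A x - g x * indicator A x \<partial>L) = (\<integral>\<^sup>+ x\<in>A. f x \<partial>L) - (\<integral>\<^sup>+ x\<in>A. g x \<partial>L)"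
    using gA by (intro nn_integral_diff) (auto simp: A_def indicator_def)
  also have "\<dots> = 0" by (rule diff_eq_0_ennreal[OF order.strict_trans1[OF le gA[unfolded infinity_ennreal_def]] le]) simp_all
  finally have "AE x in L. f x * indicator A x - g x * indicator A x = 0"
    by (subst (asm) nn_integral_0_iff_AE) auto
  moreover have "AE x in L. x \<in> space L" by simp
  ultimately show ?thesis
  proof eventually_elim
    case (elim x)
    show ?case
    proof (rule ccontr)
      assume "\<not> f x \<le> g x"
      then have "x \<in> A" using elim by (auto simp: A_def)
      then have "f x - g x = 0" using elim by simp
      then show False using \<open>\<not> f x \<le> g x\<close>
        by (metis add_0 diff_add_cancel_ennreal nle_le)
    qed
  qed
qed

lemma emeasure_uniform_unit_le:
  "emeasure (uniform_measure lborel {0..1::real}) {u. ennreal u \<le> c} = min c 1"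
proof -
  have "{u. ennreal u \<le> c} \<in> sets borel" by measurable
  then have "emeasure (uniform_measure lborel {0..1::real}) {u. ennreal u \<le> c}
      = emeasure lborel ({0..1} \<inter> {u. ennreal u \<le> c})"
    by (simp add: emeasure_uniform_measure divide_ennreal_def)
  also have "\<dots> = min c 1"
  proof (cases c)
    case (real r)
    have "{0..1} \<inter> {u. ennreal u \<le> c} = {0..min r 1}" using real by auto
    then show ?thesis using real by (cases "r \<le> 1") (auto simp: min_def)
  next
    case top
    then have "{0..1::real} \<inter> {u. ennreal u \<le> c} = {0..1}" by auto
    then show ?thesis using top by simp
  qed
  finally show ?thesis .
qed

lemma joint_law_of_indep_elements:
  assumes M: "prob_space M" and ind: "indep_elements M Ma f Mb g"
  shows "distr M (Ma \<Otimes>\<^sub>M Mb) (\<lambda>w. (f w, g w)) = distr M Ma f \<Otimes>\<^sub>M distr M Mb g"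
proof -
  interpret prob_space M by fact
  have [measurable]: "f \<in> measurable M Ma" "g \<in> measurable M Mb"
    using ind by (auto simp: indep_elements_def)
  interpret F: prob_space "distr M Ma f" by (rule prob_space_distr) simp
  interpret G: prob_space "distr M Mb g" by (rule prob_space_distr) simp
  show ?thesis
  proof (rule pair_measure_eqI[symmetric])
    show "sigma_finite_measure (distr M Ma f)" "sigma_finite_measure (distr M Mb g)" by unfold_locales
    fix A B assume AB[measurable]: "A \<in> sets (distr M Ma f)" "B \<in> sets (distr M Mb g)"
    have "prob ((f -` A \<inter> space M) \<inter> (g -` B \<inter> space M)) = prob (f -` A \<inter> space M) * prob (g -` B \<inter> space M)"
      using ind AB unfolding indep_elements_def by (intro indep_setD) auto
    moreover have "(\<lambda>w. (f w, g w)) -` (A \<times> B) \<inter> space M = (f -` A \<inter> space M) \<inter> (g -` B \<inter> space M)"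
      by auto
    ultimately show "emeasure (distr M Ma f) A * emeasure (distr M Mb g) B =
        emeasure (distr M (Ma \<Otimes>\<^sub>M Mb) (\<lambda>w. (f w, g w))) (A \<times> B)"
      using AB by (simp add: emeasure_distr emeasure_eq_measure ennreal_mult)
  qed simp
qed

text \<open>
  Approximation from below by rationals makes it possible to describe the event \<open>\<eta> < r\<close> by countably many
  levels that are fixed beforehand; the sequence increases so that the events do.
\<close>

lemma dyadic_below:
  fixes r :: real
  assumes "0 < r"
  obtains q :: "nat \<Rightarrow> rat" where "incseq q" "\<And>k. 0 \<le> q k" "\<And>k. real_of_rat (q k) < r"
    "\<And>p. p < r \<Longrightarrow> \<exists>k. p \<le> real_of_rat (q k)"
proof -
  define q where "q = (\<lambda>k::nat. rat_of_int (\<lceil>2 ^ k * r\<rceil> - 1) / 2 ^ k)"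
  have rq: "real_of_rat (q k) = real_of_int (\<lceil>2 ^ k * r\<rceil> - 1) / 2 ^ k" for k
    by (simp add: q_def of_rat_divide of_rat_power of_rat_diff)
  have less: "real_of_rat (q k) < r" for k
  proof -
    have "real_of_int (\<lceil>2 ^ k * r\<rceil> - 1) < 2 ^ k * r" by linarith
    then show ?thesis unfolding rq by (simp add: field_simps)
  qed
  have inc: "q k \<le> q (Suc k)" for k
  proof -
    have "2 * (2 ^ k * r) \<le> real_of_int \<lceil>2 ^ Suc k * r\<rceil>" by (simp add: mult.assoc)
    moreover have "real_of_int \<lceil>2 ^ k * r\<rceil> < 2 ^ k * r + 1" by linarith
    ultimately have "real_of_int (2 * (\<lceil>2 ^ k * r\<rceil> - 1)) < real_of_int \<lceil>2 ^ Suc k * r\<rceil>" by simp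
    then have "2 * (\<lceil>2 ^ k * r\<rceil> - 1) \<le> \<lceil>2 ^ Suc k * r\<rceil> - 1" by linarith
    then have "real_of_int (2 * (\<lceil>2 ^ k * r\<rceil> - 1)) \<le> real_of_int (\<lceil>2 ^ Suc k * r\<rceil> - 1)"
      by (simp only: of_int_le_iff)
    then have "real_of_rat (q k) \<le> real_of_rat (q (Suc k))"
    proof -
      assume "real_of_int (2 * (\<lceil>2 ^ k * r\<rceil> - 1)) \<le> real_of_int (\<lceil>2 ^ Suc k * r\<rceil> - 1)"
      then have "real_of_int (2 * (\<lceil>2 ^ k * r\<rceil> - 1)) / 2 ^ Suc k \<le> real_of_int (\<lceil>2 ^ Suc k * r\<rceil> - 1) / 2 ^ Suc k"
        by (rule divide_right_mono) simp
      also have "real_of_int (2 * (\<lceil>2 ^ k * r\<rceil> - 1)) / 2 ^ Suc k = real_of_int (\<lceil>2 ^ k * r\<rceil> - 1) / 2 ^ k"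
        by (simp only: of_int_mult of_int_numeral power_Suc)
      finally show ?thesis unfolding rq .
    qed
    then show ?thesis by (simp add: of_rat_less_eq)
  qed
  have nonneg: "0 \<le> q k" for k
  proof -
    have "0 < \<lceil>2 ^ k * r\<rceil>" using assms by simp
    then show ?thesis unfolding q_def by simp
  qed
  have cof: "\<exists>k. p \<le> real_of_rat (q k)" if "p < r" for p
  proof -
    obtain k where k: "(1/2) ^ k < r - p"
      using real_arch_pow_inv[of "r - p" "1/2"] \<open>p < r\<close> by (simp, blast)
    have "2 ^ k * r \<le> real_of_int \<lceil>2 ^ k * r\<rceil>" by linarith
    then have "r - (1/2) ^ k \<le> real_of_rat (q k)"
      unfolding rq by (simp add: field_simps power_divide)
    then show ?thesis using k by (intro exI[of _ k]) linarith
  qed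
  show thesis
    by (rule that[of q]) (use inc nonneg less cof in \<open>auto intro!: incseq_SucI\<close>)
qed

lemma pair_law_eqI_lessThan:
  fixes X :: "'w \<Rightarrow> 'e" and Z :: "'w \<Rightarrow> real" and X' :: "'v \<Rightarrow> 'e" and Z' :: "'v \<Rightarrow> real"
  assumes M: "prob_space M" "prob_space M'"
    and [measurable]: "X \<in> measurable M E" "Z \<in> borel_measurable M" "X' \<in> measurable M' E" "Z' \<in> borel_measurable M'"
    and eq: "\<And>A r. A \<in> sets E \<Longrightarrow> emeasure M {w \<in> space M. X w \<in> A \<and> Z w < r} = emeasure M' {w \<in> space M'. X' w \<in> A \<and> Z' w < r}"
  shows "distr M (E \<Otimes>\<^sub>M borel) (\<lambda>w. (X w, Z w)) = distr M' (E \<Otimes>\<^sub>M borel) (\<lambda>w. (X' w, Z' w))"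
proof -
  interpret M: prob_space M by fact
  interpret M': prob_space M' by fact
  let ?P = "distr M (E \<Otimes>\<^sub>M borel) (\<lambda>w. (X w, Z w))"
  let ?P' = "distr M' (E \<Otimes>\<^sub>M borel) (\<lambda>w. (X' w, Z' w))"
  have slice: "emeasure M {w \<in> space M. X w \<in> A \<and> Z w \<in> B} = emeasure M' {w \<in> space M'. X' w \<in> A \<and> Z' w \<in> B}"
    if A[measurable]: "A \<in> sets E" and B[measurable]: "B \<in> sets borel" for A B
  proof -
    let ?D = "\<lambda>\<mu> f g. distr (restrict_space \<mu> {w \<in> space \<mu>. f w \<in> A}) borel g"
    have D: "emeasure (?D \<mu> f g) B = emeasure \<mu> {w \<in> space \<mu>. f w \<in> A \<and> g w \<in> B}"
      if [measurable]: "f \<in> measurable \<mu> E" "g \<in> borel_measurable \<mu>" "B \<in> sets borel"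
      for \<mu> :: "'z measure" and f g B
    proof -
      have "emeasure (?D \<mu> f g) B = emeasure (restrict_space \<mu> {w \<in> space \<mu>. f w \<in> A})
          (g -` B \<inter> space (restrict_space \<mu> {w \<in> space \<mu>. f w \<in> A}))"
        by (intro emeasure_distr measurable_restrict_space1) auto
      also have "g -` B \<inter> space (restrict_space \<mu> {w \<in> space \<mu>. f w \<in> A}) = {w \<in> space \<mu>. f w \<in> A \<and> g w \<in> B}"
        by (auto simp: space_restrict_space)
      also have "emeasure (restrict_space \<mu> {w \<in> space \<mu>. f w \<in> A}) \<dots> = emeasure \<mu> \<dots>"
        by (intro emeasure_restrict_space) auto
      finally show ?thesis .
    qed
    have "?D M X Z = ?D M' X' Z'"
    proof (rule measure_eqI_generator_eq[where \<Omega>=UNIV and E="range lessThan" and A="\<lambda>i. {..<real i}"])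
      show "Int_stable (range (lessThan :: real \<Rightarrow> real set))"
      proof (rule Int_stableI)
        fix a b :: "real set" assume "a \<in> range lessThan" "b \<in> range lessThan"
        then obtain x y where "a = {..<x}" "b = {..<y}" by auto
        then have "a \<inter> b = {..<min x y}" by auto
        then show "a \<inter> b \<in> range lessThan" by blast
      qed
      show "emeasure (?D M X Z) C = emeasure (?D M' X' Z') C" if "C \<in> range lessThan" for C
        using that eq[OF A] by (auto simp: D)
      show "sets (?D M X Z) = sigma_sets UNIV (range lessThan)" "sets (?D M' X' Z') = sigma_sets UNIV (range lessThan)"
        by (auto simp: borel_Iio)
      show "(\<Union>i. {..<real i}) = UNIV" by (auto intro: reals_Archimedean2)
    qed (auto simp: D M.emeasure_eq_measure)
    then show ?thesis using D[of X M Z B] D[of X' M' Z' B] by simp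
  qed
  show ?thesis
  proof (rule measure_eqI_generator_eq[OF Int_stable_pair_measure_generator[of E borel] pair_measure_closed,
      where A="\<lambda>_. space E \<times> UNIV"])
    fix C assume "C \<in> {a \<times> b | a b. a \<in> sets E \<and> b \<in> sets (borel :: real measure)}"
    then obtain A B where C: "C = A \<times> B" and [measurable]: "A \<in> sets E" "B \<in> sets (borel :: real measure)" by blast
    have "(\<lambda>w. (X w, Z w)) -` C \<inter> space M = {w \<in> space M. X w \<in> A \<and> Z w \<in> B}"
      "(\<lambda>w. (X' w, Z' w)) -` C \<inter> space M' = {w \<in> space M'. X' w \<in> A \<and> Z' w \<in> B}"
      by (auto simp: C)
    then show "emeasure ?P C = emeasure ?P' C"
      using slice by (simp add: emeasure_distr C)
  next
    show "range (\<lambda>_::nat. space E \<times> (UNIV::real set)) \<subseteq> {a \<times> b | a b. a \<in> sets E \<and> b \<in> sets borel}"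
    proof (rule image_subsetI, rule CollectI, intro exI conjI)
      show "space E \<times> (UNIV::real set) = space E \<times> UNIV" by (rule refl)
    qed simp_all
    show "emeasure ?P (space E \<times> UNIV) \<noteq> \<infinity>"
      using prob_space.emeasure_le_1[OF M.prob_space_distr, of "\<lambda>w. (X w, Z w)" "E \<Otimes>\<^sub>M borel" "space E \<times> UNIV"]
      by (auto simp: top_unique)
  qed (auto simp: sets_pair_measure space_pair_measure)
qed

text \<open>
  Let \<open>L\<close> be the common law of \<open>\<xi>\<close> and \<open>\<xi>'\<close>. For a rational level \<open>q\<close>, the conditional probability of
  \<open>\<eta>' \<le> q\<close> given \<open>\<xi>' = x\<close> is the Radon-Nikodym derivative \<open>F q x\<close> of the measure
  \<open>A \<mapsto> P(\<xi>' \<in> A, \<eta>' \<le> q)\<close> with respect to \<open>L\<close>. As \<open>U\<close> is uniform and independent of \<open>\<xi>\<close>, the event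
  \<open>U \<le> F q (\<xi>)\<close> has conditional probability \<open>F q x\<close> given \<open>\<xi> = x\<close>. The quantile transform, which takes for
  \<open>\<eta>\<close> the infimum of all \<open>q\<close> with \<open>U \<le> F q (\<xi>)\<close>, therefore has the right joint law with \<open>\<xi>\<close>.
\<close>

lemma transfer_real:
  fixes \<xi> :: "'w \<Rightarrow> 'e" and U :: "'w \<Rightarrow> real" and \<xi>' :: "'v \<Rightarrow> 'e" and \<eta>' :: "'v \<Rightarrow> real"
  assumes M: "prob_space M" "prob_space M'"
    and ind: "indep_elements M borel U E \<xi>" and U: "distr M borel U = uniform_measure lborel {0..1}"
    and [measurable]: "\<xi>' \<in> measurable M' E" "\<eta>' \<in> borel_measurable M'"
    and bounds: "\<And>v. 0 \<le> \<eta>' v" "\<And>v. \<eta>' v \<le> 1"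
    and law: "distr M E \<xi> = distr M' E \<xi>'"
  obtains \<eta> where "\<eta> \<in> borel_measurable M"
    "distr M (E \<Otimes>\<^sub>M borel) (\<lambda>w. (\<xi> w, \<eta> w)) = distr M' (E \<Otimes>\<^sub>M borel) (\<lambda>v. (\<xi>' v, \<eta>' v))"
proof -
  interpret M: prob_space M by fact
  interpret M': prob_space M' by fact
  have [measurable]: "\<xi> \<in> measurable M E" "U \<in> borel_measurable M"
    using ind by (auto simp: indep_elements_def)
  define L where "L = distr M E \<xi>"
  have L': "L = distr M' E \<xi>'" by (simp add: L_def law)
  have sL[measurable_cong]: "sets L = sets E" by (simp add: L_def)
  have spL: "space L = space E" by (simp add: L_def)
  interpret L: prob_space L unfolding L_def by (rule M.prob_space_distr) simp
  define \<nu> where "\<nu> = (\<lambda>q::rat. distr (density M' (indicator {v \<in> space M'. \<eta>' v \<le> of_rat q})) E \<xi>')"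
  have \<nu>: "emeasure (\<nu> q) A = emeasure M' {v \<in> space M'. \<xi>' v \<in> A \<and> \<eta>' v \<le> of_rat q}" if [measurable]: "A \<in> sets E" for q A
  proof -
    have "emeasure (\<nu> q) A = (\<integral>\<^sup>+ v. indicator {v \<in> space M'. \<eta>' v \<le> of_rat q} v * indicator (\<xi>' -` A \<inter> space M') v \<partial>M')"
      unfolding \<nu>_def by (subst emeasure_distr) (auto simp: emeasure_density)
    also have "\<dots> = (\<integral>\<^sup>+ v. indicator {v \<in> space M'. \<xi>' v \<in> A \<and> \<eta>' v \<le> of_rat q} v \<partial>M')"
      by (intro nn_integral_cong) (auto simp: indicator_def)
    finally show ?thesis by simp
  qed
  define F where "F = (\<lambda>q. RN_deriv L (\<nu> q))"
  have [measurable]: "F q \<in> borel_measurable L" for q unfolding F_def by simp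
  have F: "(\<integral>\<^sup>+ x\<in>A. F q x \<partial>L) = emeasure M' {v \<in> space M'. \<xi>' v \<in> A \<and> \<eta>' v \<le> of_rat q}"
    if A[measurable]: "A \<in> sets E" for A q
  proof -
    have "absolutely_continuous L (\<nu> q)"
      unfolding absolutely_continuous_def
    proof
      fix A assume "A \<in> null_sets L"
      then have A[measurable]: "A \<in> sets E" and "emeasure M' (\<xi>' -` A \<inter> space M') = 0"
        unfolding L' by (auto simp: null_sets_def emeasure_distr)
      moreover have "emeasure M' {v \<in> space M'. \<xi>' v \<in> A \<and> \<eta>' v \<le> of_rat q} \<le> emeasure M' (\<xi>' -` A \<inter> space M')"
        by (intro emeasure_mono) auto
      ultimately show "A \<in> null_sets (\<nu> q)"
        by (auto simp: null_sets_def \<nu>) (simp add: \<nu>_def)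
    qed
    then have "density L (F q) = \<nu> q"
      unfolding F_def by (rule L.density_RN_deriv) (simp add: \<nu>_def sL)
    then have "emeasure (density L (F q)) A = emeasure (\<nu> q) A" by simp
    then show ?thesis using A by (simp add: \<nu> emeasure_density)
  qed
  have F_fin: "(\<integral>\<^sup>+ x. F q x \<partial>L) < \<infinity>" for q
  proof -
    have "(\<integral>\<^sup>+ x. F q x \<partial>L) = (\<integral>\<^sup>+ x\<in>space E. F q x \<partial>L)"
      by (intro nn_integral_cong) (auto simp: spL)
    then show ?thesis unfolding F[OF sets.top] by (simp add: M'.emeasure_eq_measure)
  qed
  have F_mono: "AE x in L. F p x \<le> F q x" if "p \<le> q" for p q
  proof (rule AE_le_of_set_nn_integral_le)
    fix A assume "A \<in> sets L"
    then have A: "A \<in> sets E" by (simp add: sL)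
    show "(\<integral>\<^sup>+ x\<in>A. F p x \<partial>L) \<le> (\<integral>\<^sup>+ x\<in>A. F q x \<partial>L)"
      unfolding F[OF A] using A that
      by (intro emeasure_mono) (auto intro: order_trans simp: of_rat_less_eq)
  qed (use F_fin in auto)
  have F_le1: "AE x in L. F q x \<le> 1" for q
  proof (rule AE_le_of_set_nn_integral_le)
    fix A assume "A \<in> sets L"
    then have A[measurable]: "A \<in> sets E" by (simp add: sL)
    have "(\<integral>\<^sup>+ x\<in>A. 1 \<partial>L) = emeasure M' (\<xi>' -` A \<inter> space M')"
      by (simp add: sL L' emeasure_distr)
    then show "(\<integral>\<^sup>+ x\<in>A. F q x \<partial>L) \<le> (\<integral>\<^sup>+ x\<in>A. 1 \<partial>L)"
      unfolding F[OF A] by (auto intro!: emeasure_mono)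
  qed (auto simp: L.emeasure_space_1)
  \<comment> \<open>conditional distribution functions are monotone almost everywhere; \<open>G\<close> is a version that is monotone everywhere\<close>
  define G where "G = (\<lambda>q x. SUP p\<in>{..q}. F p x)"
  have [measurable]: "G q \<in> borel_measurable E" for q
    unfolding G_def measurable_cong_sets[OF sL[symmetric] refl] by (intro borel_measurable_SUP) auto
  have G_mono: "G p x \<le> G q x" if "p \<le> q" for p q x
    unfolding G_def using that by (intro SUP_subset_mono) auto
  have G_F: "AE x in L. G q x = F q x \<and> G q x \<le> 1" for q
  proof -
    have "AE x in L. \<forall>p\<in>{..q}. F p x \<le> F q x"
      by (subst AE_ball_countable) (auto intro: F_mono)
    then show ?thesis using F_le1[of q]
    proof eventually_elim
      case (elim x)
      then have "G q x = F q x" unfolding G_def by (intro antisym SUP_least SUP_upper) auto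
      then show ?case using elim by simp
    qed
  qed
  have law2: "distr M (borel \<Otimes>\<^sub>M E) (\<lambda>w. (U w, \<xi> w)) = uniform_measure lborel {0..1} \<Otimes>\<^sub>M L"
    using joint_law_of_indep_elements[OF M(1) ind] by (simp add: U L_def)
  interpret Unif: prob_space "uniform_measure lborel {0..1::real}"
    by (rule prob_space_uniform_measure) auto
  interpret UL: pair_prob_space "uniform_measure lborel {0..1::real}" L ..
  \<comment> \<open>the section at \<open>x\<close> of this event is an interval of uniform measure \<open>F q x\<close>\<close>
  have level: "emeasure M {w \<in> space M. \<xi> w \<in> A \<and> ennreal (U w) \<le> G q (\<xi> w)} =
      emeasure M' {v \<in> space M'. \<xi>' v \<in> A \<and> \<eta>' v \<le> of_rat q}" if A[measurable]: "A \<in> sets E" for A q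
  proof -
    let ?S = "{z \<in> space (borel \<Otimes>\<^sub>M E). snd z \<in> A \<and> ennreal (fst z) \<le> G q (snd z)}"
    have S: "?S \<in> sets (borel \<Otimes>\<^sub>M E)" by measurable
    have "emeasure M {w \<in> space M. \<xi> w \<in> A \<and> ennreal (U w) \<le> G q (\<xi> w)}
        = emeasure (distr M (borel \<Otimes>\<^sub>M E) (\<lambda>w. (U w, \<xi> w))) ?S"
      using A[THEN sets.sets_into_space]
      by (subst emeasure_distr[OF _ S]) (auto simp: space_pair_measure intro!: arg_cong[where f="emeasure M"])
    also have "\<dots> = emeasure (uniform_measure lborel {0..1} \<Otimes>\<^sub>M L) ?S" by (simp add: law2)
    also have "\<dots> = (\<integral>\<^sup>+ x. emeasure (uniform_measure lborel {0..1}) ((\<lambda>u. (u, x)) -` ?S) \<partial>L)"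
    proof (rule UL.emeasure_pair_measure_alt2)
      have "sets (uniform_measure lborel {0..1::real} \<Otimes>\<^sub>M L) = sets (borel \<Otimes>\<^sub>M E)"
        by (intro sets_pair_measure_cong) (auto simp: sL)
      then show "?S \<in> sets (uniform_measure lborel {0..1} \<Otimes>\<^sub>M L)" using S by blast
    qed
    also have "\<dots> = (\<integral>\<^sup>+ x\<in>A. F q x \<partial>L)"
    proof (rule nn_integral_cong_AE)
      show "AE x in L. emeasure (uniform_measure lborel {0..1}) ((\<lambda>u. (u, x)) -` ?S) = F q x * indicator A x"
        using G_F[of q] AE_space
      proof eventually_elim
        case (elim x)
        have "(\<lambda>u. (u, x)) -` ?S = (if x \<in> A then {u. ennreal u \<le> G q x} else {})"
          using elim by (auto simp: space_pair_measure spL)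
        moreover have "emeasure (uniform_measure lborel {0..1}) {u. ennreal u \<le> G q x} = F q x"
          using elim(1) unfolding emeasure_uniform_unit_le by (metis min_absorb1)
        ultimately show ?case
          by (cases "x \<in> A") (simp_all only: if_True if_False emeasure_empty, auto)
      qed
    qed
    finally show ?thesis using F[OF A] by simp
  qed
  \<comment> \<open>the level 1 is always admitted, because \<open>\<eta>' \<le> 1\<close>; so the infimum is over a nonempty set\<close>
  define Q where "Q = (\<lambda>w. insert 1 {real_of_rat q | q. 0 \<le> q \<and> q < 1 \<and> ennreal (U w) \<le> G q (\<xi> w)})"
  define \<eta> where "\<eta> = (\<lambda>w. Inf (Q w))"
  have \<eta>_less: "\<eta> w < r \<longleftrightarrow> 1 < r \<or> (\<exists>q. 0 \<le> q \<and> q < 1 \<and> real_of_rat q < r \<and> ennreal (U w) \<le> G q (\<xi> w))" for w r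
  proof -
    have "bdd_below (Q w)" by (rule bdd_belowI[of _ 0]) (auto simp: Q_def)
    then have "Inf (Q w) < r \<longleftrightarrow> (\<exists>x\<in>Q w. x < r)" by (intro cInf_less_iff) (auto simp: Q_def)
    then show ?thesis unfolding \<eta>_def Q_def by auto
  qed
  have [measurable]: "\<eta> \<in> borel_measurable M"
    unfolding borel_measurable_iff_less \<eta>_less by measurable
  have "distr M (E \<Otimes>\<^sub>M borel) (\<lambda>w. (\<xi> w, \<eta> w)) = distr M' (E \<Otimes>\<^sub>M borel) (\<lambda>v. (\<xi>' v, \<eta>' v))"
  proof (rule pair_law_eqI_lessThan[OF M])
    fix A and r :: real assume A[measurable]: "A \<in> sets E"
    consider "1 < r" | "r \<le> 0" | "0 < r" "r \<le> 1" by linarith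
    then show "emeasure M {w \<in> space M. \<xi> w \<in> A \<and> \<eta> w < r} = emeasure M' {w \<in> space M'. \<xi>' w \<in> A \<and> \<eta>' w < r}"
    proof cases
      case 1
      have "emeasure (distr M E \<xi>) A = emeasure (distr M' E \<xi>') A" by (simp add: law)
      moreover have "\<eta>' w < r" for w using bounds(2)[of w] 1 by linarith
      moreover have "\<xi> -` A \<inter> space M = {w \<in> space M. \<xi> w \<in> A}" "\<xi>' -` A \<inter> space M' = {w \<in> space M'. \<xi>' w \<in> A}" by auto
      ultimately show ?thesis using 1 by (simp add: \<eta>_less emeasure_distr)
    next
      case 2
      have "\<not> \<eta> w < r" for w
      proof
        assume "\<eta> w < r"
        then obtain q where "0 \<le> q" "real_of_rat q < r" using 2 unfolding \<eta>_less by auto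
        then show False using 2 by (metis of_rat_0 of_rat_less_eq not_less order_trans)
      qed
      moreover have "\<not> \<eta>' w < r" for w using bounds(1)[of w] 2 by linarith
      ultimately show ?thesis by simp
    next
      case 3
      obtain q where q: "incseq q" "\<And>k. 0 \<le> q k" "\<And>k. real_of_rat (q k) < r"
        "\<And>p. p < r \<Longrightarrow> \<exists>k. p \<le> real_of_rat (q k)" using dyadic_below[OF 3(1)] by blast
      have q1: "q k < 1" for k
        using order_less_le_trans[OF q(3) 3(2), of k] by (metis of_rat_1 of_rat_less)
      have "{w \<in> space M. \<xi> w \<in> A \<and> \<eta> w < r} = (\<Union>k. {w \<in> space M. \<xi> w \<in> A \<and> ennreal (U w) \<le> G (q k) (\<xi> w)})"
      proof (intro set_eqI iffI)
        fix w assume w: "w \<in> {w \<in> space M. \<xi> w \<in> A \<and> \<eta> w < r}"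
        then obtain p where p: "real_of_rat p < r" "ennreal (U w) \<le> G p (\<xi> w)"
          using 3 unfolding \<eta>_less by auto
        obtain k where "real_of_rat p \<le> real_of_rat (q k)" using q(4)[OF p(1)] by blast
        then have "G p (\<xi> w) \<le> G (q k) (\<xi> w)" by (intro G_mono) (simp add: of_rat_less_eq)
        then show "w \<in> (\<Union>k. {w \<in> space M. \<xi> w \<in> A \<and> ennreal (U w) \<le> G (q k) (\<xi> w)})"
          using w p by (auto intro: order_trans)
      next
        fix w assume "w \<in> (\<Union>k. {w \<in> space M. \<xi> w \<in> A \<and> ennreal (U w) \<le> G (q k) (\<xi> w)})"
        then show "w \<in> {w \<in> space M. \<xi> w \<in> A \<and> \<eta> w < r}"
          unfolding \<eta>_less using q(2,3) q1 by blast
      qed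
      then have "emeasure M {w \<in> space M. \<xi> w \<in> A \<and> \<eta> w < r}
          = (SUP k. emeasure M {w \<in> space M. \<xi> w \<in> A \<and> ennreal (U w) \<le> G (q k) (\<xi> w)})"
        using q(1) by (subst SUP_emeasure_incseq) (auto simp: incseq_def intro: order_trans[OF _ G_mono])
      also have "\<dots> = (SUP k. emeasure M' {v \<in> space M'. \<xi>' v \<in> A \<and> \<eta>' v \<le> of_rat (q k)})"
        by (simp add: level)
      also have "\<dots> = emeasure M' (\<Union>k. {v \<in> space M'. \<xi>' v \<in> A \<and> \<eta>' v \<le> of_rat (q k)})"
        using q(1) by (intro SUP_emeasure_incseq) (auto simp: incseq_def of_rat_less_eq intro: order_trans)
      also have "(\<Union>k. {v \<in> space M'. \<xi>' v \<in> A \<and> \<eta>' v \<le> of_rat (q k)}) = {v \<in> space M'. \<xi>' v \<in> A \<and> \<eta>' v < r}"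
        using q(3,4) by (auto intro: order_le_less_trans)
      finally show ?thesis .
    qed
  qed measurable
  then show thesis by (rule that[rotated]) simp
qed

section \<open>Poisson laws\<close>

text \<open>
  The rate zero is included, since it occurs for null sets.
\<close>

definition poisson_law :: "real \<Rightarrow> nat pmf" where
  "poisson_law l = (if 0 < l then poisson_pmf l else return_pmf 0)"

lemma pmf_poisson_law: "0 \<le> l \<Longrightarrow> pmf (poisson_law l) k = l ^ k / fact k * exp (- l)"
  by (cases "k = 0") (auto simp: poisson_law_def)

lemma pmf_nat_sums:
  fixes f :: "nat \<Rightarrow> 'b::{banach, second_countable_topology}"
  assumes "integrable (measure_pmf p) f"
  shows "(\<lambda>k. pmf p k *\<^sub>R f k) sums (\<integral>k. f k \<partial>measure_pmf p)"
proof -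
  have "integrable (density (count_space UNIV) (pmf p)) f"
    using assms by (simp flip: measure_pmf_eq_density)
  then have i: "integrable (count_space UNIV) (\<lambda>k. pmf p k *\<^sub>R f k)"
    by (subst (asm) integrable_density) auto
  have "(\<integral>k. f k \<partial>measure_pmf p) = (\<integral>k. pmf p k *\<^sub>R f k \<partial>count_space UNIV)"
    unfolding measure_pmf_eq_density by (rule integral_density) auto
  then show ?thesis using sums_integral_count_space_nat[OF i] by simp
qed

lemma pmf_nat_integral_of_sums:
  fixes f :: "nat \<Rightarrow> real"
  assumes f: "\<And>k. 0 \<le> f k" and s: "(\<lambda>k. pmf p k * f k) sums s"
  shows "integrable (measure_pmf p) f" "(\<integral>k. f k \<partial>measure_pmf p) = s"
proof -
  have "integrable (count_space UNIV) (\<lambda>k. pmf p k *\<^sub>R f k)"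
    using f s by (auto simp: integrable_count_space_nat_iff sums_iff)
  then show i: "integrable (measure_pmf p) f"
    unfolding measure_pmf_eq_density by (subst integrable_density) auto
  show "(\<integral>k. f k \<partial>measure_pmf p) = s"
    using pmf_nat_sums[OF i] s by (simp add: sums_iff)
qed

lemma exp_sums: "(\<lambda>k. z ^ k / fact k) sums exp (z :: 'a::{real_normed_field,banach})"
  using exp_converges[of z] by (simp add: scaleR_conv_of_real field_simps)

lemma poisson_generating_function:
  fixes z :: complex
  assumes "0 \<le> l"
  shows "(\<lambda>k. pmf (poisson_law l) k *\<^sub>R z ^ k) sums exp (complex_of_real l * (z - 1))"
proof -
  have "(\<lambda>k. pmf (poisson_law l) k *\<^sub>R z ^ k) = (\<lambda>k. exp (- complex_of_real l) * ((complex_of_real l * z) ^ k / fact k))"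
    by (simp add: pmf_poisson_law assms scaleR_conv_of_real power_mult_distrib exp_of_real fun_eq_iff flip: of_real_minus)
  moreover have "(\<lambda>k. exp (- complex_of_real l) * ((complex_of_real l * z) ^ k / fact k)) sums
      (exp (- complex_of_real l) * exp (complex_of_real l * z))"
    by (intro sums_mult exp_sums)
  moreover have "exp (- complex_of_real l) * exp (complex_of_real l * z) = exp (complex_of_real l * (z - 1))"
    by (simp add: right_diff_distrib flip: exp_add)
  ultimately show ?thesis by simp
qed

lemma poisson_char:
  assumes "0 \<le> l"
  shows "(\<integral>k. iexp (u * real k) \<partial>measure_pmf (poisson_law l)) = exp (complex_of_real l * (iexp u - 1))"
proof -
  have "(\<lambda>k. pmf (poisson_law l) k *\<^sub>R iexp (u * real k)) sums (\<integral>k. iexp (u * real k) \<partial>measure_pmf (poisson_law l))"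
    by (rule pmf_nat_sums) (rule measure_pmf.integrable_iexp_real, simp)
  moreover have "iexp (u * real k) = iexp u ^ k" for k
    by (simp flip: exp_of_nat_mult add: mult_ac)
  ultimately show ?thesis
    using poisson_generating_function[OF assms, of "iexp u"] by (simp add: sums_iff)
qed

text \<open>
  Both moments come from the recursion \<open>pmf (Suc k) * Suc k = l * pmf k\<close>: applied once it gives the mean,
  applied twice the second factorial moment \<open>l^2\<close>.
\<close>

lemma poisson_moments:
  assumes l: "0 \<le> l"
  shows "integrable (measure_pmf (poisson_law l)) real" "(\<integral>k. real k \<partial>measure_pmf (poisson_law l)) = l"
    "integrable (measure_pmf (poisson_law l)) (\<lambda>k. (real k - l)\<^sup>2)"
    "(\<integral>k. (real k - l)\<^sup>2 \<partial>measure_pmf (poisson_law l)) = l"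
proof -
  let ?p = "measure_pmf (poisson_law l)"
  have e: "(\<lambda>k. exp (- l) * (l ^ k / fact k)) sums 1"
    using sums_mult[OF exp_sums[of l], of "exp (- l)"] by (simp add: exp_minus)
  have pmf_Suc: "pmf (poisson_law l) (Suc k) * real (Suc k) = l * pmf (poisson_law l) k" for k
    by (simp add: pmf_poisson_law l del: of_nat_Suc)
  have pmf_sums: "pmf (poisson_law l) sums 1"
    using e by (simp add: pmf_poisson_law l mult.commute[of "exp _"] cong: sums_cong)
  have "(\<lambda>k. pmf (poisson_law l) (Suc k) * real (Suc k)) sums l"
    unfolding pmf_Suc using sums_mult[OF pmf_sums, of l] by simp
  from sums_Suc[OF this] have s1: "(\<lambda>k. pmf (poisson_law l) k * real k) sums l" by simp
  have "pmf (poisson_law l) (Suc (Suc k)) * (real (Suc (Suc k)) * (real (Suc (Suc k)) - 1)) = l * (l * pmf (poisson_law l) k)" for k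
  proof -
    have "pmf (poisson_law l) (Suc (Suc k)) * (real (Suc (Suc k)) * (real (Suc (Suc k)) - 1))
        = (pmf (poisson_law l) (Suc (Suc k)) * real (Suc (Suc k))) * real (Suc k)" by simp
    also have "\<dots> = l * (pmf (poisson_law l) (Suc k) * real (Suc k))" by (simp only: pmf_Suc mult.assoc)
    finally show ?thesis unfolding pmf_Suc .
  qed
  then have "(\<lambda>k. pmf (poisson_law l) (Suc (Suc k)) * (real (Suc (Suc k)) * (real (Suc (Suc k)) - 1))) sums l\<^sup>2"
    using sums_mult[OF sums_mult[OF pmf_sums, of l], of l] by (simp add: power2_eq_square)
  from sums_Suc[OF sums_Suc[OF this]]
  have s2: "(\<lambda>k. pmf (poisson_law l) k * (real k * (real k - 1))) sums l\<^sup>2" by simp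
  note m1 = pmf_nat_integral_of_sums[OF _ s1]
  have nn: "0 \<le> real k * (real k - 1)" for k by (cases k) auto
  note m2 = pmf_nat_integral_of_sums[OF nn s2]
  show i1: "integrable ?p real" and e1: "(\<integral>k. real k \<partial>?p) = l" using m1 by auto
  have eq: "(\<lambda>k. (real k - l)\<^sup>2) = (\<lambda>k. real k * (real k - 1) + ((1 - 2 * l) * real k + l\<^sup>2))"
    by (auto simp: fun_eq_iff power2_eq_square algebra_simps)
  show "integrable ?p (\<lambda>k. (real k - l)\<^sup>2)"
    unfolding eq using i1 m2(1) by simp
  show "(\<integral>k. (real k - l)\<^sup>2 \<partial>?p) = l"
  proof -
    have "(\<integral>k. real k * (real k - 1) + ((1 - 2 * l) * real k + l\<^sup>2) \<partial>?p)
        = (\<integral>k. real k * (real k - 1) \<partial>?p) + ((1 - 2 * l) * (\<integral>k. real k \<partial>?p) + l\<^sup>2)"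
      using i1 m2(1) by (subst Bochner_Integration.integral_add) simp_all
    then show ?thesis unfolding eq m2(2) e1 by (simp add: power2_eq_square algebra_simps)
  qed
qed

text \<open>
  The Poisson probabilities add up to one, so almost surely no other value is taken.
\<close>

lemma poisson_rv_law:
  fixes Z :: "'w \<Rightarrow> ennreal"
  assumes M: "prob_space M" and Z[measurable]: "Z \<in> borel_measurable M" and l: "0 \<le> l"
    and P: "\<And>k::nat. measure M {w \<in> space M. Z w = of_nat k} = l ^ k / fact k * exp (- l)"
  shows "AE w in M. \<exists>k::nat. Z w = of_nat k"
    "distr M borel (\<lambda>w. enn2real (Z w)) = distr (measure_pmf (poisson_law l)) borel real"
proof -
  interpret prob_space M by fact
  let ?E = "\<lambda>k::nat. {w \<in> space M. Z w = of_nat k}"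
  have dis: "disjoint_family ?E" by (auto simp: disjoint_family_on_def)
  have "(\<lambda>k. prob (?E k)) sums prob (\<Union>k. ?E k)"
    by (intro finite_measure_UNION dis) auto
  moreover have "(\<lambda>k. prob (?E k)) sums 1"
    unfolding P using sums_mult2[OF exp_sums[of l], of "exp (- l)"] by (simp add: exp_minus)
  ultimately have "prob (\<Union>k. ?E k) = 1" by (simp add: sums_iff)
  then have "AE w in M. w \<in> (\<Union>k. ?E k)" by (subst (asm) prob_eq_1) auto
  then show ae: "AE w in M. \<exists>k::nat. Z w = of_nat k" by (rule AE_mp) (rule AE_I2, auto)
  show "distr M borel (\<lambda>w. enn2real (Z w)) = distr (measure_pmf (poisson_law l)) borel real"
  proof (rule measure_eqI)
    fix A assume "A \<in> sets (distr M borel (\<lambda>w. enn2real (Z w)))"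
    then have A[measurable]: "A \<in> sets borel" by simp
    have "emeasure (distr M borel (\<lambda>w. enn2real (Z w))) A = emeasure M {w \<in> space M. enn2real (Z w) \<in> A}"
      by (subst emeasure_distr) (auto intro!: arg_cong[where f="emeasure M"])
    also have "\<dots> = emeasure M (\<Union>k. if real k \<in> A then ?E k else {})"
    proof (rule emeasure_eq_AE)
      show "AE w in M. (w \<in> {w \<in> space M. enn2real (Z w) \<in> A}) = (w \<in> (\<Union>k. if real k \<in> A then ?E k else {}))"
        using ae AE_space by eventually_elim (auto split: if_splits)
    qed auto
    also have "\<dots> = (\<Sum>k. emeasure M (if real k \<in> A then ?E k else {}))"
      using dis by (intro suminf_emeasure[symmetric]) (auto simp: disjoint_family_on_def)
    also have "\<dots> = (\<Sum>k. ennreal (pmf (poisson_law l) k) * indicator {k. real k \<in> A} k)"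
      by (intro suminf_cong) (auto simp: emeasure_eq_measure P pmf_poisson_law l)
    also have "\<dots> = (\<integral>\<^sup>+ k. ennreal (pmf (poisson_law l) k) * indicator {k. real k \<in> A} k \<partial>count_space UNIV)"
      by (rule nn_integral_count_space_nat[symmetric])
    also have "\<dots> = emeasure (measure_pmf (poisson_law l)) {k. real k \<in> A}"
      unfolding measure_pmf_eq_density by (subst emeasure_density) auto
    also have "\<dots> = emeasure (distr (measure_pmf (poisson_law l)) borel real) A"
      by (subst emeasure_distr) (auto intro!: arg_cong[where f="emeasure _"])
    finally show "emeasure (distr M borel (\<lambda>w. enn2real (Z w))) A = emeasure (distr (measure_pmf (poisson_law l)) borel real) A" .
  qed simp
qed

lemma poisson_law_of_char:
  fixes Z :: "'w \<Rightarrow> real"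
  assumes M: "prob_space M" and Z[measurable]: "Z \<in> borel_measurable M" and l: "0 \<le> l"
    and ch: "\<And>u::real. (\<integral>w. iexp (u * Z w) \<partial>M) = exp (complex_of_real l * (iexp u - 1))"
  shows "distr M borel Z = distr (measure_pmf (poisson_law l)) borel real"
    "measure M {w \<in> space M. Z w = real k} = l ^ k / fact k * exp (- l)"
proof -
  interpret prob_space M by fact
  show law: "distr M borel Z = distr (measure_pmf (poisson_law l)) borel real"
  proof (rule Levy_uniqueness)
    show "char (distr M borel Z) = char (distr (measure_pmf (poisson_law l)) borel real)"
    proof
      fix u
      have "char (distr M borel Z) u = (\<integral>w. iexp (u * Z w) \<partial>M)"
        unfolding char_def by (rule integral_distr) simp_all
      moreover have "char (distr (measure_pmf (poisson_law l)) borel real) u = (\<integral>k. iexp (u * real k) \<partial>measure_pmf (poisson_law l))"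
        unfolding char_def by (rule integral_distr) simp_all
      ultimately show "char (distr M borel Z) u = char (distr (measure_pmf (poisson_law l)) borel real) u"
        by (simp only: ch poisson_char[OF l])
    qed
  qed (auto intro!: real_distribution_distr prob_space.real_distribution_distr[OF prob_space_measure_pmf])
  have "measure M {w \<in> space M. Z w = real k} = measure (distr M borel Z) {real k}"
    by (subst measure_distr) (auto intro!: arg_cong[where f=prob])
  also have "\<dots> = measure (measure_pmf (poisson_law l)) {k}"
    unfolding law by (subst measure_distr) (auto intro!: arg_cong[where f="measure _"])
  finally show "measure M {w \<in> space M. Z w = real k} = l ^ k / fact k * exp (- l)"
    by (simp add: measure_pmf_single pmf_poisson_law l)
qed

section \<open>Poisson random measures from independent points\<close>

lemma integral_uniform_measure_scaled:
  fixes F :: "'s \<Rightarrow> complex"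
  assumes S[measurable]: "S \<in> sets n" and pos: "0 < measure n S" and fin: "emeasure n S < \<infinity>"
    and F[measurable]: "F \<in> borel_measurable n"
  shows "complex_of_real (measure n S) * (\<integral>s. F s \<partial>uniform_measure n S) = (\<integral>s. indicator S s *\<^sub>R F s \<partial>n)"
proof -
  have eq: "uniform_measure n S = density n (\<lambda>s. ennreal (indicator S s / measure n S))"
    unfolding uniform_measure_def
  proof (rule density_cong)
    show "AE s in n. indicator S s / emeasure n S = ennreal (indicator S s / measure n S)"
      using pos fin
      by (auto simp: emeasure_eq_ennreal_measure divide_ennreal indicator_def simp flip: ennreal_1)
  qed auto
  have "(\<integral>s. F s \<partial>uniform_measure n S) = (\<integral>s. (indicator S s / measure n S) *\<^sub>R F s \<partial>n)"
    unfolding eq by (rule integral_density) (auto simp: pos)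
  also have "\<dots> = (\<integral>s. (1 / measure n S) *\<^sub>R (indicator S s *\<^sub>R F s) \<partial>n)"
    by simp
  also have "\<dots> = (1 / measure n S) *\<^sub>R (\<integral>s. indicator S s *\<^sub>R F s \<partial>n)"
    by (rule integral_scaleR_right)
  finally show ?thesis using pos by (simp add: scaleR_conv_of_real)
qed

text \<open>
  The blocks \<open>S j\<close> have finite measure. The map \<open>h\<close> records a point as a real number, and \<open>D A\<close> is the set of
  records of the points of \<open>A\<close>, up to null sets. In this way a random point of an arbitrary measurable space
  is replaced by a real random variable, and the noise lives on a countable product of real lines.
\<close>

locale coded_partition =
  fixes n :: "'s measure" and S :: "nat \<Rightarrow> 's set" and h :: "'s \<Rightarrow> real" and D :: "'s set \<Rightarrow> real set"
  assumes S_sets [measurable]: "\<And>j. S j \<in> sets n" and S_UN: "(\<Union>j. S j) = space n"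
    and S_fin: "\<And>j. emeasure n (S j) < \<infinity>" and S_disj: "disjoint_family S"
    and h [measurable]: "h \<in> borel_measurable n"
    and D_sets [measurable]: "\<And>A. A \<in> sets n \<Longrightarrow> D A \<in> sets borel"
    and D_null: "\<And>A. A \<in> sets n \<Longrightarrow> sym_diff A (h -` D A \<inter> space n) \<in> null_sets n"
begin

definition mass :: "nat \<Rightarrow> real" where "mass j = measure n (S j)"

definition point_law :: "nat \<Rightarrow> real measure" where
  "point_law j = (if 0 < mass j then distr (uniform_measure n (S j)) borel h else return borel 0)"

text \<open>
  The coordinate \<open>(j, 0)\<close> is the number of points in the block \<open>j\<close>, and the coordinates \<open>(j, Suc i)\<close> are the
  records of an infinite supply of points in that block, of which the first \<open>num j\<close> are used. A null block has
  no points, so that the law \<open>point_law j\<close> of its points is arbitrary.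
\<close>

definition coord_law :: "nat \<times> nat \<Rightarrow> real measure" where
  "coord_law = (\<lambda>(j, k). case k of 0 \<Rightarrow> distr (measure_pmf (poisson_law (mass j))) borel real | Suc _ \<Rightarrow> point_law j)"

definition points :: "(nat \<times> nat \<Rightarrow> real) measure" where
  "points = PiM UNIV coord_law"

definition num :: "nat \<Rightarrow> (nat \<times> nat \<Rightarrow> real) \<Rightarrow> nat" where
  "num j \<omega> = nat \<lfloor>\<omega> (j, 0)\<rfloor>"

definition block_sum :: "nat \<Rightarrow> (real \<Rightarrow> real) \<Rightarrow> (nat \<times> nat \<Rightarrow> real) \<Rightarrow> real" where
  "block_sum j f \<omega> = (\<Sum>i<num j \<omega>. f (\<omega> (j, Suc i)))"

text \<open>
  The number of points recorded in \<open>D A\<close>. It is not a measure in \<open>A\<close> for every \<open>\<omega>\<close>, because the choice of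
  \<open>D\<close> respects set operations only up to null sets.
\<close>

definition N :: "'s set \<Rightarrow> (nat \<times> nat \<Rightarrow> real) \<Rightarrow> ennreal" where
  "N A \<omega> = (\<Sum>j. \<Sum>i<num j \<omega>. indicator (D A) (\<omega> (j, Suc i)))"

lemma mass_nonneg: "0 \<le> mass j" by (simp add: mass_def)

lemma prob_uniform: "0 < mass j \<Longrightarrow> prob_space (uniform_measure n (S j))"
  using S_fin[of j] by (intro prob_space_uniform_measure) (auto simp: mass_def measure_def enn2real_positive_iff)

lemma point_law_prob: "prob_space (point_law j)"
  unfolding point_law_def using prob_uniform[of j]
  by (auto intro!: prob_space.prob_space_distr prob_space_return)

lemma sets_point_law: "sets (point_law j) = sets borel" by (simp add: point_law_def)

lemma coord_law_0: "coord_law (j, 0) = distr (measure_pmf (poisson_law (mass j))) borel real"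
  and coord_law_Suc: "coord_law (j, Suc i) = point_law j"
  by (simp_all add: coord_law_def)

lemma coord_law_prob: "prob_space (coord_law x)" and sets_coord_law: "sets (coord_law x) = sets borel"
proof -
  obtain j k where x: "x = (j, k)" by (cases x)
  have "prob_space (distr (measure_pmf p) borel real)" for p
    by (rule prob_space.prob_space_distr[OF prob_space_measure_pmf]) simp
  then show "prob_space (coord_law x)"
    using point_law_prob[of j]
    by (cases k) (simp_all add: x coord_law_0 coord_law_Suc)
  show "sets (coord_law x) = sets borel"
    by (cases k) (simp_all add: x coord_law_0 coord_law_Suc sets_point_law)
qed

sublocale C: product_prob_space coord_law UNIV
  using coord_law_prob by (auto simp: product_prob_space_def product_prob_space_axioms_def product_sigma_finite_def
      intro: prob_space_imp_sigma_finite)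

sublocale P: prob_space points
  unfolding points_def by (rule C.P.prob_space_axioms)

lemma sets_points: "sets points = sets (PiM UNIV (\<lambda>_. borel))"
  unfolding points_def by (rule sets_PiM_cong) (simp_all add: sets_coord_law)

lemma coord_distr: "distr points borel (\<lambda>\<omega>. \<omega> x) = coord_law x"
proof -
  have "distr points borel (\<lambda>\<omega>. \<omega> x) = distr points (coord_law x) (\<lambda>\<omega>. \<omega> x)"
    by (rule distr_cong) (simp_all add: sets_coord_law)
  then show ?thesis unfolding points_def using C.PiM_component[of x] by simp
qed

lemma measurable_coord: "(\<lambda>\<omega>. \<omega> x) \<in> borel_measurable points"
  unfolding measurable_cong_sets[OF sets_points refl] by (rule measurable_component_singleton) simp

lemma coords_indep: "P.indep_vars (\<lambda>_. borel) (\<lambda>x \<omega>. \<omega> x) UNIV"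
proof (subst P.indep_vars_iff_distr_eq_PiM)
  have "distr points (PiM UNIV (\<lambda>_. borel)) (\<lambda>\<omega>. \<lambda>x\<in>UNIV. \<omega> x) = distr points points (\<lambda>\<omega>. \<omega>)"
    by (rule distr_cong) (simp_all add: sets_points restrict_def)
  then show "distr points (PiM UNIV (\<lambda>_. borel)) (\<lambda>\<omega>. \<lambda>x\<in>UNIV. \<omega> x) = PiM UNIV (\<lambda>x. distr points borel (\<lambda>\<omega>. \<omega> x))"
    by (simp add: coord_distr distr_id2) (simp add: points_def)
qed (simp_all add: measurable_coord)

lemma measurable_coord_comp [measurable (raw)]:
  "f \<in> measurable borel M' \<Longrightarrow> (\<lambda>\<omega>. f (\<omega> x)) \<in> measurable points M'"
  by (rule measurable_compose[OF measurable_coord])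

lemma measurable_num [measurable]: "num j \<in> measurable points (count_space UNIV)"
proof -
  have "(\<lambda>x::real. nat \<lfloor>x\<rfloor>) \<in> measurable borel (count_space UNIV)"
    by (rule measurable_compose[OF measurable_real_floor]) simp
  from measurable_coord_comp[OF this, of "(j, 0)"] show ?thesis
    by (simp add: num_def[abs_def])
qed

lemma measurable_block_sum [measurable]:
  assumes [measurable]: "f \<in> borel_measurable borel"
  shows "block_sum j f \<in> borel_measurable points"
proof -
  have "block_sum j f = (\<lambda>\<omega>. \<Sum>i. if i < num j \<omega> then f (\<omega> (j, Suc i)) else 0)"
    unfolding block_sum_def
    by (rule ext, subst suminf_finite[of "{..<num j _}"]) auto
  then show ?thesis by simp
qed

lemma measurable_N [measurable]:
  assumes [measurable]: "A \<in> sets n"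
  shows "N A \<in> borel_measurable points"
proof -
  have "N A = (\<lambda>\<omega>. \<Sum>j. \<Sum>i. if i < num j \<omega> then indicator (D A) (\<omega> (j, Suc i)) else 0)"
    unfolding N_def
    by (rule ext, rule suminf_cong, subst suminf_finite[of "{..<num _ _}"]) auto
  then show ?thesis by simp
qed

lemma N_block_sum: "N A \<omega> = (\<Sum>j. ennreal (block_sum j (indicat_real (D A)) \<omega>))"
  unfolding N_def block_sum_def
  by (intro suminf_cong) (simp add: sum_ennreal[symmetric] del: sum_ennreal, simp add: ennreal_indicator)

lemma num_prob: "P.prob {\<omega> \<in> space points. num j \<omega> = k} = pmf (poisson_law (mass j)) k"
proof -
  have "P.prob {\<omega> \<in> space points. num j \<omega> = k} = measure (distr points borel (\<lambda>\<omega>. \<omega> (j, 0))) {x. nat \<lfloor>x\<rfloor> = k}"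
    by (subst measure_distr) (auto simp: num_def intro!: arg_cong[where f="measure points"])
  also have "\<dots> = measure (measure_pmf (poisson_law (mass j))) {k}"
    unfolding coord_distr coord_law_0 by (subst measure_distr) (auto intro!: arg_cong[where f="measure _"])
  finally show ?thesis by (simp add: measure_pmf_single)
qed

text \<open>
  Given that the block contains \<open>k\<close> points, the expectation is the \<open>k\<close>-th power of the transform \<open>\<phi>\<close> of
  a single summand; averaging over \<open>k\<close> gives the Poisson generating function at \<open>\<phi>\<close>.
\<close>

lemma block_sum_char:
  assumes f[measurable]: "f \<in> borel_measurable borel"
  shows "P.expectation (\<lambda>\<omega>. iexp (block_sum j f \<omega>)) = exp (complex_of_real (mass j) * ((\<integral>x. iexp (f x) \<partial>point_law j) - 1))"
proof -
  define \<phi> where "\<phi> = (\<integral>x. iexp (f x) \<partial>point_law j)"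
  \<comment> \<open>the contribution of the event that the block contains \<open>k\<close> points\<close>
  define g where "g = (\<lambda>k \<omega>. complex_of_real (indicator {\<omega>. num j \<omega> = k} \<omega>) * (\<Prod>i<k. iexp (f (\<omega> (j, Suc i)))))"
  have norm_g: "norm (g k \<omega>) = indicator {\<omega>. num j \<omega> = k} \<omega>" for k \<omega>
    by (simp add: g_def norm_mult prod_norm[symmetric])
  have [measurable]: "g k \<in> borel_measurable points" for k
    unfolding g_def by measurable
  have gi: "integrable points (g k)" for k
    by (rule P.integrable_const_bound[where B=1]) (auto simp: norm_g indicator_def)
  have sums_g: "(\<lambda>k. g k \<omega>) sums iexp (block_sum j f \<omega>)" for \<omega>
  proof -
    have "(\<lambda>k. g k \<omega>) = (\<lambda>k. if k = num j \<omega> then iexp (block_sum j f \<omega>) else 0)"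
      by (auto simp: g_def block_sum_def fun_eq_iff sum_distrib_left exp_sum)
    then show ?thesis using sums_single[of "num j \<omega>" "\<lambda>_. iexp (block_sum j f \<omega>)"] by simp
  qed
  have Eg: "P.expectation (g k) = pmf (poisson_law (mass j)) k *\<^sub>R \<phi> ^ k" for k
  proof -
    \<comment> \<open>\<open>g k\<close> as a product of functions of single coordinates\<close>
    define Y where "Y = (\<lambda>x :: nat \<times> nat. case snd x of 0 \<Rightarrow> (\<lambda>y. complex_of_real (indicator {y. nat \<lfloor>y\<rfloor> = k} y)) | Suc _ \<Rightarrow> (\<lambda>y. iexp (f y)))"
    have Ym: "Y x \<in> borel_measurable borel" for x
      by (cases "snd x") (simp_all add: Y_def)
    define J where "J = insert (j, 0) ((\<lambda>i. (j, Suc i)) ` {..<k})"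
    have prodJ: "(\<Prod>x\<in>J. F x) = F (j, 0) * (\<Prod>i<k. F (j, Suc i))" for F :: "nat \<times> nat \<Rightarrow> complex"
      unfolding J_def by (subst prod.insert) (auto simp: prod.reindex inj_on_def)
    have "P.indep_vars (\<lambda>_. borel) (\<lambda>x \<omega>. Y x (\<omega> x)) J"
      using P.indep_vars_compose2[OF P.indep_vars_subset[OF coords_indep subset_UNIV, of J], of Y "\<lambda>_. borel"] Ym by simp
    moreover have "integrable points (\<lambda>\<omega>. Y x (\<omega> x))" for x
      using Ym[of x] by (intro P.integrable_const_bound[where B=1])
        (auto simp: Y_def indicator_def split: nat.split intro!: measurable_compose[OF _ Ym[unfolded Y_def]])
    ultimately have "P.expectation (\<lambda>\<omega>. \<Prod>x\<in>J. Y x (\<omega> x)) = (\<Prod>x\<in>J. P.expectation (\<lambda>\<omega>. Y x (\<omega> x)))"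
      by (intro P.indep_vars_lebesgue_integral) (auto simp: J_def)
    moreover have "(\<lambda>\<omega>. \<Prod>x\<in>J. Y x (\<omega> x)) = g k"
      by (simp add: prodJ Y_def g_def num_def fun_eq_iff indicator_def)
    moreover have "P.expectation (\<lambda>\<omega>. Y (j, 0) (\<omega> (j, 0))) = complex_of_real (pmf (poisson_law (mass j)) k)"
    proof -
      have "P.expectation (\<lambda>\<omega>. Y (j, 0) (\<omega> (j, 0))) = P.expectation (\<lambda>\<omega>. complex_of_real (indicator {\<omega> \<in> space points. num j \<omega> = k} \<omega>))"
        by (intro Bochner_Integration.integral_cong) (auto simp: Y_def num_def indicator_def)
      also have "\<dots> = complex_of_real (P.prob ({\<omega> \<in> space points. num j \<omega> = k} \<inter> space points))"
        by simp
      also have "{\<omega> \<in> space points. num j \<omega> = k} \<inter> space points = {\<omega> \<in> space points. num j \<omega> = k}" by auto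
      finally show ?thesis by (simp add: num_prob)
    qed
    moreover have "P.expectation (\<lambda>\<omega>. Y (j, Suc i) (\<omega> (j, Suc i))) = \<phi>" for i
    proof -
      have "\<phi> = (\<integral>x. iexp (f x) \<partial>distr points borel (\<lambda>\<omega>. \<omega> (j, Suc i)))"
        by (simp add: \<phi>_def coord_distr coord_law_Suc)
      also have "\<dots> = P.expectation (\<lambda>\<omega>. iexp (f (\<omega> (j, Suc i))))"
        by (rule integral_distr) simp_all
      finally show ?thesis by (simp add: Y_def)
    qed
    ultimately show ?thesis by (simp add: prodJ scaleR_conv_of_real)
  qed
  have "(\<lambda>k. P.expectation (g k)) sums P.expectation (\<lambda>\<omega>. \<Sum>k. g k \<omega>)"
  proof (rule sums_integral)
    show "AE \<omega> in points. summable (\<lambda>k. norm (g k \<omega>))"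
    proof (rule AE_I2)
      fix \<omega>
      have "(\<lambda>k. norm (g k \<omega>)) = (\<lambda>k. if k = num j \<omega> then 1 else 0)"
        by (auto simp: norm_g indicator_def)
      then show "summable (\<lambda>k. norm (g k \<omega>))" by simp
    qed
    have "(\<integral>\<omega>. norm (g k \<omega>) \<partial>points) = pmf (poisson_law (mass j)) k" for k
    proof -
      have "(\<integral>\<omega>. norm (g k \<omega>) \<partial>points) = (\<integral>\<omega>. indicator {\<omega> \<in> space points. num j \<omega> = k} \<omega> \<partial>points)"
        by (intro Bochner_Integration.integral_cong) (auto simp: norm_g indicator_def)
      also have "\<dots> = P.prob ({\<omega> \<in> space points. num j \<omega> = k} \<inter> space points)" by simp
      also have "{\<omega> \<in> space points. num j \<omega> = k} \<inter> space points = {\<omega> \<in> space points. num j \<omega> = k}" by auto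
      finally show ?thesis by (simp add: num_prob)
    qed
    moreover have "summable (pmf (poisson_law (mass j)))"
      using pmf_nat_sums[of "poisson_law (mass j)" "\<lambda>_. 1::real"] by (auto simp: sums_iff)
    ultimately show "summable (\<lambda>k. \<integral>\<omega>. norm (g k \<omega>) \<partial>points)" by simp
  qed (rule gi)
  also have "(\<lambda>\<omega>. \<Sum>k. g k \<omega>) = (\<lambda>\<omega>. iexp (block_sum j f \<omega>))"
    using sums_g by (auto simp: sums_iff)
  finally show ?thesis
    using poisson_generating_function[OF mass_nonneg, of j \<phi>] by (simp add: Eg \<phi>_def sums_iff)
qed

lemma mass_integral_point_law:
  fixes F :: "real \<Rightarrow> complex"
  assumes F[measurable]: "F \<in> borel_measurable borel"
  shows "complex_of_real (mass j) * (\<integral>x. F x \<partial>point_law j) = (\<integral>s. indicator (S j) s *\<^sub>R F (h s) \<partial>n)"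
proof (cases "0 < mass j")
  case True
  have "(\<integral>x. F x \<partial>point_law j) = (\<integral>s. F (h s) \<partial>uniform_measure n (S j))"
    unfolding point_law_def using True by (auto intro!: integral_distr)
  then show ?thesis
    using integral_uniform_measure_scaled[OF S_sets _ S_fin, of j "\<lambda>s. F (h s)"] True by (simp add: mass_def)
next
  case False
  then have "mass j = 0" using mass_nonneg[of j] by simp
  then have "emeasure n (S j) = 0" using S_fin[of j] by (simp add: mass_def emeasure_eq_ennreal_measure)
  then have "S j \<in> null_sets n" by auto
  then have "AE s in n. s \<notin> S j" by (rule AE_not_in)
  then have "(\<integral>s. indicator (S j) s *\<^sub>R F (h s) \<partial>n) = (\<integral>s. 0 \<partial>n)"
    by (intro integral_cong_AE) auto
  then show ?thesis using \<open>mass j = 0\<close> by simp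
qed

lemma AE_code: assumes "A \<in> sets n" shows "AE s in n. h s \<in> D A \<longleftrightarrow> s \<in> A"
  using AE_not_in[OF D_null[OF assms]] AE_space by eventually_elim auto

text \<open>
  As the sets are disjoint, a point lies in at most one of them, and there the integrand
  \<open>iexp (f (h s)) - 1\<close> is \<open>iexp (c A) - 1\<close>. So the exponent splits into a sum over the sets, which expresses
  the independence of the counts.
\<close>

lemma block_sum_char_sets:
  assumes fin: "finite \<A>" and A: "\<A> \<subseteq> sets n" and dis: "disjoint \<A>"
  shows "P.expectation (\<lambda>\<omega>. iexp (\<Sum>A\<in>\<A>. c A * block_sum j (indicat_real (D A)) \<omega>)) =
    exp (\<Sum>A\<in>\<A>. complex_of_real (measure n (A \<inter> S j)) * (iexp (c A) - 1))"
proof -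
  define f where "f = (\<lambda>x. \<Sum>A\<in>\<A>. c A * indicat_real (D A) x)"
  have f[measurable]: "f \<in> borel_measurable borel"
    unfolding f_def using A by (auto intro!: borel_measurable_sum borel_measurable_times borel_measurable_indicator D_sets)
  have "(\<Sum>A\<in>\<A>. c A * block_sum j (indicat_real (D A)) \<omega>) = block_sum j f \<omega>" for \<omega>
    unfolding block_sum_def f_def by (subst sum.swap) (simp add: sum_distrib_left)
  then have "P.expectation (\<lambda>\<omega>. iexp (\<Sum>A\<in>\<A>. c A * block_sum j (indicat_real (D A)) \<omega>))
      = exp (complex_of_real (mass j) * ((\<integral>x. iexp (f x) \<partial>point_law j) - 1))"
    using block_sum_char[OF f] by simp
  also have "(\<integral>x. iexp (f x) \<partial>point_law j) - 1 = (\<integral>x. iexp (f x) - 1 \<partial>point_law j)"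
  proof -
    interpret p: prob_space "point_law j" by (rule point_law_prob)
    have "integrable (point_law j) (\<lambda>x. iexp (f x))"
      by (rule p.integrable_iexp_real) (simp add: sets_point_law cong: measurable_cong_sets)
    then show ?thesis by (simp add: p.prob_space)
  qed
  also have "complex_of_real (mass j) * (\<integral>x. iexp (f x) - 1 \<partial>point_law j) = (\<integral>s. indicator (S j) s *\<^sub>R (iexp (f (h s)) - 1) \<partial>n)"
    by (rule mass_integral_point_law) simp
  also have "\<dots> = (\<integral>s. (\<Sum>A\<in>\<A>. indicat_real (A \<inter> S j) s *\<^sub>R (iexp (c A) - 1)) \<partial>n)"
  proof (rule integral_cong_AE)
    have "AE s in n. \<forall>A\<in>\<A>. h s \<in> D A \<longleftrightarrow> s \<in> A"
      using fin A by (intro AE_finite_allI) (auto intro!: AE_code)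
    then show "AE s in n. indicator (S j) s *\<^sub>R (iexp (f (h s)) - 1) = (\<Sum>A\<in>\<A>. indicat_real (A \<inter> S j) s *\<^sub>R (iexp (c A) - 1))"
    proof eventually_elim
      case (elim s)
      have f_eq: "f (h s) = (\<Sum>A\<in>\<A>. c A * indicat_real A s)"
        unfolding f_def by (intro sum.cong) (auto simp: elim indicator_def)
      show ?case
      proof (cases "\<exists>A\<in>\<A>. s \<in> A")
        case True
        then obtain A where As: "A \<in> \<A>" "s \<in> A" by blast
        have other: "s \<notin> B" if "B \<in> \<A> - {A}" for B
          using disjointD[OF dis, of A B] As that by auto
        have "f (h s) = c A"
          unfolding f_eq using fin As other by (subst sum.remove[of _ A]) (auto intro!: sum.neutral)
        moreover have "(\<Sum>A\<in>\<A>. indicat_real (A \<inter> S j) s *\<^sub>R (iexp (c A) - 1)) = indicat_real (S j) s *\<^sub>R (iexp (c A) - 1)"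
          using fin As other by (subst sum.remove[of _ A]) (auto simp: indicator_def intro!: sum.neutral)
        ultimately show ?thesis by simp
      next
        case False
        then have "f (h s) = 0" unfolding f_eq by (auto intro!: sum.neutral)
        moreover have "(\<Sum>A\<in>\<A>. indicat_real (A \<inter> S j) s *\<^sub>R (iexp (c A) - 1)) = 0"
          using False by (intro sum.neutral) auto
        ultimately show ?thesis by simp
      qed
    qed
  qed (use A in \<open>auto intro!: borel_measurable_sum borel_measurable_scaleR borel_measurable_indicator\<close>)
  also have "\<dots> = (\<Sum>A\<in>\<A>. \<integral>s. indicat_real (A \<inter> S j) s *\<^sub>R (iexp (c A) - 1) \<partial>n)"
  proof (rule Bochner_Integration.integral_sum)
    fix A assume "A \<in> \<A>"
    then have [measurable]: "A \<in> sets n" using A by auto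
    have "emeasure n (A \<inter> S j) \<le> emeasure n (S j)" by (intro emeasure_mono) auto
    then have "emeasure n (A \<inter> S j) < \<infinity>" using S_fin[of j] by (rule order.strict_trans1)
    then show "integrable n (\<lambda>s. indicat_real (A \<inter> S j) s *\<^sub>R (iexp (c A) - 1))"
      by (intro integrable_scaleR_left integrable_real_indicator) auto
  qed
  also have "\<dots> = (\<Sum>A\<in>\<A>. complex_of_real (measure n (A \<inter> S j)) * (iexp (c A) - 1))"
  proof (rule sum.cong[OF refl])
    fix A assume "A \<in> \<A>"
    then have [measurable]: "A \<in> sets n" using A by auto
    have "A \<inter> S j \<inter> space n = A \<inter> S j" using sets.sets_into_space[OF S_sets[of j]] by auto
    have "emeasure n (A \<inter> S j) \<le> emeasure n (S j)" by (intro emeasure_mono) auto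
    then have "emeasure n (A \<inter> S j) < \<infinity>" using S_fin[of j] by (rule order.strict_trans1)
    then have "(\<integral>s. indicat_real (A \<inter> S j) s *\<^sub>R (iexp (c A) - 1) \<partial>n) = (\<integral>s. indicat_real (A \<inter> S j) s \<partial>n) *\<^sub>R (iexp (c A) - 1)"
      by (intro integral_scaleR_left integrable_real_indicator) auto
    then show "(\<integral>s. indicat_real (A \<inter> S j) s *\<^sub>R (iexp (c A) - 1) \<partial>n) = complex_of_real (measure n (A \<inter> S j)) * (iexp (c A) - 1)"
      by (simp add: scaleR_conv_of_real \<open>A \<inter> S j \<inter> space n = A \<inter> S j\<close>)
  qed
  finally show ?thesis .
qed

lemma emeasure_block_finite:
  assumes "A \<in> sets n"
  shows "emeasure n (A \<inter> S j) = ennreal (measure n (A \<inter> S j))"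
proof -
  have "emeasure n (A \<inter> S j) \<le> emeasure n (S j)" using assms by (intro emeasure_mono) auto
  then have "emeasure n (A \<inter> S j) < \<infinity>" using S_fin[of j] by (rule order.strict_trans1)
  then show ?thesis by (simp add: emeasure_eq_ennreal_measure)
qed

lemma indicator_code_measurable: "A \<in> sets n \<Longrightarrow> indicat_real (D A) \<in> borel_measurable borel"
  by (intro borel_measurable_indicator D_sets)

lemma block_sum_mean:
  assumes A: "A \<in> sets n"
  shows "(\<integral>\<^sup>+ \<omega>. ennreal (block_sum j (indicat_real (D A)) \<omega>) \<partial>points) = emeasure n (A \<inter> S j)"
proof -
  let ?B = "block_sum j (indicat_real (D A))"
  have B[measurable]: "?B \<in> borel_measurable points"
    by (intro measurable_block_sum indicator_code_measurable A)
  have ch: "P.expectation (\<lambda>\<omega>. iexp (u * ?B \<omega>)) = exp (complex_of_real (measure n (A \<inter> S j)) * (iexp u - 1))" for u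
    using block_sum_char_sets[of "{A}" "\<lambda>_. u" j] A by (simp add: disjoint_def)
  have law: "distr points borel ?B = distr (measure_pmf (poisson_law (measure n (A \<inter> S j)))) borel real"
    by (rule poisson_law_of_char(1)[OF P.prob_space_axioms B measure_nonneg ch])
  have "(\<integral>\<^sup>+ \<omega>. ennreal (?B \<omega>) \<partial>points) = (\<integral>\<^sup>+ x. ennreal x \<partial>distr points borel ?B)"
    by (subst nn_integral_distr) auto
  also have "\<dots> = (\<integral>\<^sup>+ k. ennreal (real k) \<partial>measure_pmf (poisson_law (measure n (A \<inter> S j))))"
    unfolding law by (subst nn_integral_distr) auto
  also have "\<dots> = ennreal (measure n (A \<inter> S j))"
    using poisson_moments(1,2)[OF measure_nonneg, of n "A \<inter> S j"] by (subst nn_integral_eq_integral) auto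
  finally show ?thesis by (simp only: emeasure_block_finite[OF A])
qed

lemma UN_blocks: "A \<in> sets n \<Longrightarrow> (\<Union>j. A \<inter> S j) = A"
  using S_UN sets.sets_into_space[of A n] by auto

lemma disjoint_blocks: "disjoint_family (\<lambda>j. A \<inter> S j)"
  using S_disj by (auto simp: disjoint_family_on_def)

lemma N_mean:
  assumes A: "A \<in> sets n"
  shows "(\<integral>\<^sup>+ \<omega>. N A \<omega> \<partial>points) = emeasure n A"
proof -
  have "(\<integral>\<^sup>+ \<omega>. N A \<omega> \<partial>points) = (\<Sum>j. \<integral>\<^sup>+ \<omega>. ennreal (block_sum j (indicat_real (D A)) \<omega>) \<partial>points)"
    unfolding N_block_sum
    by (intro nn_integral_suminf measurable_compose[OF measurable_block_sum measurable_ennreal] indicator_code_measurable A)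
  also have "\<dots> = (\<Sum>j. emeasure n (A \<inter> S j))" by (simp add: block_sum_mean A)
  also have "\<dots> = emeasure n (\<Union>j. A \<inter> S j)"
    using A by (intro suminf_emeasure disjoint_blocks) auto
  finally show ?thesis unfolding UN_blocks[OF A] .
qed

lemma blocks_indep:
  assumes f[measurable]: "f \<in> borel_measurable borel"
  shows "P.indep_vars (\<lambda>_. borel) (\<lambda>j. block_sum j f) UNIV"
proof -
  let ?K = "\<lambda>j::nat. {j} \<times> (UNIV :: nat set)"
  have ind: "P.indep_vars (\<lambda>j. PiM (?K j) (\<lambda>_. borel)) (\<lambda>j \<omega>. restrict (\<lambda>x. \<omega> x) (?K j)) UNIV"
    by (rule P.indep_vars_restrict[OF coords_indep]) (auto simp: disjoint_family_on_def)
  define Y where "Y = (\<lambda>j (x :: nat \<times> nat \<Rightarrow> real). \<Sum>i. if i < nat \<lfloor>x (j, 0)\<rfloor> then f (x (j, Suc i)) else 0)"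
  have Ym: "Y j \<in> borel_measurable (PiM (?K j) (\<lambda>_. borel))" for j
  proof -
    have c: "(\<lambda>x. x (j, i)) \<in> borel_measurable (PiM (?K j) (\<lambda>_. borel :: real measure))" for i
      by (rule measurable_component_singleton) simp
    have [measurable]: "(\<lambda>x. f (x (j, Suc i))) \<in> borel_measurable (PiM (?K j) (\<lambda>_. borel))" for i
      by (rule measurable_compose[OF c f])
    have "(\<lambda>x::real. nat \<lfloor>x\<rfloor>) \<in> measurable borel (count_space UNIV)"
      by (rule measurable_compose[OF measurable_real_floor]) simp
    from measurable_compose[OF c[of 0] this]
    have [measurable]: "(\<lambda>x :: nat \<times> nat \<Rightarrow> real. nat \<lfloor>x (j, 0)\<rfloor>) \<in> measurable (PiM (?K j) (\<lambda>_. borel)) (count_space UNIV)" .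
    show ?thesis unfolding Y_def by measurable
  qed
  have "P.indep_vars (\<lambda>_. borel) (\<lambda>j \<omega>. Y j (restrict (\<lambda>x. \<omega> x) (?K j))) UNIV"
    by (rule P.indep_vars_compose2[OF ind]) (rule Ym)
  also have "(\<lambda>j \<omega>. Y j (restrict (\<lambda>x. \<omega> x) (?K j))) = (\<lambda>j. block_sum j f)"
  proof (intro ext)
    fix j \<omega>
    have "Y j (restrict (\<lambda>x. \<omega> x) (?K j)) = (\<Sum>i. if i < num j \<omega> then f (\<omega> (j, Suc i)) else 0)"
      by (simp add: Y_def num_def restrict_def cong: if_cong)
    also have "\<dots> = block_sum j f \<omega>"
      unfolding block_sum_def by (subst suminf_finite[of "{..<num j \<omega>}"]) auto
    finally show "Y j (restrict (\<lambda>x. \<omega> x) (?K j)) = block_sum j f \<omega>" .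
  qed
  finally show ?thesis .
qed

lemma partial_char:
  assumes fin: "finite \<A>" and A: "\<A> \<subseteq> sets n" and dis: "disjoint \<A>"
  shows "P.expectation (\<lambda>\<omega>. iexp (\<Sum>A\<in>\<A>. c A * (\<Sum>j<J. block_sum j (indicat_real (D A)) \<omega>))) =
    exp (\<Sum>A\<in>\<A>. complex_of_real (\<Sum>j<J. measure n (A \<inter> S j)) * (iexp (c A) - 1))"
proof -
  define f where "f = (\<lambda>x. \<Sum>A\<in>\<A>. c A * indicat_real (D A) x)"
  have f[measurable]: "f \<in> borel_measurable borel"
    unfolding f_def using A by (auto intro!: borel_measurable_sum borel_measurable_times indicator_code_measurable)
  have eq: "(\<Sum>A\<in>\<A>. c A * block_sum j (indicat_real (D A)) \<omega>) = block_sum j f \<omega>" for j \<omega>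
    unfolding block_sum_def f_def by (subst sum.swap) (simp add: sum_distrib_left)
  have eq2: "(\<Sum>A\<in>\<A>. c A * (\<Sum>j<J. block_sum j (indicat_real (D A)) \<omega>)) = (\<Sum>j<J. block_sum j f \<omega>)" for \<omega>
    unfolding eq[symmetric] by (subst sum.swap) (simp add: sum_distrib_left)
  have "P.expectation (\<lambda>\<omega>. iexp (\<Sum>j<J. block_sum j f \<omega>)) = P.expectation (\<lambda>\<omega>. \<Prod>j<J. iexp (block_sum j f \<omega>))"
    by (simp add: sum_distrib_left exp_sum)
  also have "\<dots> = (\<Prod>j<J. P.expectation (\<lambda>\<omega>. iexp (block_sum j f \<omega>)))"
  proof (rule P.indep_vars_lebesgue_integral)
    show "P.indep_vars (\<lambda>_. borel) (\<lambda>j \<omega>. iexp (block_sum j f \<omega>)) {..<J}"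
      by (rule P.indep_vars_compose2[OF P.indep_vars_subset[OF blocks_indep[OF f] subset_UNIV]]) simp
    show "integrable points (\<lambda>\<omega>. iexp (block_sum j f \<omega>))" for j
      by (rule P.integrable_iexp_real) simp
  qed simp
  also have "\<dots> = (\<Prod>j<J. exp (\<Sum>A\<in>\<A>. complex_of_real (measure n (A \<inter> S j)) * (iexp (c A) - 1)))"
    unfolding eq[symmetric] by (simp only: block_sum_char_sets[OF fin A dis])
  also have "\<dots> = exp (\<Sum>j<J. \<Sum>A\<in>\<A>. complex_of_real (measure n (A \<inter> S j)) * (iexp (c A) - 1))"
    by (rule exp_sum[symmetric]) simp
  also have "(\<Sum>j<J. \<Sum>A\<in>\<A>. complex_of_real (measure n (A \<inter> S j)) * (iexp (c A) - 1)) =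
      (\<Sum>A\<in>\<A>. complex_of_real (\<Sum>j<J. measure n (A \<inter> S j)) * (iexp (c A) - 1))"
    by (subst sum.swap) (simp only: of_real_sum sum_distrib_right)
  finally show ?thesis unfolding eq2 .
qed

lemma block_sum_nonneg: "0 \<le> block_sum j (indicat_real E) \<omega>"
  unfolding block_sum_def by (intro sum_nonneg) auto

lemma partial_le_N: "ennreal (\<Sum>j<J. block_sum j (indicat_real (D A)) \<omega>) \<le> N A \<omega>"
proof -
  have "ennreal (\<Sum>j<J. block_sum j (indicat_real (D A)) \<omega>) = (\<Sum>j<J. ennreal (block_sum j (indicat_real (D A)) \<omega>))"
    by (rule sum_ennreal[symmetric]) (rule block_sum_nonneg)
  also have "\<dots> \<le> N A \<omega>" unfolding N_block_sum by (rule sum_le_suminf) auto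
  finally show ?thesis .
qed

lemma partial_tendsto:
  assumes "N A \<omega> < \<infinity>"
  shows "(\<lambda>J. \<Sum>j<J. block_sum j (indicat_real (D A)) \<omega>) \<longlonglongrightarrow> enn2real (N A \<omega>)"
proof -
  have "(\<lambda>J. \<Sum>j<J. ennreal (block_sum j (indicat_real (D A)) \<omega>)) \<longlonglongrightarrow> ennreal (enn2real (N A \<omega>))"
    using assms summable_LIMSEQ[of "\<lambda>j. ennreal (block_sum j (indicat_real (D A)) \<omega>)"] by (simp add: N_block_sum[symmetric] less_top)
  from tendsto_enn2real[OF this enn2real_nonneg] show ?thesis
    by (simp add: block_sum_nonneg sum_nonneg)
qed

lemma AE_N_finite: assumes "A \<in> sets n" "emeasure n A < \<infinity>" shows "AE \<omega> in points. N A \<omega> < \<infinity>"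
  using nn_integral_PInf_AE[of "N A" points] assms N_mean[of A] by (auto simp: less_top)

text \<open>
  The blocks are independent, which gives the formula for the first \<open>J\<close> blocks (\<open>partial_char\<close>); then \<open>J\<close>
  tends to infinity under dominated convergence.
\<close>

lemma N_char:
  assumes fin: "finite \<A>" and A: "\<A> \<subseteq> sets n" and dis: "disjoint \<A>" and A_fin: "\<And>A. A \<in> \<A> \<Longrightarrow> emeasure n A < \<infinity>"
  shows "P.expectation (\<lambda>\<omega>. iexp (\<Sum>A\<in>\<A>. c A * enn2real (N A \<omega>))) =
    exp (\<Sum>A\<in>\<A>. complex_of_real (measure n A) * (iexp (c A) - 1))"
proof -
  let ?Z = "\<lambda>J \<omega>. \<Sum>A\<in>\<A>. c A * (\<Sum>j<J. block_sum j (indicat_real (D A)) \<omega>)"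
  have [measurable]: "?Z J \<in> borel_measurable points" "(\<lambda>\<omega>. \<Sum>A\<in>\<A>. c A * enn2real (N A \<omega>)) \<in> borel_measurable points" for J
    using A by (auto intro!: borel_measurable_sum borel_measurable_times measurable_block_sum indicator_code_measurable
        measurable_compose[OF measurable_N borel_measurable_enn2real])
  have "(\<lambda>J. P.expectation (\<lambda>\<omega>. iexp (?Z J \<omega>))) \<longlonglongrightarrow> P.expectation (\<lambda>\<omega>. iexp (\<Sum>A\<in>\<A>. c A * enn2real (N A \<omega>)))"
  proof (rule integral_dominated_convergence[where w="\<lambda>_. 1"])
    have "AE \<omega> in points. \<forall>A\<in>\<A>. N A \<omega> < \<infinity>"
      using fin A A_fin by (intro AE_finite_allI AE_N_finite) auto
    then show "AE \<omega> in points. (\<lambda>J. iexp (?Z J \<omega>)) \<longlonglongrightarrow> iexp (\<Sum>A\<in>\<A>. c A * enn2real (N A \<omega>))"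
      by eventually_elim (intro tendsto_intros partial_tendsto, blast)
    show "(\<lambda>\<omega>. iexp (\<Sum>A\<in>\<A>. c A * enn2real (N A \<omega>))) \<in> borel_measurable points" by measurable
    show "(\<lambda>\<omega>. iexp (?Z J \<omega>)) \<in> borel_measurable points" for J by measurable
  qed (simp_all only: norm_exp_i_times order_refl eventually_True P.integrable_const)
  moreover have "(\<lambda>J. exp (\<Sum>A\<in>\<A>. complex_of_real (\<Sum>j<J. measure n (A \<inter> S j)) * (iexp (c A) - 1))) \<longlonglongrightarrow>
      exp (\<Sum>A\<in>\<A>. complex_of_real (measure n A) * (iexp (c A) - 1))"
  proof (intro tendsto_intros)
    fix A assume "A \<in> \<A>"
    then have A': "A \<in> sets n" "emeasure n A < \<infinity>" using A A_fin by auto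
    have "(\<lambda>j. measure n (A \<inter> S j)) sums measure n (\<Union>j. A \<inter> S j)"
    proof (rule measure_UNION[OF _ disjoint_blocks])
      show "range (\<lambda>j. A \<inter> S j) \<subseteq> sets n" using A' by auto
      show "emeasure n (\<Union>j. A \<inter> S j) \<noteq> \<infinity>" unfolding UN_blocks[OF A'(1)] using A'(2) by simp
    qed
    then show "(\<lambda>J. \<Sum>j<J. measure n (A \<inter> S j)) \<longlonglongrightarrow> measure n A"
      unfolding UN_blocks[OF A'(1)] sums_def .
  qed
  ultimately show ?thesis
    unfolding partial_char[OF fin A dis] by (rule LIMSEQ_unique)
qed

lemma N_poisson:
  assumes A: "A \<in> sets n" "emeasure n A < \<infinity>"
  shows "P.prob {\<omega> \<in> space points. N A \<omega> = of_nat k} = measure n A ^ k / fact k * exp (- measure n A)"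
proof -
  have [measurable]: "N A \<in> borel_measurable points" using A by simp
  have ch: "P.expectation (\<lambda>\<omega>. iexp (u * enn2real (N A \<omega>))) = exp (complex_of_real (measure n A) * (iexp u - 1))" for u
    using N_char[of "{A}" "\<lambda>_. u"] A by (simp add: disjoint_def)
  have "P.prob {\<omega> \<in> space points. enn2real (N A \<omega>) = real k} = measure n A ^ k / fact k * exp (- measure n A)"
    by (rule poisson_law_of_char(2)[OF P.prob_space_axioms _ measure_nonneg ch]) measurable
  moreover have "P.prob {\<omega> \<in> space points. enn2real (N A \<omega>) = real k} = P.prob {\<omega> \<in> space points. N A \<omega> = of_nat k}"
  proof (rule measure_eq_AE)
    show "AE \<omega> in points. (\<omega> \<in> {\<omega> \<in> space points. enn2real (N A \<omega>) = real k}) = (\<omega> \<in> {\<omega> \<in> space points. N A \<omega> = of_nat k})"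
      using AE_N_finite[OF A]
    proof eventually_elim
      case (elim \<omega>)
      then obtain r where "0 \<le> r" "N A \<omega> = ennreal r" by (cases "N A \<omega>") auto
      then show ?case by (auto simp: ennreal_of_nat_eq_real_of_nat)
    qed
  qed measurable
  ultimately show ?thesis by simp
qed

text \<open>
  The count in the first \<open>J\<close> blocks is Poisson with a rate \<open>l\<close> that tends to infinity with \<open>J\<close>, so the
  probability that it is at most \<open>k\<close> tends to \<open>0\<close> like a polynomial in \<open>l\<close> times \<open>exp (- l)\<close>.
\<close>

lemma N_infinite:
  assumes A: "A \<in> sets n" "emeasure n A = \<infinity>"
  shows "AE \<omega> in points. N A \<omega> = \<infinity>"
proof -
  let ?Z = "\<lambda>J \<omega>. \<Sum>j<J. block_sum j (indicat_real (D A)) \<omega>"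
  let ?l = "\<lambda>J. \<Sum>j<J. measure n (A \<inter> S j)"
  have [measurable]: "N A \<in> borel_measurable points" using A by simp
  have Z[measurable]: "?Z J \<in> borel_measurable points" for J
    using A by (intro borel_measurable_sum measurable_block_sum indicator_code_measurable) auto
  have l0: "0 \<le> ?l J" for J by (intro sum_nonneg) auto
  have l_top: "filterlim ?l at_top sequentially"
  proof -
    have "(\<lambda>J. \<Sum>j<J. emeasure n (A \<inter> S j)) \<longlonglongrightarrow> (\<Sum>j. emeasure n (A \<inter> S j))"
      by (rule summable_LIMSEQ) auto
    also have "(\<Sum>j. emeasure n (A \<inter> S j)) = emeasure n (\<Union>j. A \<inter> S j)"
      using A by (intro suminf_emeasure disjoint_blocks) auto
    also have "\<dots> = \<infinity>" unfolding UN_blocks[OF A(1)] by (rule A(2))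
    also have "(\<lambda>J. \<Sum>j<J. emeasure n (A \<inter> S j)) = (\<lambda>J. ennreal (?l J))"
      using A by (simp add: emeasure_block_finite sum_nonneg)
    finally have lim: "(\<lambda>J. ennreal (?l J)) \<longlonglongrightarrow> \<infinity>" .
    show ?thesis
      unfolding filterlim_at_top
    proof
      fix z :: real
      have "eventually (\<lambda>J. ennreal (max z 0) < ennreal (?l J)) sequentially"
        by (rule order_tendstoD(1)[OF lim]) simp
      then show "eventually (\<lambda>J. z \<le> ?l J) sequentially"
      proof eventually_elim
        case (elim J)
        then have "max z 0 < ?l J" by (subst (asm) ennreal_less_iff) simp_all
        then show ?case by simp
      qed
    qed
  qed
  have law: "distr points borel (?Z J) = distr (measure_pmf (poisson_law (?l J))) borel real" for J
  proof (rule poisson_law_of_char(1)[OF P.prob_space_axioms Z l0])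
    show "P.expectation (\<lambda>\<omega>. iexp (u * ?Z J \<omega>)) = exp (complex_of_real (?l J) * (iexp u - 1))" for u
      using partial_char[of "{A}" "\<lambda>_. u" J] A by (simp add: disjoint_def)
  qed
  have "P.prob {\<omega> \<in> space points. N A \<omega> \<le> of_nat k} = 0" for k :: nat
  proof -
    have "P.prob {\<omega> \<in> space points. N A \<omega> \<le> of_nat k} \<le> (\<Sum>i\<le>k. ?l J ^ i / fact i * exp (- ?l J))" for J
    proof -
      have "P.prob {\<omega> \<in> space points. N A \<omega> \<le> of_nat k} \<le> P.prob {\<omega> \<in> space points. ?Z J \<omega> \<le> real k}"
      proof (intro P.finite_measure_mono subsetI)
        fix \<omega> assume w: "\<omega> \<in> {\<omega> \<in> space points. N A \<omega> \<le> of_nat k}"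
        have "ennreal (?Z J \<omega>) \<le> ennreal (real k)"
          by (rule order_trans[OF partial_le_N]) (use w in \<open>simp add: ennreal_of_nat_eq_real_of_nat\<close>)
        then show "\<omega> \<in> {\<omega> \<in> space points. ?Z J \<omega> \<le> real k}" using w by simp
      qed measurable
      also have "\<dots> = measure (distr points borel (?Z J)) {..real k}"
        by (subst measure_distr) (auto intro!: arg_cong[where f=P.prob])
      also have "\<dots> = measure (measure_pmf (poisson_law (?l J))) {..k}"
        unfolding law by (subst measure_distr) (auto intro!: arg_cong[where f="measure _"])
      also have "\<dots> = (\<Sum>i\<le>k. ?l J ^ i / fact i * exp (- ?l J))"
        using l0 by (simp add: measure_measure_pmf_finite pmf_poisson_law)
      finally show ?thesis .
    qed
    moreover have "(\<lambda>J. \<Sum>i\<le>k. ?l J ^ i / fact i * exp (- ?l J)) \<longlonglongrightarrow> (\<Sum>i\<le>k. 0)"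
    proof (rule tendsto_sum)
      fix i
      have "(\<lambda>J. (1 / fact i) * (?l J ^ i / exp (?l J))) \<longlonglongrightarrow> (1 / fact i) * 0"
        by (intro tendsto_mult tendsto_const filterlim_compose[OF tendsto_power_div_exp_0 l_top])
      then show "(\<lambda>J. ?l J ^ i / fact i * exp (- ?l J)) \<longlonglongrightarrow> 0"
        by (simp add: exp_minus divide_inverse mult_ac)
    qed
    ultimately have "P.prob {\<omega> \<in> space points. N A \<omega> \<le> of_nat k} \<le> 0"
      by (intro LIMSEQ_le_const) auto
    then show ?thesis using measure_nonneg[of points] by (simp add: order_antisym)
  qed
  then have "AE \<omega> in points. \<not> N A \<omega> \<le> of_nat k" for k :: nat
    by (intro AE_I[where N="{\<omega> \<in> space points. N A \<omega> \<le> of_nat k}"]) (auto simp: P.emeasure_eq_measure)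
  then have "AE \<omega> in points. \<forall>k::nat. \<not> N A \<omega> \<le> of_nat k" by (simp add: AE_all_countable)
  then show ?thesis
  proof eventually_elim
    case (elim \<omega>)
    show ?case
    proof (rule ccontr)
      assume "N A \<omega> \<noteq> \<infinity>"
      then obtain k :: nat where "N A \<omega> < of_nat k" using ennreal_Ex_less_of_nat[of "N A \<omega>"] by (auto simp: less_top)
      then show False using elim by (auto dest: less_imp_le)
    qed
  qed
qed

text \<open>
  On sets of finite measure the joint transform factorizes. On the other sets \<open>N\<close> is almost surely infinite
  and carries no information: there \<open>Z\<close> replaces it by the constant \<open>0\<close>, and \<open>C\<close> is everything or nothing.
\<close>

lemma N_indep:
  assumes A: "\<A> \<subseteq> sets n" and dis: "disjoint \<A>"
  shows "P.indep_vars (\<lambda>_. borel) N \<A>"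
  unfolding P.indep_vars_def2
proof (intro conjI ballI)
  show "N A \<in> borel_measurable points" if "A \<in> \<A>" for A
    using that A by (intro measurable_N) auto
  show "P.indep_sets (\<lambda>A. {N A -` B \<inter> space points | B. B \<in> sets borel}) \<A>"
  proof (rule P.indep_setsI)
    show "{N A -` B \<inter> space points | B. B \<in> sets borel} \<subseteq> P.events" if "A \<in> \<A>" for A
      using that A by (auto intro!: measurable_sets[OF measurable_N])
    fix E J assume J: "J \<noteq> {}" "J \<subseteq> \<A>" "finite J" and "\<forall>A\<in>J. E A \<in> {N A -` B \<inter> space points | B. B \<in> sets borel}"
    then obtain B where B: "\<And>A. A \<in> J \<Longrightarrow> B A \<in> sets borel" "\<And>A. A \<in> J \<Longrightarrow> E A = N A -` B A \<inter> space points"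
      by (auto simp: Ball_def) metis
    have Js: "J \<subseteq> sets n" using J A by auto
    have Jd: "disjoint J" by (rule pairwise_subset[OF dis J(2)])
    define Z where "Z = (\<lambda>A \<omega>. if emeasure n A < \<infinity> then enn2real (N A \<omega>) else 0)"
    define C where "C = (\<lambda>A. if emeasure n A < \<infinity> then {x. ennreal x \<in> B A} else if \<infinity> \<in> B A then UNIV else ({} :: real set))"
    have Zm: "Z A \<in> borel_measurable points" if "A \<in> J" for A
      unfolding Z_def using that Js by (auto intro!: measurable_compose[OF measurable_N borel_measurable_enn2real])
    have Cm: "C A \<in> sets borel" if "A \<in> J" for A
    proof -
      have "ennreal -` B A \<inter> space borel \<in> sets borel"
        by (rule measurable_sets[OF measurable_ennreal B(1)[OF that]])
      then show ?thesis unfolding C_def by (auto simp: vimage_def)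
    qed
    have ZC: "AE \<omega> in points. N A \<omega> \<in> B A \<longleftrightarrow> Z A \<omega> \<in> C A" if "A \<in> J" for A
    proof (cases "emeasure n A < \<infinity>")
      case True
      have "AE \<omega> in points. N A \<omega> < \<infinity>" using that Js True by (intro AE_N_finite) auto
      then show ?thesis
      proof eventually_elim
        case (elim \<omega>)
        then have "ennreal (Z A \<omega>) = N A \<omega>" using True by (simp add: Z_def)
        then show ?case using True by (simp add: C_def)
      qed
    next
      case False
      then have "emeasure n A = \<infinity>" unfolding infinity_ennreal_def less_top[symmetric] by simp
      then have "AE \<omega> in points. N A \<omega> = \<infinity>" using that Js by (intro N_infinite) auto
      then show ?thesis by eventually_elim (use False in \<open>auto simp: Z_def C_def\<close>)
    qed
    have ch: "P.expectation (\<lambda>\<omega>. iexp (\<Sum>A\<in>I. a A * Z A \<omega>)) =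
        exp (\<Sum>A\<in>{A\<in>I. emeasure n A < \<infinity>}. complex_of_real (measure n A) * (iexp (a A) - 1))"
      if I: "I \<subseteq> J" for I a
    proof -
      have finI: "finite I" using I J finite_subset by blast
      have "(\<Sum>A\<in>I. a A * Z A \<omega>) = (\<Sum>A\<in>{A\<in>I. emeasure n A < \<infinity>}. a A * enn2real (N A \<omega>))" for \<omega>
        using finI by (intro sum.mono_neutral_cong_right) (auto simp: Z_def)
      moreover have "P.expectation (\<lambda>\<omega>. iexp (\<Sum>A\<in>{A\<in>I. emeasure n A < \<infinity>}. a A * enn2real (N A \<omega>))) =
          exp (\<Sum>A\<in>{A\<in>I. emeasure n A < \<infinity>}. complex_of_real (measure n A) * (iexp (a A) - 1))"
        using finI I Js by (intro N_char pairwise_subset[OF Jd]) auto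
      ultimately show ?thesis by (simp only:)
    qed
    have "P.prob {\<omega> \<in> space points. \<forall>A\<in>J. Z A \<omega> \<in> C A} = (\<Prod>A\<in>J. P.prob {\<omega> \<in> space points. Z A \<omega> \<in> C A})"
    proof (rule P.indep_of_char[OF J(3) Zm _ Cm])
      fix a :: "'s set \<Rightarrow> real"
      have single: "P.expectation (\<lambda>\<omega>. iexp (a A * Z A \<omega>)) = (if emeasure n A < \<infinity> then exp (complex_of_real (measure n A) * (iexp (a A) - 1)) else 1)" if "A \<in> J" for A
      proof -
        have "{B \<in> {A}. emeasure n B < \<infinity>} = (if emeasure n A < \<infinity> then {A} else {})" by auto
        then show ?thesis using ch[of "{A}" a] that by simp
      qed
      have "(\<Prod>A\<in>J. P.expectation (\<lambda>\<omega>. iexp (a A * Z A \<omega>))) =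
          (\<Prod>A\<in>J. if emeasure n A < \<infinity> then exp (complex_of_real (measure n A) * (iexp (a A) - 1)) else 1)"
        by (rule prod.cong[OF refl single])
      also have "\<dots> = (\<Prod>A\<in>{A\<in>J. emeasure n A < \<infinity>}. exp (complex_of_real (measure n A) * (iexp (a A) - 1)))"
        by (rule prod.inter_filter[symmetric, OF J(3)])
      also have "\<dots> = exp (\<Sum>A\<in>{A\<in>J. emeasure n A < \<infinity>}. complex_of_real (measure n A) * (iexp (a A) - 1))"
        using J(3) by (intro exp_sum[symmetric]) simp
      finally show "P.expectation (\<lambda>\<omega>. iexp (\<Sum>A\<in>J. a A * Z A \<omega>)) = (\<Prod>A\<in>J. P.expectation (\<lambda>\<omega>. iexp (a A * Z A \<omega>)))"
        unfolding ch[OF subset_refl] by (rule sym)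
    qed
    moreover have "P.prob (\<Inter>A\<in>J. E A) = P.prob {\<omega> \<in> space points. \<forall>A\<in>J. Z A \<omega> \<in> C A}"
    proof (rule measure_eq_AE)
      have "AE \<omega> in points. \<forall>A\<in>J. N A \<omega> \<in> B A \<longleftrightarrow> Z A \<omega> \<in> C A"
        by (rule AE_finite_allI[OF J(3)]) (rule ZC)
      then show "AE \<omega> in points. (\<omega> \<in> (\<Inter>A\<in>J. E A)) = (\<omega> \<in> {\<omega> \<in> space points. \<forall>A\<in>J. Z A \<omega> \<in> C A})"
        using AE_space
      proof eventually_elim
        case (elim \<omega>)
        have "\<omega> \<in> E A \<longleftrightarrow> Z A \<omega> \<in> C A" if "A \<in> J" for A
          using elim B(2)[OF that] that by simp
        then show ?case using elim(2) by simp
      qed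
      show "(\<Inter>A\<in>J. E A) \<in> P.events"
        by (rule sets.finite_INT[OF J(3,1)]) (use Js B in \<open>auto intro!: measurable_sets[OF measurable_N]\<close>)
      show "{\<omega> \<in> space points. \<forall>A\<in>J. Z A \<omega> \<in> C A} \<in> P.events"
        using J(1,3) Zm Cm by (intro sets.sets_Collect_finite_All') (auto intro!: measurable_sets_Collect)
    qed
    moreover have "P.prob (E A) = P.prob {\<omega> \<in> space points. Z A \<omega> \<in> C A}" if "A \<in> J" for A
    proof (rule measure_eq_AE)
      show "AE \<omega> in points. (\<omega> \<in> E A) = (\<omega> \<in> {\<omega> \<in> space points. Z A \<omega> \<in> C A})"
        using ZC[OF that] AE_space by eventually_elim (use B(2)[OF that] in auto)
      show "E A \<in> P.events" using that Js B by (auto intro!: measurable_sets[OF measurable_N])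
      show "{\<omega> \<in> space points. Z A \<omega> \<in> C A} \<in> P.events" using Zm[OF that] Cm[OF that] by measurable
    qed
    ultimately show "P.prob (\<Inter>A\<in>J. E A) = (\<Prod>A\<in>J. P.prob (E A))" by simp
  qed
qed

lemma AE_no_point_in_null:
  assumes E[measurable]: "E \<in> sets borel" and null: "emeasure n (h -` E \<inter> space n) = 0"
  shows "AE \<omega> in points. \<forall>j i. i < num j \<omega> \<longrightarrow> \<omega> (j, Suc i) \<notin> E"
proof -
  have "AE \<omega> in points. i < num j \<omega> \<longrightarrow> \<omega> (j, Suc i) \<notin> E" for j i
  proof (cases "0 < mass j")
    case True
    have "emeasure (uniform_measure n (S j)) (h -` E \<inter> space n) = 0"
    proof -
      have "emeasure n (S j \<inter> (h -` E \<inter> space n)) \<le> emeasure n (h -` E \<inter> space n)" by (intro emeasure_mono) auto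
      then show ?thesis using null by simp
    qed
    then have "AE x in point_law j. x \<notin> E"
      using True by (intro AE_not_in) (auto simp: null_sets_def point_law_def emeasure_distr)
    then have "AE x in distr points borel (\<lambda>\<omega>. \<omega> (j, Suc i)). x \<notin> E"
      unfolding coord_distr coord_law_Suc .
    then have "AE \<omega> in points. \<omega> (j, Suc i) \<notin> E"
      by (subst (asm) AE_distr_iff[OF measurable_coord]) auto
    then show ?thesis by eventually_elim simp
  next
    case False
    then have "mass j = 0" using mass_nonneg[of j] by simp
    then have "P.prob {\<omega> \<in> space points. num j \<omega> = 0} = 1"
      unfolding num_prob by (simp add: pmf_poisson_law)
    then have "AE \<omega> in points. \<omega> \<in> {\<omega> \<in> space points. num j \<omega> = 0}"
      by (subst (asm) P.prob_eq_1) auto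
    then show ?thesis by eventually_elim simp
  qed
  then show ?thesis by (simp add: AE_all_countable)
qed

text \<open>
  The indicators of \<open>D (\<Union>i. A i)\<close> and of the sets \<open>D (A i)\<close> are related as they should be outside a set \<open>E\<close>
  of records that a point almost surely avoids (\<open>AE_no_point_in_null\<close>). Off this event additivity is an
  interchange of two sums.
\<close>

lemma N_countably_additive:
  assumes A: "range A \<subseteq> sets n" and dis: "disjoint_family A"
  shows "AE \<omega> in points. N (\<Union>i. A i) \<omega> = (\<Sum>i. N (A i) \<omega>)"
proof -
  have Ai: "A i \<in> sets n" for i using A by auto
  have UA: "(\<Union>i. A i) \<in> sets n" using Ai by auto
  define E where "E = {x. (indicator (D (\<Union>i. A i)) x :: ennreal) \<noteq> (\<Sum>i. indicator (D (A i)) x)}"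
  have [measurable]: "D (A i) \<in> sets borel" "D (\<Union>i. A i) \<in> sets borel" for i
    using Ai UA by (auto intro: D_sets)
  have E: "E \<in> sets borel" unfolding E_def by measurable
  have "AE s in n. h s \<notin> E"
  proof -
    have "AE s in n. \<forall>i. h s \<in> D (A i) \<longleftrightarrow> s \<in> A i"
      by (subst AE_all_countable) (auto intro!: AE_code Ai)
    then show ?thesis using AE_code[OF UA]
    proof eventually_elim
      case (elim s)
      have "(\<Sum>i. indicator (D (A i)) (h s) :: ennreal) = (\<Sum>i. indicator (A i) s)"
        by (intro suminf_cong) (simp add: elim indicator_def)
      also have "\<dots> = indicator (\<Union>i. A i) s" by (rule suminf_indicator[OF dis])
      also have "\<dots> = indicator (D (\<Union>i. A i)) (h s)" using elim by (simp add: indicator_def)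
      finally show ?case by (simp add: E_def)
    qed
  qed
  then have "emeasure n {s \<in> space n. \<not> h s \<notin> E} = 0"
    using E by (subst (asm) AE_iff_measurable[OF _ refl]) auto
  also have "{s \<in> space n. \<not> h s \<notin> E} = h -` E \<inter> space n" by auto
  finally have "AE \<omega> in points. \<forall>j i. i < num j \<omega> \<longrightarrow> \<omega> (j, Suc i) \<notin> E"
    by (rule AE_no_point_in_null[OF E])
  then show ?thesis
  proof eventually_elim
    case (elim \<omega>)
    have "N (\<Union>i. A i) \<omega> = (\<Sum>j. \<Sum>l<num j \<omega>. \<Sum>i. indicator (D (A i)) (\<omega> (j, Suc l)))"
      unfolding N_def using elim by (intro suminf_cong sum.cong) (auto simp: E_def)
    also have "\<dots> = (\<Sum>j. \<Sum>i. \<Sum>l<num j \<omega>. indicator (D (A i)) (\<omega> (j, Suc l)))"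
      by (intro suminf_cong suminf_sum[symmetric]) auto
    \<comment> \<open>the interchange of the two infinite sums is monotone convergence for the counting measure\<close>
    also have "\<dots> = (\<integral>\<^sup>+ j. (\<Sum>i. \<Sum>l<num j \<omega>. indicator (D (A i)) (\<omega> (j, Suc l))) \<partial>count_space UNIV)"
      by (rule nn_integral_count_space_nat[symmetric])
    also have "\<dots> = (\<Sum>i. \<integral>\<^sup>+ j. (\<Sum>l<num j \<omega>. indicator (D (A i)) (\<omega> (j, Suc l))) \<partial>count_space UNIV)"
      by (rule nn_integral_suminf) simp
    also have "\<dots> = (\<Sum>i. N (A i) \<omega>)"
      unfolding N_def by (simp add: nn_integral_count_space_nat)
    finally show ?case .
  qed
qed

theorem N_poisson_random_measure: "poisson_random_measure points n N"
  unfolding poisson_random_measure_def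
proof (intro conjI ballI allI impI; (elim conjE)?)
  show "N A \<in> borel_measurable points" if "A \<in> sets n" for A by (rule measurable_N[OF that])
  show "P.prob {\<omega> \<in> space points. N A \<omega> = of_nat k} = measure n A ^ k / fact k * exp (- measure n A)"
    if "A \<in> sets n" "emeasure n A < \<infinity>" for A k by (rule N_poisson[OF that])
  show "AE \<omega> in points. N A \<omega> = \<infinity>" if "A \<in> sets n" "emeasure n A = \<infinity>" for A by (rule N_infinite[OF that])
  show "P.indep_vars (\<lambda>_. borel) N \<A>" if "\<A> \<subseteq> sets n" "disjoint \<A>" for \<A> by (rule N_indep[OF that])
  show "AE \<omega> in points. N (\<Union>i. A i) \<omega> = (\<Sum>i. N (A i) \<omega>)"
    if "range A \<subseteq> sets n" "disjoint_family A" for A by (rule N_countably_additive[OF that])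
qed

end

section \<open>Integrals of step functions\<close>

text \<open>
  If some \<open>i\<close> with \<open>\<bar>c i\<bar> \<ge> 1\<close> is counted at least once, then the right-hand side is at least \<open>1\<close>; otherwise
  no truncation occurs on the right and this is the triangle inequality. It is essential that the counts are
  integers.
\<close>

lemma min_sum_counts_le:
  fixes c :: "'i \<Rightarrow> real" and k :: "'i \<Rightarrow> nat"
  assumes fin: "finite I"
  shows "min \<bar>\<Sum>i\<in>I. c i * real (k i)\<bar> 1 \<le> (\<Sum>i\<in>I. min \<bar>c i\<bar> 1 * real (k i))"
proof (cases "\<exists>i\<in>I. 1 \<le> k i \<and> 1 \<le> \<bar>c i\<bar>")
  case True
  then obtain i where i: "i \<in> I" "1 \<le> k i" "1 \<le> \<bar>c i\<bar>" by blast
  have "min \<bar>\<Sum>i\<in>I. c i * real (k i)\<bar> 1 \<le> 1" by simp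
  also have "\<dots> \<le> min \<bar>c i\<bar> 1 * real (k i)" using i by simp
  also have "\<dots> \<le> (\<Sum>i\<in>I. min \<bar>c i\<bar> 1 * real (k i))"
    using i fin by (intro member_le_sum) auto
  finally show ?thesis .
next
  case False
  have "min \<bar>\<Sum>i\<in>I. c i * real (k i)\<bar> 1 \<le> \<bar>\<Sum>i\<in>I. c i * real (k i)\<bar>" by simp
  also have "\<dots> \<le> (\<Sum>i\<in>I. \<bar>c i * real (k i)\<bar>)" by (rule sum_abs)
  also have "\<dots> = (\<Sum>i\<in>I. min \<bar>c i\<bar> 1 * real (k i))"
  proof (rule sum.cong[OF refl])
    fix i assume "i \<in> I"
    then have "k i = 0 \<or> \<bar>c i\<bar> < 1" using False by (auto simp: not_le)
    then show "\<bar>c i * real (k i)\<bar> = min \<bar>c i\<bar> 1 * real (k i)" by (auto simp: abs_mult)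
  qed
  finally show ?thesis .
qed

definition finite_partition :: "'s measure \<Rightarrow> 's set set \<Rightarrow> bool" where
  "finite_partition n \<P> \<longleftrightarrow> finite \<P> \<and> disjoint \<P> \<and> \<P> \<subseteq> sets n \<and> {} \<notin> \<P> \<and> (\<forall>A\<in>\<P>. emeasure n A < \<infinity>)"

text \<open>
  The value on a nonempty set on which the function is constant.
\<close>

definition step_value :: "('s \<Rightarrow> 'b) \<Rightarrow> 's set \<Rightarrow> 'b" where
  "step_value g A = g (SOME s. s \<in> A)"

text \<open>
  Integrals of several step functions can be compared only after they are written as sums over the same
  finite partition; it is required that each function is constant on the cells and zero outside their union.
\<close>

definition adapted :: "'s measure \<Rightarrow> 's set set \<Rightarrow> ('s \<Rightarrow> 'b::zero) \<Rightarrow> bool" where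
  "adapted n \<P> g \<longleftrightarrow> (\<forall>A\<in>\<P>. \<forall>s\<in>A. g s = step_value g A) \<and> {s \<in> space n. g s \<noteq> 0} \<subseteq> \<Union>\<P>"

lemma adapted_expansion:
  fixes g :: "'s \<Rightarrow> 'b::real_vector"
  assumes P: "finite_partition n \<P>" and g: "adapted n \<P> g" and s: "s \<in> space n"
  shows "g s = (\<Sum>A\<in>\<P>. indicat_real A s *\<^sub>R step_value g A)"
proof (cases "\<exists>A\<in>\<P>. s \<in> A")
  case True
  then obtain A where A: "A \<in> \<P>" "s \<in> A" by blast
  have "s \<notin> B" if "B \<in> \<P> - {A}" for B
    using P A that by (auto simp: finite_partition_def disjoint_def)
  then have "(\<Sum>A\<in>\<P>. indicat_real A s *\<^sub>R step_value g A) = step_value g A"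
    using P A by (subst sum.remove[of _ A]) (auto simp: finite_partition_def intro!: sum.neutral)
  then show ?thesis using g A by (simp add: adapted_def)
next
  case False
  then have "g s = 0" using g s by (auto simp: adapted_def)
  moreover have "(\<Sum>A\<in>\<P>. indicat_real A s *\<^sub>R step_value g A) = 0"
    using False by (intro sum.neutral) auto
  ultimately show ?thesis by simp
qed

lemma integral_adapted:
  fixes g :: "'s \<Rightarrow> 'b::{banach, second_countable_topology}"
  assumes P: "finite_partition n \<P>" and g: "adapted n \<P> g"
  shows "integrable n g" "(\<integral>s. g s \<partial>n) = (\<Sum>A\<in>\<P>. measure n A *\<^sub>R step_value g A)"
proof -
  have i: "integrable n (\<lambda>s. indicat_real A s *\<^sub>R step_value g A)" if "A \<in> \<P>" for A
    using P that by (intro integrable_scaleR_left integrable_real_indicator) (auto simp: finite_partition_def)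
  have m: "(\<integral>s. indicat_real A s *\<^sub>R step_value g A \<partial>n) = measure n A *\<^sub>R step_value g A" if "A \<in> \<P>" for A
  proof -
    have A: "A \<in> sets n" "emeasure n A < \<infinity>" using P that by (auto simp: finite_partition_def)
    then have "A \<inter> space n = A" using sets.sets_into_space[of A n] by auto
    moreover have "(\<integral>s. indicat_real A s *\<^sub>R step_value g A \<partial>n) = (\<integral>s. indicat_real A s \<partial>n) *\<^sub>R step_value g A"
      using A by (intro integral_scaleR_left integrable_real_indicator)
    ultimately show ?thesis by simp
  qed
  have "integrable n (\<lambda>s. \<Sum>A\<in>\<P>. indicat_real A s *\<^sub>R step_value g A)"
    by (intro Bochner_Integration.integrable_sum i)
  moreover have "integrable n g \<longleftrightarrow> integrable n (\<lambda>s. \<Sum>A\<in>\<P>. indicat_real A s *\<^sub>R step_value g A)"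
    by (rule Bochner_Integration.integrable_cong[OF refl]) (rule adapted_expansion[OF P g])
  ultimately show "integrable n g" by blast
  have "(\<integral>s. g s \<partial>n) = (\<integral>s. (\<Sum>A\<in>\<P>. indicat_real A s *\<^sub>R step_value g A) \<partial>n)"
    by (intro Bochner_Integration.integral_cong refl adapted_expansion[OF P g])
  also have "\<dots> = (\<Sum>A\<in>\<P>. measure n A *\<^sub>R step_value g A)"
    by (subst Bochner_Integration.integral_sum) (auto simp: i m)
  finally show "(\<integral>s. g s \<partial>n) = (\<Sum>A\<in>\<P>. measure n A *\<^sub>R step_value g A)" .
qed

text \<open>
  The cells are the fibres of the joint map \<open>s \<mapsto> (g i s)\<close>. The fibre over zero is left out, as its measure
  may be infinite; accordingly only functions \<open>f\<close> of the values that vanish at zero are considered.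
\<close>

lemma common_partition:
  fixes g :: "'i \<Rightarrow> 's \<Rightarrow> real"
  assumes I: "finite I" and g: "\<And>i. i \<in> I \<Longrightarrow> finite_simple n (g i)"
  shows "\<exists>\<P>. finite_partition n \<P> \<and>
    (\<forall>f :: ('i \<Rightarrow> real) \<Rightarrow> 'b::zero. f (\<lambda>i\<in>I. 0) = 0 \<longrightarrow> adapted n \<P> (\<lambda>s. f (\<lambda>i\<in>I. g i s)))"
proof -
  define G where "G = (\<lambda>s. \<lambda>i\<in>I. g i s)"
  define \<P> where "\<P> = (\<lambda>v. G -` {v} \<inter> space n) ` (G ` space n - {\<lambda>i\<in>I. 0})"
  have sf: "simple_function n (g i)" "emeasure n {s \<in> space n. g i s \<noteq> 0} < \<infinity>" if "i \<in> I" for i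
    using g[OF that] by (auto simp: finite_simple_def)
  have "G ` space n \<subseteq> (\<Pi>\<^sub>E i\<in>I. g i ` space n)" by (auto simp: G_def)
  moreover have "finite (\<Pi>\<^sub>E i\<in>I. g i ` space n)"
    using I sf by (intro finite_PiE) (auto simp: simple_function_def)
  ultimately have finG: "finite (G ` space n)" by (rule finite_subset)
  have Geq: "G s = G s' \<longleftrightarrow> (\<forall>i\<in>I. g i s = g i s')" for s s'
    by (auto simp: G_def fun_eq_iff restrict_def)
  have fib: "G -` {G s} \<inter> space n \<in> sets n" for s
  proof -
    have "G -` {G s} \<inter> space n = {s' \<in> space n. \<forall>i\<in>I. g i s' = g i s}"
      using Geq[of _ s] by auto
    also have "\<dots> \<in> sets n"
      using I sf by (intro sets.sets_Collect_finite_All) (auto intro!: measurable_sets_Collect borel_measurable_simple_function)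
    finally show ?thesis .
  qed
  have fin: "finite_partition n \<P>"
    unfolding finite_partition_def
  proof (intro conjI ballI)
    show "finite \<P>" using finG by (simp add: \<P>_def)
    show "disjoint \<P>" by (auto simp: \<P>_def disjoint_def)
    show "\<P> \<subseteq> sets n" using fib by (auto simp: \<P>_def)
    show "{} \<notin> \<P>" by (auto simp: \<P>_def)
    fix A assume "A \<in> \<P>"
    then obtain s where s: "s \<in> space n" "G s \<noteq> (\<lambda>i\<in>I. 0)" "A = G -` {G s} \<inter> space n" by (auto simp: \<P>_def)
    then obtain i where i: "i \<in> I" "g i s \<noteq> 0" by (auto simp: G_def fun_eq_iff restrict_def split: if_splits)
    have "A \<subseteq> {s \<in> space n. g i s \<noteq> 0}" using s i Geq by auto
    moreover have "{s \<in> space n. g i s \<noteq> 0} \<in> sets n"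
      using borel_measurable_simple_function[OF sf(1)[OF i(1)]] by measurable
    ultimately have "emeasure n A \<le> emeasure n {s \<in> space n. g i s \<noteq> 0}" by (rule emeasure_mono)
    then show "emeasure n A < \<infinity>" using sf(2)[OF i(1)] by (rule order.strict_trans1)
  qed
  moreover have "adapted n \<P> (\<lambda>s. f (\<lambda>i\<in>I. g i s))" if f: "f (\<lambda>i\<in>I. 0) = 0" for f :: "('i \<Rightarrow> real) \<Rightarrow> 'b"
    unfolding adapted_def G_def[THEN fun_cong, symmetric]
  proof (intro conjI ballI subsetI)
    fix A s assume A: "A \<in> \<P>" "s \<in> A"
    then have "(SOME s. s \<in> A) \<in> A" by (metis someI)
    then have "G (SOME s. s \<in> A) = G s" using A by (auto simp: \<P>_def)
    then show "f (G s) = step_value (\<lambda>s. f (G s)) A" by (simp add: step_value_def)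
  next
    fix s assume "s \<in> {s \<in> space n. f (G s) \<noteq> 0}"
    then show "s \<in> \<Union>\<P>" using f by (auto simp: \<P>_def)
  qed
  ultimately show ?thesis by blast
qed

locale poisson_noise = prob_space M for M :: "'w measure" +
  fixes n :: "'s measure" and N :: "'s set \<Rightarrow> 'w \<Rightarrow> ennreal"
  assumes prm: "poisson_random_measure M n N"
begin

abbreviation cnt :: "'s set \<Rightarrow> 'w \<Rightarrow> real" where "cnt A w \<equiv> enn2real (N A w)"

lemma N_measurable [measurable]: "A \<in> sets n \<Longrightarrow> N A \<in> borel_measurable M"
  using prm by (simp add: poisson_random_measure_def)

lemma N_pmf: "A \<in> sets n \<Longrightarrow> emeasure n A < \<infinity> \<Longrightarrow>
    prob {w \<in> space M. N A w = of_nat k} = measure n A ^ k / fact k * exp (- measure n A)"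
  using prm unfolding poisson_random_measure_def by blast

lemma N_indep: "\<A> \<subseteq> sets n \<Longrightarrow> disjoint \<A> \<Longrightarrow> indep_vars (\<lambda>_. borel) N \<A>"
  using prm unfolding poisson_random_measure_def by blast

lemma N_additive: "range A \<subseteq> sets n \<Longrightarrow> disjoint_family A \<Longrightarrow> AE w in M. N (\<Union>i. A i) w = (\<Sum>i. N (A i) w)"
  using prm unfolding poisson_random_measure_def by blast

lemma AE_N_nat: "A \<in> sets n \<Longrightarrow> emeasure n A < \<infinity> \<Longrightarrow> AE w in M. \<exists>k::nat. N A w = of_nat k"
  by (rule poisson_rv_law(1)[OF prob_space_axioms _ measure_nonneg N_pmf]) measurable

lemma cnt_law: "A \<in> sets n \<Longrightarrow> emeasure n A < \<infinity> \<Longrightarrow>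
    distr M borel (cnt A) = distr (measure_pmf (poisson_law (measure n A))) borel real"
  by (rule poisson_rv_law(2)[OF prob_space_axioms _ measure_nonneg N_pmf]) measurable

lemma cnt_moments:
  assumes A[measurable]: "A \<in> sets n" and fin: "emeasure n A < \<infinity>"
  shows "integrable M (cnt A)" "expectation (cnt A) = measure n A"
    "integrable M (\<lambda>w. (cnt A w - measure n A)\<^sup>2)" "expectation (\<lambda>w. (cnt A w - measure n A)\<^sup>2) = measure n A"
    "expectation (\<lambda>w. iexp (u * cnt A w)) = exp (complex_of_real (measure n A) * (iexp u - 1))"
proof -
  let ?p = "measure_pmf (poisson_law (measure n A))"
  have c: "cnt A \<in> borel_measurable M" by measurable
  have r: "real \<in> measurable ?p borel" by simp
  note tr = same_law_transfer[OF cnt_law[OF A fin] c r]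
  note pm = poisson_moments[OF measure_nonneg, of n A]
  have id: "(\<lambda>x::real. x) \<in> borel_measurable borel" by simp
  have sq: "(\<lambda>x::real. (x - measure n A)\<^sup>2) \<in> borel_measurable borel" by simp
  have ie: "(\<lambda>x::real. iexp (u * x)) \<in> borel_measurable borel" by simp
  show "integrable M (cnt A)" by (rule iffD2[OF tr(1)[OF id] pm(1)])
  show "expectation (cnt A) = measure n A" unfolding tr(2)[OF id] by (rule pm(2))
  show "integrable M (\<lambda>w. (cnt A w - measure n A)\<^sup>2)" by (rule iffD2[OF tr(1)[OF sq] pm(3)])
  show "expectation (\<lambda>w. (cnt A w - measure n A)\<^sup>2) = measure n A" unfolding tr(2)[OF sq] by (rule pm(4))
  show "expectation (\<lambda>w. iexp (u * cnt A w)) = exp (complex_of_real (measure n A) * (iexp u - 1))"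
    unfolding tr(2)[OF ie] by (rule poisson_char) simp
qed

lemma N_empty: "AE w in M. N {} w = 0"
proof -
  have "AE w in M. w \<in> {w \<in> space M. N {} w = of_nat 0}"
    using N_pmf[of "{}" 0] by (subst prob_eq_1[symmetric]) auto
  then show ?thesis by eventually_elim simp
qed

lemma N_Un:
  assumes A: "A \<in> sets n" and B: "B \<in> sets n" and AB: "A \<inter> B = {}"
  shows "AE w in M. N (A \<union> B) w = N A w + N B w"
proof -
  define F where "F = (\<lambda>i::nat. if i = 0 then A else if i = 1 then B else {})"
  have "AE w in M. N (\<Union>i. F i) w = (\<Sum>i. N (F i) w)"
    using A B AB by (intro N_additive) (auto simp: F_def disjoint_family_on_def)
  moreover have "(\<Union>i. F i) = A \<union> B"
    by (auto simp: F_def split: if_splits)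
  ultimately have "AE w in M. N (A \<union> B) w = (\<Sum>i. N (F i) w)" by simp
  then show ?thesis
    using N_empty
  proof eventually_elim
    fix w assume w: "N (A \<union> B) w = (\<Sum>i. N (F i) w)" "N {} w = 0"
    have "(\<Sum>i. N (F i) w) = (\<Sum>i\<in>{0, 1}. N (F i) w)"
      by (rule suminf_finite) (auto simp: F_def w)
    then show "N (A \<union> B) w = N A w + N B w" using w by (simp add: F_def)
  qed
qed

lemma N_Union:
  assumes "finite \<A>" "\<A> \<subseteq> sets n" "disjoint \<A>"
  shows "AE w in M. N (\<Union>\<A>) w = (\<Sum>A\<in>\<A>. N A w)"
  using assms
proof (induction \<A> rule: finite_induct)
  case empty
  then show ?case using N_empty by simp
next
  case (insert A \<A>)
  have "A \<inter> \<Union>\<A> = {}" using insert.prems(2) insert.hyps(2) by (auto simp: disjoint_def)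
  then have "AE w in M. N (A \<union> \<Union>\<A>) w = N A w + N (\<Union>\<A>) w"
    using insert.prems insert.hyps by (intro N_Un) auto
  moreover have "AE w in M. N (\<Union>\<A>) w = (\<Sum>A\<in>\<A>. N A w)"
    using insert.prems by (intro insert.IH pairwise_subset[OF insert.prems(2)]) auto
  ultimately show ?case
    by eventually_elim (use insert.hyps in simp)
qed

lemma char_partition:
  assumes P: "finite_partition n \<P>"
  shows "expectation (\<lambda>w. iexp (\<Sum>A\<in>\<P>. c A * cnt A w)) = exp (\<Sum>A\<in>\<P>. complex_of_real (measure n A) * (iexp (c A) - 1))"
proof -
  have p: "finite \<P>" "disjoint \<P>" "\<P> \<subseteq> sets n" "\<And>A. A \<in> \<P> \<Longrightarrow> emeasure n A < \<infinity>" "\<And>A. A \<in> \<P> \<Longrightarrow> A \<in> sets n"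
    using P by (auto simp: finite_partition_def)
  have "expectation (\<lambda>w. iexp (\<Sum>A\<in>\<P>. c A * cnt A w)) = expectation (\<lambda>w. \<Prod>A\<in>\<P>. iexp (c A * cnt A w))"
    using p(1) by (simp add: sum_distrib_left exp_sum)
  also have "\<dots> = (\<Prod>A\<in>\<P>. expectation (\<lambda>w. iexp (c A * cnt A w)))"
  proof (rule indep_vars_lebesgue_integral[OF p(1)])
    show "indep_vars (\<lambda>_. borel) (\<lambda>A w. iexp (c A * cnt A w)) \<P>"
      by (rule indep_vars_compose2[OF N_indep[OF p(3,2)], where Y="\<lambda>A x. iexp (c A * enn2real x)"]) measurable
    show "integrable M (\<lambda>w. iexp (c A * cnt A w))" if "A \<in> \<P>" for A
      using p(5)[OF that] by (intro integrable_iexp_real) measurable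
  qed
  also have "\<dots> = (\<Prod>A\<in>\<P>. exp (complex_of_real (measure n A) * (iexp (c A) - 1)))"
    by (intro prod.cong refl cnt_moments(5) p)
  also have "\<dots> = exp (\<Sum>A\<in>\<P>. complex_of_real (measure n A) * (iexp (c A) - 1))"
    by (rule exp_sum[OF p(1), symmetric])
  finally show ?thesis .
qed

text \<open>
  Distinct cells contribute uncorrelated centered variables, and the variance of a count is its mean.
\<close>

lemma second_moment_partition:
  assumes P: "finite_partition n \<P>"
  shows "integrable M (\<lambda>w. (\<Sum>A\<in>\<P>. c A * (cnt A w - measure n A))\<^sup>2)"
    "expectation (\<lambda>w. (\<Sum>A\<in>\<P>. c A * (cnt A w - measure n A))\<^sup>2) = (\<Sum>A\<in>\<P>. (c A)\<^sup>2 * measure n A)"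
proof -
  have p: "finite \<P>" "disjoint \<P>" "\<P> \<subseteq> sets n" "\<And>A. A \<in> \<P> \<Longrightarrow> emeasure n A < \<infinity>" "\<And>A. A \<in> \<P> \<Longrightarrow> A \<in> sets n"
    using P by (auto simp: finite_partition_def)
  define X where "X = (\<lambda>A w. c A * (cnt A w - measure n A))"
  have sq: "(\<Sum>A\<in>\<P>. c A * (cnt A w - measure n A))\<^sup>2 = (\<Sum>A\<in>\<P>. \<Sum>B\<in>\<P>. X A w * X B w)" for w
    by (simp add: X_def power2_eq_square sum_product)
  have Xi: "integrable M (X A)" and X0: "expectation (X A) = 0" if "A \<in> \<P>" for A
    using cnt_moments(1,2)[OF p(5,4)[OF that]] by (auto simp: X_def prob_space)
  have XX: "integrable M (\<lambda>w. X A w * X B w) \<and> expectation (\<lambda>w. X A w * X B w) = (if A = B then (c A)\<^sup>2 * measure n A else 0)"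
    if A: "A \<in> \<P>" and B: "B \<in> \<P>" for A B
  proof (cases "A = B")
    case True
    have "(\<lambda>w. X A w * X B w) = (\<lambda>w. (c A)\<^sup>2 * (cnt A w - measure n A)\<^sup>2)"
      by (simp add: X_def True power2_eq_square mult_ac)
    then show ?thesis using cnt_moments(3,4)[OF p(5,4)[OF A]] True by simp
  next
    case False
    have ind: "indep_vars (\<lambda>_. borel) X \<P>"
      unfolding X_def
      by (rule indep_vars_compose2[OF N_indep[OF p(3,2)], where Y="\<lambda>A x. c A * (enn2real x - measure n A)"]) measurable
    have ind2: "indep_vars (\<lambda>_. borel) X {A, B}"
      using A B by (intro indep_vars_subset[OF ind]) auto
    have "integrable M (\<lambda>w. \<Prod>C\<in>{A, B}. X C w)"
      using A B Xi by (intro indep_vars_integrable[OF _ ind2]) auto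
    moreover have "expectation (\<lambda>w. \<Prod>C\<in>{A, B}. X C w) = (\<Prod>C\<in>{A, B}. expectation (X C))"
      using A B Xi by (intro indep_vars_lebesgue_integral[OF _ ind2]) auto
    ultimately show ?thesis using False X0 A B by simp
  qed
  show "integrable M (\<lambda>w. (\<Sum>A\<in>\<P>. c A * (cnt A w - measure n A))\<^sup>2)"
    unfolding sq by (intro Bochner_Integration.integrable_sum) (use XX in blast)
  have "expectation (\<lambda>w. (\<Sum>A\<in>\<P>. c A * (cnt A w - measure n A))\<^sup>2) = (\<Sum>A\<in>\<P>. \<Sum>B\<in>\<P>. expectation (\<lambda>w. X A w * X B w))"
    unfolding sq using XX by (subst Bochner_Integration.integral_sum; (intro sum.cong refl Bochner_Integration.integral_sum Bochner_Integration.integrable_sum)?) blast+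
  also have "\<dots> = (\<Sum>A\<in>\<P>. \<Sum>B\<in>\<P>. if A = B then (c A)\<^sup>2 * measure n A else 0)"
    using XX by (intro sum.cong refl) blast
  also have "\<dots> = (\<Sum>A\<in>\<P>. (c A)\<^sup>2 * measure n A)"
    using p(1) by (simp add: sum.delta)
  finally show "expectation (\<lambda>w. (\<Sum>A\<in>\<P>. c A * (cnt A w - measure n A))\<^sup>2) = (\<Sum>A\<in>\<P>. (c A)\<^sup>2 * measure n A)" .
qed

lemma min_partition:
  assumes P: "finite_partition n \<P>"
  shows "expectation (\<lambda>w. min \<bar>\<Sum>A\<in>\<P>. c A * cnt A w\<bar> 1) \<le> (\<Sum>A\<in>\<P>. min \<bar>c A\<bar> 1 * measure n A)"
proof -
  have p: "finite \<P>" "\<And>A. A \<in> \<P> \<Longrightarrow> emeasure n A < \<infinity>" "\<And>A. A \<in> \<P> \<Longrightarrow> A \<in> sets n"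
    using P by (auto simp: finite_partition_def)
  have i: "integrable M (\<lambda>w. \<Sum>A\<in>\<P>. min \<bar>c A\<bar> 1 * cnt A w)"
    by (intro Bochner_Integration.integrable_sum integrable_mult_right cnt_moments(1) p)
  have m: "(\<lambda>w. \<Sum>A\<in>\<P>. c A * cnt A w) \<in> borel_measurable M"
    using p by (intro borel_measurable_sum) measurable
  have "expectation (\<lambda>w. min \<bar>\<Sum>A\<in>\<P>. c A * cnt A w\<bar> 1) \<le> expectation (\<lambda>w. \<Sum>A\<in>\<P>. min \<bar>c A\<bar> 1 * cnt A w)"
  proof (rule integral_mono_AE)
    show "integrable M (\<lambda>w. min \<bar>\<Sum>A\<in>\<P>. c A * cnt A w\<bar> 1)"
      using m by (intro integrable_const_bound[where B=1]) auto
    have "AE w in M. \<forall>A\<in>\<P>. \<exists>k::nat. N A w = of_nat k"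
      by (intro AE_finite_allI p AE_N_nat)
    then show "AE w in M. min \<bar>\<Sum>A\<in>\<P>. c A * cnt A w\<bar> 1 \<le> (\<Sum>A\<in>\<P>. min \<bar>c A\<bar> 1 * cnt A w)"
    proof eventually_elim
      case (elim w)
      then obtain k :: "'s set \<Rightarrow> nat" where k: "\<And>A. A \<in> \<P> \<Longrightarrow> N A w = of_nat (k A)" by metis
      have "cnt A w = real (k A)" if "A \<in> \<P>" for A
        using k[OF that] by (simp add: ennreal_of_nat_eq_real_of_nat)
      then show ?case
        using min_sum_counts_le[OF p(1), of c k] by (simp cong: sum.cong)
    qed
  qed (rule i)
  also have "\<dots> = (\<Sum>A\<in>\<P>. min \<bar>c A\<bar> 1 * measure n A)"
    using cnt_moments(1,2)[OF p(3,2)] by (subst Bochner_Integration.integral_sum) auto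
  finally show ?thesis .
qed

text \<open>
  The integrals are defined by grouping the points by the value of \<open>g\<close>. The set on which a nonzero value is
  taken is a finite union of cells, over which \<open>N\<close> is almost surely additive.
\<close>

lemma simple_integral_partition:
  fixes g :: "'s \<Rightarrow> real"
  assumes P: "finite_partition n \<P>" and g: "adapted n \<P> g"
  shows "AE w in M. simple_integral_N n N g w = (\<Sum>A\<in>\<P>. step_value g A * cnt A w)"
    "AE w in M. simple_integral_compensated n N g w = (\<Sum>A\<in>\<P>. step_value g A * (cnt A w - measure n A))"
proof -
  have p: "finite \<P>" "disjoint \<P>" "\<P> \<subseteq> sets n" "\<And>A. A \<in> \<P> \<Longrightarrow> emeasure n A < \<infinity>" "\<And>A. A \<in> \<P> \<Longrightarrow> A \<in> sets n"
    and ne: "{} \<notin> \<P>"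
    using P by (auto simp: finite_partition_def)
  have gA: "g s = step_value g A" if "A \<in> \<P>" "s \<in> A" for A s
    using g that by (auto simp: adapted_def)
  define Y where "Y = g ` space n - {0}"
  define Q where "Q = (\<lambda>y. {A \<in> \<P>. step_value g A = y})"
  have fib: "g -` {y} \<inter> space n = \<Union>(Q y)" if "y \<noteq> 0" for y
  proof (intro set_eqI iffI)
    fix s assume s: "s \<in> g -` {y} \<inter> space n"
    then have "s \<in> \<Union>\<P>" using g that by (auto simp: adapted_def)
    then obtain A where "A \<in> \<P>" "s \<in> A" by blast
    then show "s \<in> \<Union>(Q y)" using gA s by (auto simp: Q_def)
  next
    fix s assume "s \<in> \<Union>(Q y)"
    then obtain A where "A \<in> \<P>" "step_value g A = y" "s \<in> A" by (auto simp: Q_def)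
    then show "s \<in> g -` {y} \<inter> space n" using gA sets.sets_into_space[OF p(5)[of A]] by auto
  qed
  have vals: "step_value g A \<in> Y" if "A \<in> \<P>" "step_value g A \<noteq> 0" for A
  proof -
    have "A \<noteq> {}" using ne that(1) by blast
    then obtain s where s: "s \<in> A" by blast
    have "s \<in> space n" using sets.sets_into_space[OF p(5)[OF that(1)]] s by blast
    then show ?thesis using that(2) gA[OF that(1) s] unfolding Y_def by (metis DiffI image_eqI singletonD)
  qed
  have Y_fin: "finite Y"
  proof (rule finite_subset)
    show "Y \<subseteq> step_value g ` \<P>"
    proof
      fix y assume "y \<in> Y"
      then obtain s where "s \<in> space n" "g s = y" "y \<noteq> 0" by (auto simp: Y_def)
      then have "s \<in> \<Union>(Q y)" using fib[of y] by auto
      then show "y \<in> step_value g ` \<P>" by (auto simp: Q_def)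
    qed
  qed (use p in simp)
  have regroup: "(\<Sum>y\<in>Y. y * (\<Sum>A\<in>Q y. F A)) = (\<Sum>A\<in>\<P>. step_value g A * F A)" for F :: "'s set \<Rightarrow> real"
  proof -
    have "(\<Sum>y\<in>Y. y * (\<Sum>A\<in>Q y. F A)) = (\<Sum>y\<in>Y. \<Sum>A\<in>{A \<in> {A\<in>\<P>. step_value g A \<noteq> 0}. step_value g A = y}. step_value g A * F A)"
    proof (rule sum.cong[OF refl])
      fix y assume "y \<in> Y"
      then have "{A \<in> {A\<in>\<P>. step_value g A \<noteq> 0}. step_value g A = y} = Q y" by (auto simp: Y_def Q_def)
      then show "y * (\<Sum>A\<in>Q y. F A) = (\<Sum>A\<in>{A \<in> {A\<in>\<P>. step_value g A \<noteq> 0}. step_value g A = y}. step_value g A * F A)"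
        by (simp add: sum_distrib_left) (auto simp: Q_def intro!: sum.cong)
    qed
    also have "\<dots> = (\<Sum>A\<in>{A\<in>\<P>. step_value g A \<noteq> 0}. step_value g A * F A)"
      using p(1) Y_fin vals by (intro sum.group) auto
    also have "\<dots> = (\<Sum>A\<in>\<P>. step_value g A * F A)"
      using p(1) by (intro sum.mono_neutral_left) auto
    finally show ?thesis .
  qed
  have Qp: "finite (Q y)" "Q y \<subseteq> sets n" "disjoint (Q y)" for y
    using p by (auto simp: Q_def intro: pairwise_subset)
  have mQ: "measure n (\<Union>(Q y)) = (\<Sum>A\<in>Q y. measure n A)" for y
  proof -
    have "measure n (\<Union>A\<in>Q y. A) = (\<Sum>A\<in>Q y. measure n A)"
      using Qp[of y] p(4) by (intro measure_finite_Union) (auto simp: disjoint_family_on_def disjoint_def Q_def less_top)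
    then show ?thesis by simp
  qed
  have "AE w in M. \<forall>y\<in>Y. N (\<Union>(Q y)) w = (\<Sum>A\<in>Q y. N A w)"
    by (intro AE_finite_allI Y_fin N_Union Qp)
  moreover have "AE w in M. \<forall>A\<in>\<P>. \<exists>k::nat. N A w = of_nat k"
    by (intro AE_finite_allI p AE_N_nat)
  ultimately have cntQ: "AE w in M. \<forall>y\<in>Y. cnt (\<Union>(Q y)) w = (\<Sum>A\<in>Q y. cnt A w)"
  proof eventually_elim
    case (elim w)
    show ?case
    proof
      fix y assume "y \<in> Y"
      have fin: "N A w < top" if "A \<in> Q y" for A
      proof -
        have "A \<in> \<P>" using that by (simp add: Q_def)
        then obtain k :: nat where "N A w = of_nat k" using elim(2) by blast
        then show ?thesis by (simp add: of_nat_less_top)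
      qed
      have "enn2real (\<Sum>A\<in>Q y. N A w) = (\<Sum>A\<in>Q y. cnt A w)"
        by (subst enn2real_sum) (simp_all add: fin)
      then show "cnt (\<Union>(Q y)) w = (\<Sum>A\<in>Q y. cnt A w)" using elim(1) \<open>y \<in> Y\<close> by simp
    qed
  qed
  show "AE w in M. simple_integral_N n N g w = (\<Sum>A\<in>\<P>. step_value g A * cnt A w)"
    using cntQ
  proof eventually_elim
    case (elim w)
    have "simple_integral_N n N g w = (\<Sum>y\<in>Y. y * (\<Sum>A\<in>Q y. cnt A w))"
      unfolding simple_integral_N_def Y_def[symmetric] by (intro sum.cong refl) (use elim fib in \<open>auto simp: Y_def\<close>)
    then show ?case unfolding regroup .
  qed
  show "AE w in M. simple_integral_compensated n N g w = (\<Sum>A\<in>\<P>. step_value g A * (cnt A w - measure n A))"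
    using cntQ
  proof eventually_elim
    case (elim w)
    have "simple_integral_compensated n N g w = (\<Sum>y\<in>Y. y * (\<Sum>A\<in>Q y. (cnt A w - measure n A)))"
      unfolding simple_integral_compensated_def Y_def[symmetric]
    proof (intro sum.cong refl)
      fix y assume y: "y \<in> Y"
      then have "g -` {y} \<inter> space n = \<Union>(Q y)" by (intro fib) (auto simp: Y_def)
      then show "y * (cnt (g -` {y} \<inter> space n) w - measure n (g -` {y} \<inter> space n)) = y * (\<Sum>A\<in>Q y. (cnt A w - measure n A))"
        using elim y by (simp add: mQ sum_subtractf)
    qed
    then show ?case unfolding regroup .
  qed
qed

lemma simple_integrals_measurable:
  assumes "finite_simple n g"
  shows "simple_integral_N n N g \<in> borel_measurable M" "simple_integral_compensated n N g \<in> borel_measurable M"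
proof -
  have m: "cnt (g -` {y} \<inter> space n) \<in> borel_measurable M" for y
    using assms by (intro borel_measurable_enn2real N_measurable) (auto simp: finite_simple_def intro: simple_functionD(2))
  show "simple_integral_N n N g \<in> borel_measurable M"
    unfolding simple_integral_N_def[abs_def] by (intro borel_measurable_sum borel_measurable_times borel_measurable_const m)
  show "simple_integral_compensated n N g \<in> borel_measurable M"
    unfolding simple_integral_compensated_def[abs_def]
    by (intro borel_measurable_sum borel_measurable_times borel_measurable_diff borel_measurable_const m)
qed

text \<open>
  Compensated and plain integrals are treated together, since a Poissonian integral is approximated by a sum
  of one of each kind, for the small and for the large values of the integrand.
\<close>

lemma simple_char:
  fixes g1 g2 :: "'t \<Rightarrow> 's \<Rightarrow> real"
  assumes I: "finite I" and g: "\<And>t. t \<in> I \<Longrightarrow> finite_simple n (g1 t)" "\<And>t. t \<in> I \<Longrightarrow> finite_simple n (g2 t)"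
  shows "expectation (\<lambda>w. iexp (\<Sum>t\<in>I. a t * (simple_integral_compensated n N (g1 t) w + simple_integral_N n N (g2 t) w))) =
    exp (\<integral>s. (iexp (\<Sum>t\<in>I. a t * (g1 t s + g2 t s)) - 1 - \<i> * complex_of_real (\<Sum>t\<in>I. a t * g1 t s)) \<partial>n)"
proof -
  define G where "G = case_sum g1 g2"
  have "finite (I <+> I)" using I by simp
  moreover have "finite_simple n (G i)" if "i \<in> I <+> I" for i
    using that g by (auto simp: G_def)
  ultimately obtain \<P> where P: "finite_partition n \<P>"
    and ad: "\<And>f :: ('t + 't \<Rightarrow> real) \<Rightarrow> complex. f (\<lambda>i\<in>I <+> I. 0) = 0 \<Longrightarrow> adapted n \<P> (\<lambda>s. f (\<lambda>i\<in>I <+> I. G i s))"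
    using common_partition[of "I <+> I" n G] by blast
  have ad_real: "adapted n \<P> (G i)" if "i \<in> I <+> I" for i
  proof -
    have "adapted n \<P> (\<lambda>s. complex_of_real ((\<lambda>i\<in>I <+> I. G i s) i))"
      using that by (intro ad[of "\<lambda>v. complex_of_real (v i)"]) simp
    then show ?thesis using that by (simp add: adapted_def step_value_def)
  qed
  have g1: "adapted n \<P> (g1 t)" and g2: "adapted n \<P> (g2 t)" if "t \<in> I" for t
    using ad_real[of "Inl t"] ad_real[of "Inr t"] that by (auto simp: G_def)
  define C where "C = (\<lambda>s. \<Sum>t\<in>I. a t * (g1 t s + g2 t s))"
  define H where "H = (\<lambda>s. \<Sum>t\<in>I. a t * g1 t s)"
  define \<phi> where "\<phi> = (\<lambda>s. iexp (C s) - 1 - \<i> * complex_of_real (H s))"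
  \<comment> \<open>the integrand of the exponent as a function of the values of all \<open>g1 t\<close> and \<open>g2 t\<close>, vanishing at zero\<close>
  define f where "f = (\<lambda>v :: 't + 't \<Rightarrow> real. iexp (\<Sum>t\<in>I. a t * (v (Inl t) + v (Inr t))) - 1 - \<i> * complex_of_real (\<Sum>t\<in>I. a t * v (Inl t)))"
  have "adapted n \<P> (\<lambda>s. f (\<lambda>i\<in>I <+> I. G i s))"
  proof (rule ad)
    have "(\<Sum>t\<in>I. a t * ((\<lambda>i\<in>I <+> I. 0) (Inl t) + (\<lambda>i\<in>I <+> I. 0) (Inr t))) = 0"
      "(\<Sum>t\<in>I. a t * (\<lambda>i\<in>I <+> I. 0) (Inl t)) = 0"
      by (intro sum.neutral ballI; simp add: InlI InrI)+
    then show "f (\<lambda>i\<in>I <+> I. 0) = 0" by (simp only: f_def) simp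
  qed
  moreover have "(\<lambda>s. f (\<lambda>i\<in>I <+> I. G i s)) = \<phi>"
  proof
    fix s
    have "(\<Sum>t\<in>I. a t * ((\<lambda>i\<in>I <+> I. G i s) (Inl t) + (\<lambda>i\<in>I <+> I. G i s) (Inr t))) = C s"
      "(\<Sum>t\<in>I. a t * (\<lambda>i\<in>I <+> I. G i s) (Inl t)) = H s"
      unfolding C_def H_def by (intro sum.cong refl; simp add: G_def InlI InrI)+
    then show "f (\<lambda>i\<in>I <+> I. G i s) = \<phi> s" by (simp only: f_def \<phi>_def)
  qed
  ultimately have ad_phi: "adapted n \<P> \<phi>" by simp
  \<comment> \<open>the point of a cell at which \<open>step_value\<close> evaluates a function\<close>
  define p where "p = (\<lambda>A :: 's set. SOME s. s \<in> A)"
  have sv: "step_value g A = g (p A)" for g :: "'s \<Rightarrow> 'z" and A by (simp add: step_value_def p_def)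
  have fin: "finite \<P>" using P by (simp add: finite_partition_def)
  \<comment> \<open>the compensator\<close>
  define k where "k = (\<Sum>A\<in>\<P>. H (p A) * measure n A)"
  have "AE w in M. \<forall>t\<in>I. simple_integral_compensated n N (g1 t) w = (\<Sum>A\<in>\<P>. step_value (g1 t) A * (cnt A w - measure n A))
      \<and> simple_integral_N n N (g2 t) w = (\<Sum>A\<in>\<P>. step_value (g2 t) A * cnt A w)"
    using I simple_integral_partition[OF P g1] simple_integral_partition[OF P g2]
    by (intro AE_finite_allI AE_conjI) auto
  then have "AE w in M. (\<Sum>t\<in>I. a t * (simple_integral_compensated n N (g1 t) w + simple_integral_N n N (g2 t) w)) = (\<Sum>A\<in>\<P>. C (p A) * cnt A w) - k"
  proof eventually_elim
    case (elim w)
    have "(\<Sum>t\<in>I. a t * (simple_integral_compensated n N (g1 t) w + simple_integral_N n N (g2 t) w))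
        = (\<Sum>t\<in>I. \<Sum>A\<in>\<P>. a t * (g1 t (p A) + g2 t (p A)) * cnt A w - a t * g1 t (p A) * measure n A)"
      by (intro sum.cong refl) (simp add: elim sv sum_distrib_left algebra_simps flip: sum.distrib sum_subtractf)
    also have "\<dots> = (\<Sum>A\<in>\<P>. \<Sum>t\<in>I. a t * (g1 t (p A) + g2 t (p A)) * cnt A w - a t * g1 t (p A) * measure n A)"
      by (rule sum.swap)
    also have "\<dots> = (\<Sum>A\<in>\<P>. C (p A) * cnt A w - H (p A) * measure n A)"
      by (simp only: C_def H_def sum_distrib_right sum_subtractf)
    finally show ?case by (simp add: k_def sum_subtractf)
  qed
  note AE_step = this
  have "expectation (\<lambda>w. iexp (\<Sum>t\<in>I. a t * (simple_integral_compensated n N (g1 t) w + simple_integral_N n N (g2 t) w)))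
      = expectation (\<lambda>w. iexp ((\<Sum>A\<in>\<P>. C (p A) * cnt A w) - k))"
  proof (rule integral_cong_AE)
    have Am: "A \<in> sets n" if "A \<in> \<P>" for A using that P by (auto simp: finite_partition_def)
    have "(\<lambda>w. (\<Sum>A\<in>\<P>. C (p A) * cnt A w) - k) \<in> borel_measurable M"
      by (intro borel_measurable_diff borel_measurable_sum borel_measurable_times borel_measurable_const
          borel_measurable_enn2real N_measurable Am)
    then show "(\<lambda>w. iexp ((\<Sum>A\<in>\<P>. C (p A) * cnt A w) - k)) \<in> borel_measurable M" by measurable
    have "(\<lambda>w. \<Sum>t\<in>I. a t * (simple_integral_compensated n N (g1 t) w + simple_integral_N n N (g2 t) w)) \<in> borel_measurable M"
      by (intro borel_measurable_sum borel_measurable_times borel_measurable_add borel_measurable_const simple_integrals_measurable g)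
    then show "(\<lambda>w. iexp (\<Sum>t\<in>I. a t * (simple_integral_compensated n N (g1 t) w + simple_integral_N n N (g2 t) w))) \<in> borel_measurable M"
      by measurable
  qed (use AE_step in \<open>eventually_elim, simp only:\<close>)
  also have "\<dots> = expectation (\<lambda>w. iexp (- k) * iexp (\<Sum>A\<in>\<P>. C (p A) * cnt A w))"
    by (intro Bochner_Integration.integral_cong refl) (simp add: algebra_simps flip: exp_add)
  also have "\<dots> = iexp (- k) * exp (\<Sum>A\<in>\<P>. complex_of_real (measure n A) * (iexp (C (p A)) - 1))"
    by (simp only: integral_mult_right_zero char_partition[OF P])
  also have "\<dots> = exp (\<Sum>A\<in>\<P>. measure n A *\<^sub>R \<phi> (p A))"
  proof -
    have "(\<Sum>A\<in>\<P>. measure n A *\<^sub>R \<phi> (p A)) = (\<Sum>A\<in>\<P>. complex_of_real (measure n A) * (iexp (C (p A)) - 1) - \<i> * complex_of_real (H (p A) * measure n A))"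
      by (intro sum.cong refl) (simp add: \<phi>_def scaleR_conv_of_real algebra_simps)
    also have "\<dots> = \<i> * complex_of_real (- k) + (\<Sum>A\<in>\<P>. complex_of_real (measure n A) * (iexp (C (p A)) - 1))"
      unfolding sum_subtractf k_def by (simp only: of_real_minus of_real_sum sum_distrib_left mult_minus_right) simp
    finally show ?thesis by (simp only: exp_add)
  qed
  also have "(\<Sum>A\<in>\<P>. measure n A *\<^sub>R \<phi> (p A)) = (\<integral>s. \<phi> s \<partial>n)"
    unfolding integral_adapted(2)[OF P ad_phi] by (simp only: sv)
  finally show ?thesis unfolding \<phi>_def C_def H_def .
qed

lemma two_simple_partition:
  assumes g: "finite_simple n g" "finite_simple n g'"
  shows "\<exists>\<P>. finite_partition n \<P> \<and> adapted n \<P> g \<and> adapted n \<P> g' \<and>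
    (\<forall>F :: real \<Rightarrow> real. F 0 = 0 \<longrightarrow> adapted n \<P> (\<lambda>s. F (g s - g' s)))"
proof -
  define G where "G = (\<lambda>b. if b then g else g')"
  have "finite_simple n (G b)" for b using g by (simp add: G_def)
  then obtain \<P> where P: "finite_partition n \<P>"
    and ad: "\<And>f :: (bool \<Rightarrow> real) \<Rightarrow> real. f (\<lambda>i\<in>UNIV. 0) = 0 \<Longrightarrow> adapted n \<P> (\<lambda>s. f (\<lambda>i\<in>UNIV. G i s))"
    using common_partition[of "UNIV :: bool set" n G, OF finite] by blast
  show ?thesis
  proof (intro exI[of _ \<P>] conjI allI impI P)
    show "adapted n \<P> g" using ad[of "\<lambda>v. v True"] by (simp add: G_def)
    show "adapted n \<P> g'" using ad[of "\<lambda>v. v False"] by (simp add: G_def)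
    show "adapted n \<P> (\<lambda>s. F (g s - g' s))" if "F 0 = 0" for F :: "real \<Rightarrow> real"
      using ad[of "\<lambda>v. F (v True - v False)"] that by (simp add: G_def)
  qed
qed

lemma simple_compensated_isometry:
  assumes g: "finite_simple n g" "finite_simple n g'"
  shows "(\<integral>\<^sup>+ w. ennreal ((simple_integral_compensated n N g w - simple_integral_compensated n N g' w)\<^sup>2) \<partial>M)
    = (\<integral>\<^sup>+ s. ennreal ((g s - g' s)\<^sup>2) \<partial>n)"
proof -
  obtain \<P> where P: "finite_partition n \<P>" and ad: "adapted n \<P> g" "adapted n \<P> g'"
    and adF: "\<And>F :: real \<Rightarrow> real. F 0 = 0 \<Longrightarrow> adapted n \<P> (\<lambda>s. F (g s - g' s))"
    using two_simple_partition[OF g] by blast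
  define c where "c = (\<lambda>A. step_value g A - step_value g' A)"
  have adsq: "adapted n \<P> (\<lambda>s. (g s - g' s)\<^sup>2)" by (rule adF[of "\<lambda>x. x\<^sup>2"]) simp
  have "AE w in M. simple_integral_compensated n N g w - simple_integral_compensated n N g' w = (\<Sum>A\<in>\<P>. c A * (cnt A w - measure n A))"
    using simple_integral_partition(2)[OF P ad(1)] simple_integral_partition(2)[OF P ad(2)]
    by eventually_elim (simp add: c_def left_diff_distrib sum_subtractf)
  then have "(\<integral>\<^sup>+ w. ennreal ((simple_integral_compensated n N g w - simple_integral_compensated n N g' w)\<^sup>2) \<partial>M)
      = (\<integral>\<^sup>+ w. ennreal ((\<Sum>A\<in>\<P>. c A * (cnt A w - measure n A))\<^sup>2) \<partial>M)"
    by (intro nn_integral_cong_AE) (auto elim: eventually_mono)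
  also have "\<dots> = ennreal (\<Sum>A\<in>\<P>. (c A)\<^sup>2 * measure n A)"
    using second_moment_partition[OF P, of c] by (subst nn_integral_eq_integral) auto
  also have "(\<Sum>A\<in>\<P>. (c A)\<^sup>2 * measure n A) = (\<integral>s. (g s - g' s)\<^sup>2 \<partial>n)"
    unfolding integral_adapted(2)[OF P adsq] by (simp add: c_def step_value_def mult.commute)
  also have "ennreal \<dots> = (\<integral>\<^sup>+ s. ennreal ((g s - g' s)\<^sup>2) \<partial>n)"
    by (rule nn_integral_eq_integral[symmetric]) (auto intro: integral_adapted(1)[OF P adsq])
  finally show ?thesis .
qed

text \<open>
  This plays for integrals with respect to \<open>N\<close> the role of the isometry: it gives Cauchy sequences in the
  metric of convergence in probability and needs no moments of the integrand.
\<close>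

lemma simple_N_contraction:
  assumes g: "finite_simple n g" "finite_simple n g'"
  shows "expectation (\<lambda>w. min \<bar>simple_integral_N n N g w - simple_integral_N n N g' w\<bar> 1) \<le> (\<integral>s. min \<bar>g s - g' s\<bar> 1 \<partial>n)"
    "integrable n (\<lambda>s. min \<bar>g s - g' s\<bar> 1)"
proof -
  obtain \<P> where P: "finite_partition n \<P>" and ad: "adapted n \<P> g" "adapted n \<P> g'"
    and adF: "\<And>F :: real \<Rightarrow> real. F 0 = 0 \<Longrightarrow> adapted n \<P> (\<lambda>s. F (g s - g' s))"
    using two_simple_partition[OF g] by blast
  define c where "c = (\<lambda>A. step_value g A - step_value g' A)"
  have adm: "adapted n \<P> (\<lambda>s. min \<bar>g s - g' s\<bar> 1)" by (rule adF[of "\<lambda>x. min \<bar>x\<bar> 1"]) simp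
  show "integrable n (\<lambda>s. min \<bar>g s - g' s\<bar> 1)" by (rule integral_adapted(1)[OF P adm])
  have "AE w in M. simple_integral_N n N g w - simple_integral_N n N g' w = (\<Sum>A\<in>\<P>. c A * cnt A w)"
    using simple_integral_partition(1)[OF P ad(1)] simple_integral_partition(1)[OF P ad(2)]
    by eventually_elim (simp add: c_def left_diff_distrib sum_subtractf)
  then have "expectation (\<lambda>w. min \<bar>simple_integral_N n N g w - simple_integral_N n N g' w\<bar> 1) = expectation (\<lambda>w. min \<bar>\<Sum>A\<in>\<P>. c A * cnt A w\<bar> 1)"
  proof (intro integral_cong_AE)
    have Am: "A \<in> sets n" if "A \<in> \<P>" for A using that P by (auto simp: finite_partition_def)
    show "(\<lambda>w. min \<bar>\<Sum>A\<in>\<P>. c A * cnt A w\<bar> 1) \<in> borel_measurable M"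
      by (intro borel_measurable_min borel_measurable_abs borel_measurable_sum borel_measurable_times borel_measurable_const
          borel_measurable_enn2real N_measurable Am)
    show "(\<lambda>w. min \<bar>simple_integral_N n N g w - simple_integral_N n N g' w\<bar> 1) \<in> borel_measurable M"
      by (intro borel_measurable_min borel_measurable_abs borel_measurable_diff borel_measurable_const simple_integrals_measurable g)
  qed (auto elim: eventually_mono)
  also have "\<dots> \<le> (\<Sum>A\<in>\<P>. min \<bar>c A\<bar> 1 * measure n A)" by (rule min_partition[OF P])
  also have "\<dots> = (\<integral>s. min \<bar>g s - g' s\<bar> 1 \<partial>n)"
    unfolding integral_adapted(2)[OF P adm] by (simp add: c_def step_value_def mult.commute)
  finally show "expectation (\<lambda>w. min \<bar>simple_integral_N n N g w - simple_integral_N n N g' w\<bar> 1) \<le> (\<integral>s. min \<bar>g s - g' s\<bar> 1 \<partial>n)" .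
qed

end

section \<open>Convergence in probability\<close>

lemma (in prob_space) tendsto_in_prob_of_min:
  assumes Z: "\<And>k. Z k \<in> borel_measurable M" "Y \<in> borel_measurable M"
    and lim: "(\<lambda>k. expectation (\<lambda>w. min \<bar>Z k w - Y w\<bar> 1)) \<longlonglongrightarrow> 0"
  shows "tendsto_in_prob M Z Y"
  unfolding tendsto_in_prob_def
proof (intro allI impI)
  fix \<epsilon> :: real assume e: "0 < \<epsilon>"
  note [measurable] = Z
  define d where "d = min \<epsilon> 1"
  have d: "0 < d" "d \<le> \<epsilon>" "d \<le> 1" using e by (auto simp: d_def)
  have bound: "prob {w \<in> space M. \<bar>Z k w - Y w\<bar> > \<epsilon>} \<le> expectation (\<lambda>w. min \<bar>Z k w - Y w\<bar> 1) / d" for k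
  proof -
    have "prob {w \<in> space M. \<bar>Z k w - Y w\<bar> > \<epsilon>} = expectation (indicator {w \<in> space M. \<bar>Z k w - Y w\<bar> > \<epsilon>})"
    proof -
      have "{w \<in> space M. \<bar>Z k w - Y w\<bar> > \<epsilon>} \<inter> space M = {w \<in> space M. \<bar>Z k w - Y w\<bar> > \<epsilon>}" by blast
      then show ?thesis by (simp only: Bochner_Integration.integral_indicator)
    qed
    also have "\<dots> \<le> expectation (\<lambda>w. min \<bar>Z k w - Y w\<bar> 1 / d)"
    proof (rule integral_mono)
      show "integrable M (indicat_real {w \<in> space M. \<bar>Z k w - Y w\<bar> > \<epsilon>})"
        by (intro integrable_real_indicator) (auto simp: emeasure_eq_measure)
      have "integrable M (\<lambda>w. min \<bar>Z k w - Y w\<bar> 1)"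
        by (rule integrable_const_bound[where B=1]) auto
      then show "integrable M (\<lambda>w. min \<bar>Z k w - Y w\<bar> 1 / d)" by simp
      show "indicator {w \<in> space M. \<bar>Z k w - Y w\<bar> > \<epsilon>} w \<le> min \<bar>Z k w - Y w\<bar> 1 / d" for w
        using d by (auto simp: indicator_def field_simps)
    qed
    finally show ?thesis by simp
  qed
  have "(\<lambda>k. expectation (\<lambda>w. min \<bar>Z k w - Y w\<bar> 1) / d) \<longlonglongrightarrow> 0 / d"
    by (intro tendsto_divide lim tendsto_const) (use d in simp)
  then have lim': "(\<lambda>k. expectation (\<lambda>w. min \<bar>Z k w - Y w\<bar> 1) / d) \<longlonglongrightarrow> 0" by simp
  show "(\<lambda>k. prob {w \<in> space M. \<bar>Z k w - Y w\<bar> > \<epsilon>}) \<longlonglongrightarrow> 0"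
    by (rule tendsto_sandwich[OF always_eventually always_eventually tendsto_const lim'])
      (use bound in simp_all)
qed

text \<open>
  Completeness of the metric \<open>E min(|X - Y|, 1)\<close> of convergence in probability. Along a subsequence whose
  successive distances are at most \<open>2^(-j)\<close>, the sum of the truncated increments has finite expectation, so the
  subsequence converges almost surely; its limit is the limit of the whole Cauchy sequence. The almost sure
  subsequence is part of the result because Fatou's lemma is applied to it later.
\<close>

lemma (in prob_space) cauchy_in_prob_limit:
  fixes Z :: "nat \<Rightarrow> 'a \<Rightarrow> real"
  assumes Z[measurable]: "\<And>k. Z k \<in> borel_measurable M"
    and cauchy: "\<And>\<epsilon>. 0 < \<epsilon> \<Longrightarrow> \<exists>K. \<forall>k\<ge>K. \<forall>l\<ge>K. expectation (\<lambda>w. min \<bar>Z k w - Z l w\<bar> 1) \<le> \<epsilon>"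
  obtains Y r where "Y \<in> borel_measurable M" "strict_mono (r :: nat \<Rightarrow> nat)" "AE w in M. (\<lambda>j. Z (r j) w) \<longlonglongrightarrow> Y w"
    "(\<lambda>k. expectation (\<lambda>w. min \<bar>Z k w - Y w\<bar> 1)) \<longlonglongrightarrow> 0"
proof -
  let ?d = "\<lambda>k l. expectation (\<lambda>w. min \<bar>Z k w - Z l w\<bar> 1)"
  have int: "integrable M (\<lambda>w. min \<bar>Z k w - Z l w\<bar> 1)" for k l
    by (rule integrable_const_bound[where B=1]) auto
  have "\<forall>j. \<exists>K. \<forall>k\<ge>K. \<forall>l\<ge>K. ?d k l \<le> (1/2) ^ j"
    by (intro allI cauchy) simp
  then obtain K where K: "\<And>j k l. K j \<le> k \<Longrightarrow> K j \<le> l \<Longrightarrow> ?d k l \<le> (1/2) ^ j" by metis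
  define r where "r = rec_nat (K 0) (\<lambda>j m. max (Suc m) (K (Suc j)))"
  have r_Suc: "r (Suc j) = max (Suc (r j)) (K (Suc j))" for j by (simp add: r_def)
  have r_mono: "strict_mono r" by (intro strict_monoI_Suc) (simp add: r_Suc)
  have rK: "K j \<le> r j" for j by (cases j) (auto simp: r_def)
  have small: "?d (r (Suc j)) (r j) \<le> (1/2) ^ j" for j
    using rK[of j] r_Suc[of j] by (intro K) auto
  have "AE w in M. (\<Sum>j. ennreal (min \<bar>Z (r (Suc j)) w - Z (r j) w\<bar> 1)) \<noteq> \<infinity>"
  proof (rule nn_integral_PInf_AE)
    have "(\<integral>\<^sup>+ w. (\<Sum>j. ennreal (min \<bar>Z (r (Suc j)) w - Z (r j) w\<bar> 1)) \<partial>M)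
        = (\<Sum>j. \<integral>\<^sup>+ w. ennreal (min \<bar>Z (r (Suc j)) w - Z (r j) w\<bar> 1) \<partial>M)"
      by (rule nn_integral_suminf) simp
    also have "\<dots> = (\<Sum>j. ennreal (?d (r (Suc j)) (r j)))"
      by (intro suminf_cong nn_integral_eq_integral int) auto
    also have "\<dots> \<le> (\<Sum>j. ennreal ((1/2) ^ j))"
      by (intro suminf_le ennreal_leI small) auto
    also have "\<dots> = ennreal (\<Sum>j. (1/2) ^ j)"
      by (rule suminf_ennreal2) (auto intro: summable_geometric)
    also have "\<dots> < \<infinity>" by simp
    finally show "(\<integral>\<^sup>+ w. (\<Sum>j. ennreal (min \<bar>Z (r (Suc j)) w - Z (r j) w\<bar> 1)) \<partial>M) \<noteq> \<infinity>" by simp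
  qed simp
  then have conv: "AE w in M. convergent (\<lambda>j. Z (r j) w)"
  proof eventually_elim
    case (elim w)
    let ?x = "\<lambda>j. Z (r (Suc j)) w - Z (r j) w"
    have s: "summable (\<lambda>j. min \<bar>?x j\<bar> 1)"
      using elim by (intro summable_suminf_not_top) auto
    then have "(\<lambda>j. min \<bar>?x j\<bar> 1) \<longlonglongrightarrow> 0" by (rule summable_LIMSEQ_zero)
    then have "eventually (\<lambda>j. min \<bar>?x j\<bar> 1 < 1) sequentially" by (rule order_tendstoD) simp
    then have "eventually (\<lambda>j. norm (?x j) \<le> min \<bar>?x j\<bar> 1) sequentially"
      by eventually_elim (auto simp: min_def split: if_splits)
    then have "summable ?x" using s by (rule summable_comparison_test_ev)
    then have "convergent (\<lambda>j. (\<Sum>i<j. ?x i))" by (simp add: summable_iff_convergent)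
    then have "convergent (\<lambda>j. Z (r 0) w + (\<Sum>i<j. ?x i))" by (intro convergent_add convergent_const)
    moreover have "Z (r 0) w + (\<Sum>i<j. ?x i) = Z (r j) w" for j
      using sum_lessThan_telescope[of "\<lambda>i. Z (r i) w" j] by simp
    ultimately show ?case by simp
  qed
  define Y where "Y = (\<lambda>w. lim (\<lambda>j. Z (r j) w))"
  have [measurable]: "Y \<in> borel_measurable M"
    unfolding Y_def by (rule borel_measurable_lim_metric) simp
  have lim: "AE w in M. (\<lambda>j. Z (r j) w) \<longlonglongrightarrow> Y w"
    using conv by eventually_elim (simp add: Y_def convergent_LIMSEQ_iff)
  have "(\<lambda>k. expectation (\<lambda>w. min \<bar>Z k w - Y w\<bar> 1)) \<longlonglongrightarrow> 0"
  proof (rule LIMSEQ_I)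
    fix e :: real assume "0 < e"
    then obtain K' where K': "\<And>k l. K' \<le> k \<Longrightarrow> K' \<le> l \<Longrightarrow> ?d k l \<le> e / 2" using cauchy[of "e/2"] by auto
    have "expectation (\<lambda>w. min \<bar>Z k w - Y w\<bar> 1) \<le> e / 2" if k: "K' \<le> k" for k
    proof (rule LIMSEQ_le_const2)
      show "(\<lambda>j. ?d k (r j)) \<longlonglongrightarrow> expectation (\<lambda>w. min \<bar>Z k w - Y w\<bar> 1)"
      proof (rule integral_dominated_convergence[where w="\<lambda>_. 1"])
        show "AE w in M. (\<lambda>j. min \<bar>Z k w - Z (r j) w\<bar> 1) \<longlonglongrightarrow> min \<bar>Z k w - Y w\<bar> 1"
          using lim by eventually_elim (intro tendsto_intros)
      qed auto
      show "\<exists>N. \<forall>j\<ge>N. ?d k (r j) \<le> e / 2"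
      proof (intro exI[of _ K'] allI impI K' k)
        fix j assume "K' \<le> j"
        then show "K' \<le> r j" using strict_mono_imp_increasing[OF r_mono, of j] by linarith
      qed
    qed
    moreover have "0 \<le> expectation (\<lambda>w. min \<bar>Z k w - Y w\<bar> 1)" for k by (rule integral_nonneg_AE) auto
    ultimately show "\<exists>no. \<forall>k\<ge>no. norm (expectation (\<lambda>w. min \<bar>Z k w - Y w\<bar> 1) - 0) < e"
      using \<open>0 < e\<close> by (intro exI[of _ K']) (smt (verit) field_sum_of_halves real_norm_def)
  qed
  then show thesis using that[of Y r] r_mono lim by simp
qed

text \<open>
  A bound in terms of the truncated distance, so that transforms converge along with convergence in
  probability.
\<close>

lemma norm_iexp_diff_le: "norm (iexp (a * x) - iexp (a * y)) \<le> (\<bar>a\<bar> + 2) * min \<bar>x - y\<bar> 1"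
proof -
  have "iexp (a * x) - iexp (a * y) = iexp (a * y) * (iexp (a * (x - y)) - 1)"
    by (simp add: algebra_simps flip: exp_add)
  then have eq: "norm (iexp (a * x) - iexp (a * y)) = norm (iexp (a * (x - y)) - 1)"
    by (simp only: norm_mult norm_exp_i_times mult_1_left)
  have 1: "norm (iexp (a * (x - y)) - 1) \<le> \<bar>a\<bar> * \<bar>x - y\<bar>"
    using iexp_approx1[of "a * (x - y)" 0] by (simp add: abs_mult)
  have 2: "norm (iexp (a * (x - y)) - 1) \<le> 2"
    using norm_triangle_ineq4[of "iexp (a * (x - y))" 1] by (simp only: norm_exp_i_times norm_one one_add_one)
  show ?thesis
  proof (cases "\<bar>x - y\<bar> \<le> 1")
    case True
    have "\<bar>a\<bar> * \<bar>x - y\<bar> \<le> (\<bar>a\<bar> + 2) * \<bar>x - y\<bar>" by (intro mult_right_mono) auto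
    then show ?thesis using 1 True unfolding eq by (simp add: min_absorb1 del: of_real_mult of_real_diff)
  next
    case False
    then show ?thesis using 2 unfolding eq by (simp add: min_absorb2 del: of_real_mult of_real_diff)
  qed
qed

lemma (in prob_space) char_tendsto:
  fixes Z :: "'t \<Rightarrow> nat \<Rightarrow> 'a \<Rightarrow> real"
  assumes I: "finite I" and Z: "\<And>t k. t \<in> I \<Longrightarrow> Z t k \<in> borel_measurable M" "\<And>t. t \<in> I \<Longrightarrow> Y t \<in> borel_measurable M"
    and lim: "\<And>t. t \<in> I \<Longrightarrow> (\<lambda>k. expectation (\<lambda>w. min \<bar>Z t k w - Y t w\<bar> 1)) \<longlonglongrightarrow> 0"
  shows "(\<lambda>k. expectation (\<lambda>w. iexp (\<Sum>t\<in>I. a t * Z t k w))) \<longlonglongrightarrow> expectation (\<lambda>w. iexp (\<Sum>t\<in>I. a t * Y t w))"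
proof (rule LIM_zero_cancel, rule tendsto_norm_zero_cancel)
  let ?B = "\<lambda>k. \<Sum>t\<in>I. (\<bar>a t\<bar> + 2) * expectation (\<lambda>w. min \<bar>Z t k w - Y t w\<bar> 1)"
  have B0: "?B \<longlonglongrightarrow> (\<Sum>t\<in>I. (\<bar>a t\<bar> + 2) * 0)"
    by (intro tendsto_sum tendsto_mult tendsto_const lim)
  have int: "integrable M (\<lambda>w. min \<bar>Z t k w - Y t w\<bar> 1)" if "t \<in> I" for t k
    using Z[OF that] by (intro integrable_const_bound[where B=1]) auto
  have m: "(\<lambda>w. \<Sum>t\<in>I. a t * Z t k w) \<in> borel_measurable M" "(\<lambda>w. \<Sum>t\<in>I. a t * Y t w) \<in> borel_measurable M" for k
    using Z by (auto intro!: borel_measurable_sum borel_measurable_times)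
  have "norm (expectation (\<lambda>w. iexp (\<Sum>t\<in>I. a t * Z t k w)) - expectation (\<lambda>w. iexp (\<Sum>t\<in>I. a t * Y t w))) \<le> ?B k" for k
  proof -
    have i: "integrable M (\<lambda>w. iexp (\<Sum>t\<in>I. a t * Z t k w))" "integrable M (\<lambda>w. iexp (\<Sum>t\<in>I. a t * Y t w))"
      by (rule integrable_iexp_real, rule m)+
    have "norm (expectation (\<lambda>w. iexp (\<Sum>t\<in>I. a t * Z t k w)) - expectation (\<lambda>w. iexp (\<Sum>t\<in>I. a t * Y t w)))
        = norm (expectation (\<lambda>w. iexp (\<Sum>t\<in>I. a t * Z t k w) - iexp (\<Sum>t\<in>I. a t * Y t w)))"
      using i by (simp only: Bochner_Integration.integral_diff)
    also have "\<dots> \<le> expectation (\<lambda>w. norm (iexp (\<Sum>t\<in>I. a t * Z t k w) - iexp (\<Sum>t\<in>I. a t * Y t w)))"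
      by (rule integral_norm_bound)
    also have "\<dots> \<le> expectation (\<lambda>w. \<Sum>t\<in>I. (\<bar>a t\<bar> + 2) * min \<bar>Z t k w - Y t w\<bar> 1)"
    proof (rule integral_mono)
      show "integrable M (\<lambda>w. norm (iexp (\<Sum>t\<in>I. a t * Z t k w) - iexp (\<Sum>t\<in>I. a t * Y t w)))"
        by (intro integrable_norm Bochner_Integration.integrable_diff i)
      show "integrable M (\<lambda>w. \<Sum>t\<in>I. (\<bar>a t\<bar> + 2) * min \<bar>Z t k w - Y t w\<bar> 1)"
        by (intro Bochner_Integration.integrable_sum integrable_mult_right int)
      fix w
      have "norm (iexp (\<Sum>t\<in>I. a t * Z t k w) - iexp (\<Sum>t\<in>I. a t * Y t w))
          = norm ((\<Prod>t\<in>I. iexp (a t * Z t k w)) - (\<Prod>t\<in>I. iexp (a t * Y t w)))"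
        by (simp only: of_real_sum sum_distrib_left exp_sum[OF I])
      also have "\<dots> \<le> (\<Sum>t\<in>I. norm (iexp (a t * Z t k w) - iexp (a t * Y t w)))"
        by (rule norm_prod_diff) (simp_all only: norm_exp_i_times order_refl)
      also have "\<dots> \<le> (\<Sum>t\<in>I. (\<bar>a t\<bar> + 2) * min \<bar>Z t k w - Y t w\<bar> 1)"
        by (intro sum_mono norm_iexp_diff_le)
      finally show "norm (iexp (\<Sum>t\<in>I. a t * Z t k w) - iexp (\<Sum>t\<in>I. a t * Y t w)) \<le> (\<Sum>t\<in>I. (\<bar>a t\<bar> + 2) * min \<bar>Z t k w - Y t w\<bar> 1)" .
    qed
    also have "\<dots> = ?B k"
      using int by (subst Bochner_Integration.integral_sum) auto
    finally show ?thesis .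
  qed
  note bound = this
  have B0': "?B \<longlonglongrightarrow> 0" using B0 by simp
  show "(\<lambda>k. norm (expectation (\<lambda>w. iexp (\<Sum>t\<in>I. a t * Z t k w)) - expectation (\<lambda>w. iexp (\<Sum>t\<in>I. a t * Y t w)))) \<longlonglongrightarrow> 0"
    by (rule tendsto_sandwich[OF always_eventually always_eventually tendsto_const B0'])
      (use bound in \<open>simp_all only: norm_ge_zero simp_thms\<close>)
qed

section \<open>Poissonian integrals\<close>

text \<open>
  The asymptotics \<open>\<chi>(v) = 1 + o(v)\<close> bounds the left-hand side by \<open>v^2\<close> near zero, \<open>\<chi>(v) = O(1 / v)\<close>
  bounds it by a constant near infinity, and in between boundedness of \<open>\<chi>\<close> suffices. So the drift of a
  Poissonian integral converges.
\<close>

lemma cutoff_bound: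
  assumes "cutoff chi"
  obtains C where "0 \<le> C" "\<And>v. \<bar>v * (indicator {x. \<bar>x\<bar> \<le> 1} v - chi v)\<bar> \<le> C * min (v\<^sup>2) 1"
proof -
  obtain B0 where B0: "\<And>v. \<bar>chi v\<bar> \<le> B0"
    using assms unfolding cutoff_def bounded_iff by auto
  then have B: "0 \<le> B0" using abs_ge_zero order_trans by blast
  have "eventually (\<lambda>v. norm (chi v - 1) \<le> 1 * norm \<bar>v\<bar>) (at 0)"
    using assms unfolding cutoff_def by (intro landau_o.smallD) auto
  then obtain d where d: "0 < d" "\<And>v. v \<noteq> 0 \<Longrightarrow> \<bar>v\<bar> < d \<Longrightarrow> \<bar>chi v - 1\<bar> \<le> \<bar>v\<bar>"
    unfolding eventually_at by (auto simp: dist_real_def)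
  have "chi \<in> O[at_infinity](\<lambda>v. inverse \<bar>v\<bar>)" using assms unfolding cutoff_def by blast
  then obtain c where c: "0 < c" "eventually (\<lambda>v. norm (chi v) \<le> c * norm (inverse \<bar>v\<bar>)) at_infinity"
    by (rule landau_o.bigE)
  then obtain b where b: "\<And>v. b \<le> \<bar>v\<bar> \<Longrightarrow> \<bar>chi v\<bar> \<le> c * inverse \<bar>v\<bar>"
    unfolding eventually_at_infinity by auto
  define r where "r = min d 1"
  define R where "R = max b 1"
  define E where "E = R * (1 + B0) + c"
  have r: "0 < r" "r \<le> d" "r \<le> 1" using d by (auto simp: r_def)
  have R: "b \<le> R" "1 \<le> R" by (auto simp: R_def)
  have E0: "0 \<le> E" using R B c by (simp add: E_def)
  define C where "C = 1 + E / r\<^sup>2"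
  have C: "0 \<le> C" using E0 by (simp add: C_def)
  have "\<bar>v * (indicator {x. \<bar>x\<bar> \<le> 1} v - chi v)\<bar> \<le> C * min (v\<^sup>2) 1" for v
  proof -
    consider "v = 0" | "v \<noteq> 0" "\<bar>v\<bar> < r" | "r \<le> \<bar>v\<bar>" by linarith
    then show ?thesis
    proof cases
      case 1
      then show ?thesis by simp
    next
      case 2
      then have "\<bar>v * (1 - chi v)\<bar> \<le> \<bar>v\<bar> * \<bar>v\<bar>"
        using d(2)[of v] r unfolding abs_mult by (intro mult_left_mono) auto
      moreover have "v\<^sup>2 \<le> 1" using 2 r by (simp add: abs_square_le_1)
      moreover have "1 * v\<^sup>2 \<le> C * v\<^sup>2" using E0 by (intro mult_right_mono) (auto simp: C_def)
      ultimately show ?thesis using 2 r by (simp add: power2_eq_square min_absorb1)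
    next
      case 3
      have "\<bar>v * (indicator {x. \<bar>x\<bar> \<le> 1} v - chi v)\<bar> \<le> E"
      proof (cases "\<bar>v\<bar> \<le> R")
        case True
        have "\<bar>v\<bar> * \<bar>indicator {x. \<bar>x\<bar> \<le> 1} v - chi v\<bar> \<le> R * (1 + B0)"
        proof (rule mult_mono)
          show "\<bar>indicator {x. \<bar>x\<bar> \<le> 1} v - chi v\<bar> \<le> 1 + B0"
            using B0[of v] by (auto simp: indicator_def abs_le_iff)
        qed (use True R in auto)
        then show ?thesis using c by (simp add: abs_mult E_def)
      next
        case False
        then have "\<bar>v\<bar> * \<bar>chi v\<bar> \<le> \<bar>v\<bar> * (c * inverse \<bar>v\<bar>)" using b[of v] R by (intro mult_left_mono) auto
        also have "\<dots> = c" using False R by simp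
        finally have "\<bar>v * chi v\<bar> \<le> c" by (simp add: abs_mult)
        then show ?thesis using False R B by (simp add: E_def indicator_def) (smt (verit) mult_nonneg_nonneg)
      qed
      also have "E = (E / r\<^sup>2) * r\<^sup>2" using r by simp
      also have "\<dots> \<le> C * min (v\<^sup>2) 1"
      proof (rule mult_mono)
        have "r\<^sup>2 \<le> v\<^sup>2" using 3 r abs_le_square_iff[of r v] by simp
        moreover have "r\<^sup>2 \<le> 1" using r by (simp add: power_le_one)
        ultimately show "r\<^sup>2 \<le> min (v\<^sup>2) 1" by simp
      qed (use C in \<open>auto simp: C_def\<close>)
      finally show ?thesis .
    qed
  qed
  then show thesis by (rule that[OF C])
qed

text \<open>
  A majorant of the exponent that is integrable along with \<open>min (v^2) 1\<close> and serves for \<open>v\<close> itself and for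
  all approximating step functions \<open>x\<close>: by \<open>borel_measurable_implies_sequence_metric\<close> these can be chosen with \<open>|x t| \<le> 2 * |v t|\<close>. The
  exponent differs from that of the truncated variables only if some \<open>|v t| > 1\<close>, and for the truncated ones
  the second order Taylor bound is quadratic.
\<close>

lemma levy_exponent_bound:
  fixes a x v :: "'t \<Rightarrow> real"
  assumes I: "finite I" and xv: "\<And>t. t \<in> I \<Longrightarrow> \<bar>x t\<bar> \<le> 2 * \<bar>v t\<bar>"
  shows "cmod (iexp (\<Sum>t\<in>I. a t * x t) - 1 - \<i> * complex_of_real (\<Sum>t\<in>I. a t * (x t * indicator {y. \<bar>y\<bar> \<le> 1} (v t))))
    \<le> (\<Sum>t\<in>I. (2 + 2 * real (card I) * (a t)\<^sup>2) * min ((v t)\<^sup>2) 1)"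
proof -
  define u where "u = (\<Sum>t\<in>I. a t * x t)"
  define u1 where "u1 = (\<Sum>t\<in>I. a t * (x t * indicator {y. \<bar>y\<bar> \<le> 1} (v t)))"
  have A: "cmod (iexp u - iexp u1) \<le> (\<Sum>t\<in>I. 2 * indicator {y. \<bar>y\<bar> > 1} (v t))"
  proof (cases "\<exists>t\<in>I. \<bar>v t\<bar> > 1")
    case True
    then obtain t where t: "t \<in> I" "\<bar>v t\<bar> > 1" by blast
    have "cmod (iexp u - iexp u1) \<le> 2"
      using norm_triangle_ineq4[of "iexp u" "iexp u1"] by (simp only: norm_exp_i_times one_add_one)
    also have "2 \<le> 2 * indicat_real {y. \<bar>y\<bar> > 1} (v t)" using t by simp
    also have "\<dots> \<le> (\<Sum>t\<in>I. 2 * indicator {y. \<bar>y\<bar> > 1} (v t))"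
      using t I by (intro member_le_sum[of t I "\<lambda>t. 2 * indicat_real {y. \<bar>y\<bar> > 1} (v t)"]) auto
    finally show ?thesis .
  next
    case False
    then have "u = u1" unfolding u_def u1_def by (intro sum.cong) (auto simp: not_less)
    then show ?thesis by (simp add: sum_nonneg)
  qed
  have "cmod (iexp u1 - 1 - \<i> * complex_of_real u1) \<le> u1\<^sup>2 / 2"
    using iexp_approx1[of u1 1] by (simp add: power2_eq_square diff_diff_eq)
  also have "u1\<^sup>2 \<le> (\<Sum>t\<in>I. (a t * (x t * indicator {y. \<bar>y\<bar> \<le> 1} (v t)))\<^sup>2) * real (card I)"
    unfolding u1_def by (rule sum_squared_le_sum_of_squares)
  also have "(\<Sum>t\<in>I. (a t * (x t * indicator {y. \<bar>y\<bar> \<le> 1} (v t)))\<^sup>2) \<le> (\<Sum>t\<in>I. (a t)\<^sup>2 * (4 * ((v t)\<^sup>2 * indicator {y. \<bar>y\<bar> \<le> 1} (v t))))"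
  proof (rule sum_mono)
    fix t assume "t \<in> I"
    then have "\<bar>x t\<bar>\<^sup>2 \<le> (2 * \<bar>v t\<bar>)\<^sup>2" by (intro power_mono xv) auto
    then have "(x t)\<^sup>2 \<le> 4 * (v t)\<^sup>2" by (simp add: power_mult_distrib)
    then show "(a t * (x t * indicator {y. \<bar>y\<bar> \<le> 1} (v t)))\<^sup>2 \<le> (a t)\<^sup>2 * (4 * ((v t)\<^sup>2 * indicator {y. \<bar>y\<bar> \<le> 1} (v t)))"
      by (auto simp: power_mult_distrib indicator_def intro!: mult_left_mono)
  qed
  finally have Bd: "cmod (iexp u1 - 1 - \<i> * complex_of_real u1) \<le> (\<Sum>t\<in>I. (a t)\<^sup>2 * (4 * ((v t)\<^sup>2 * indicator {y. \<bar>y\<bar> \<le> 1} (v t)))) * real (card I) / 2"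
    by (simp add: mult_right_mono divide_right_mono)
  have "cmod (iexp u - 1 - \<i> * complex_of_real u1) \<le> cmod (iexp u - iexp u1) + cmod (iexp u1 - 1 - \<i> * complex_of_real u1)"
  proof -
    have eq: "iexp u - 1 - \<i> * complex_of_real u1 = (iexp u - iexp u1) + (iexp u1 - 1 - \<i> * complex_of_real u1)"
      by simp
    show ?thesis by (subst eq) (rule norm_triangle_ineq)
  qed
  also have "\<dots> \<le> (\<Sum>t\<in>I. 2 * indicator {y. \<bar>y\<bar> > 1} (v t)) + (\<Sum>t\<in>I. (a t)\<^sup>2 * (4 * ((v t)\<^sup>2 * indicator {y. \<bar>y\<bar> \<le> 1} (v t)))) * real (card I) / 2"
    by (intro add_mono A Bd)
  also have "\<dots> = (\<Sum>t\<in>I. 2 * indicator {y. \<bar>y\<bar> > 1} (v t) + 2 * real (card I) * (a t)\<^sup>2 * ((v t)\<^sup>2 * indicator {y. \<bar>y\<bar> \<le> 1} (v t)))"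
  proof -
    have "(\<Sum>t\<in>I. (a t)\<^sup>2 * (4 * ((v t)\<^sup>2 * indicat_real {y. \<bar>y\<bar> \<le> 1} (v t)))) * real (card I) / 2
        = (\<Sum>t\<in>I. 2 * real (card I) * (a t)\<^sup>2 * ((v t)\<^sup>2 * indicator {y. \<bar>y\<bar> \<le> 1} (v t)))"
      unfolding sum_distrib_right sum_divide_distrib by (rule sum.cong) simp_all
    then show ?thesis by (simp only: sum.distrib)
  qed
  also have "\<dots> \<le> (\<Sum>t\<in>I. (2 + 2 * real (card I) * (a t)\<^sup>2) * min ((v t)\<^sup>2) 1)"
  proof (rule sum_mono)
    fix t assume "t \<in> I"
    show "2 * indicator {y. \<bar>y\<bar> > 1} (v t) + 2 * real (card I) * (a t)\<^sup>2 * ((v t)\<^sup>2 * indicator {y. \<bar>y\<bar> \<le> 1} (v t)) \<le> (2 + 2 * real (card I) * (a t)\<^sup>2) * min ((v t)\<^sup>2) 1"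
    proof (cases "\<bar>v t\<bar> \<le> 1")
      case True
      then have "(v t)\<^sup>2 \<le> 1" by (simp add: abs_square_le_1)
      then show ?thesis using True by (simp add: min_absorb1 algebra_simps)
    next
      case False
      then have "1 \<le> (v t)\<^sup>2" using abs_square_le_1[of "v t"] by linarith
      then show ?thesis using False by (simp add: min_absorb2)
    qed
  qed
  finally show ?thesis unfolding u_def u1_def .
qed

lemma finite_simple_of_square_integrable:
  fixes g :: "'s \<Rightarrow> real"
  assumes g: "simple_function n g" and fin: "(\<integral>\<^sup>+ s. ennreal ((g s)\<^sup>2) \<partial>n) < \<infinity>"
  shows "finite_simple n g"
proof -
  have "Bochner_Integration.simple_bochner_integrable n (\<lambda>s. (g s)\<^sup>2)"
    using fin by (intro simple_bochner_integrableI_bounded simple_function_compose1[OF g, of "\<lambda>x. x\<^sup>2"]) simp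
  then have "emeasure n {s \<in> space n. (g s)\<^sup>2 \<noteq> 0} \<noteq> \<infinity>"
    by (rule simple_bochner_integrable.cases)
  then show ?thesis using g by (simp add: finite_simple_def less_top)
qed

lemma square_diff_le: "((x::real) - y)\<^sup>2 \<le> 2 * (x - z)\<^sup>2 + 2 * (y - z)\<^sup>2"
proof -
  have "0 \<le> (x - z + (y - z))\<^sup>2" by simp
  then show ?thesis by (simp add: power2_eq_square algebra_simps)
qed

lemma min_le_square: "0 < \<delta> \<Longrightarrow> min \<bar>x::real\<bar> 1 \<le> \<delta> + x\<^sup>2 / \<delta>"
proof -
  assume d: "0 < \<delta>"
  have "\<bar>x\<bar> \<le> \<delta> + x\<^sup>2 / \<delta>"
  proof (cases "\<bar>x\<bar> \<le> \<delta>")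
    case True
    then show ?thesis using d by (simp add: add_increasing2)
  next
    case False
    then have "\<delta> * \<bar>x\<bar> \<le> \<bar>x\<bar> * \<bar>x\<bar>" by (intro mult_right_mono) auto
    then have "\<bar>x\<bar> \<le> x\<^sup>2 / \<delta>" using d by (simp add: pos_le_divide_eq power2_eq_square mult.commute)
    then show ?thesis using d by simp
  qed
  then show ?thesis by simp
qed

text \<open>
  The cut is at the size of \<open>f\<close> and not of \<open>F\<close>, so that the parts of step functions \<open>F\<close> converging to \<open>f\<close>
  converge to the parts of \<open>f\<close>.
\<close>

definition small_part :: "('s \<Rightarrow> real) \<Rightarrow> ('s \<Rightarrow> real) \<Rightarrow> 's \<Rightarrow> real" where
  "small_part f F = (\<lambda>s. F s * indicator {s. \<bar>f s\<bar> \<le> 1} s)"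

definition large_part :: "('s \<Rightarrow> real) \<Rightarrow> ('s \<Rightarrow> real) \<Rightarrow> 's \<Rightarrow> real" where
  "large_part f F = (\<lambda>s. F s * indicator {s. \<bar>f s\<bar> > 1} s)"

context poisson_noise
begin

text \<open>
  By the isometry the simple integrals form a Cauchy sequence in mean square. The limit is obtained first
  in probability, and Fatou's lemma along an almost surely convergent subsequence upgrades the convergence to
  mean square. The approximating sequence is given in advance, as the same step functions are cut to
  approximate the small and the large values of an integrand.
\<close>

lemma compensated_integral_exists:
  assumes h[measurable]: "h \<in> borel_measurable n" and sq: "(\<integral>\<^sup>+ s. ennreal ((h s)\<^sup>2) \<partial>n) < \<infinity>"
    and g: "\<And>k. simple_function n (g k)" and lim: "\<And>s. s \<in> space n \<Longrightarrow> (\<lambda>k. g k s) \<longlonglongrightarrow> h s"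
    and bd: "\<And>k s. s \<in> space n \<Longrightarrow> \<bar>g k s\<bar> \<le> 2 * \<bar>h s\<bar>"
  shows "\<And>k. finite_simple n (g k)"
    "\<exists>Y. compensated_integral M n N h Y \<and> (\<lambda>k. expectation (\<lambda>w. min \<bar>simple_integral_compensated n N (g k) w - Y w\<bar> 1)) \<longlonglongrightarrow> 0"
proof -
  have gm[measurable]: "g k \<in> borel_measurable n" for k by (rule borel_measurable_simple_function[OF g])
  have bd2: "(g k s)\<^sup>2 \<le> 4 * (h s)\<^sup>2" if "s \<in> space n" for k s
  proof -
    have "\<bar>g k s\<bar>\<^sup>2 \<le> (2 * \<bar>h s\<bar>)\<^sup>2" by (intro power_mono bd that) auto
    then show ?thesis by (simp add: power_mult_distrib)
  qed
  have sq4: "(\<integral>\<^sup>+ s. ennreal (c * (h s)\<^sup>2) \<partial>n) < \<infinity>" if "0 \<le> c" for c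
    using sq that by (simp add: ennreal_mult nn_integral_cmult ennreal_mult_less_top)
  show fs: "finite_simple n (g k)" for k
  proof (rule finite_simple_of_square_integrable[OF g])
    have "(\<integral>\<^sup>+ s. ennreal ((g k s)\<^sup>2) \<partial>n) \<le> (\<integral>\<^sup>+ s. ennreal (4 * (h s)\<^sup>2) \<partial>n)"
      by (intro nn_integral_mono ennreal_leI bd2)
    then show "(\<integral>\<^sup>+ s. ennreal ((g k s)\<^sup>2) \<partial>n) < \<infinity>" using sq4[of 4] by (rule order.strict_trans1) simp
  qed
  define Dst where "Dst = (\<lambda>k. \<integral>\<^sup>+ s. ennreal ((g k s - h s)\<^sup>2) \<partial>n)"
  have Dst0: "Dst \<longlonglongrightarrow> 0"
  proof -
    have "Dst \<longlonglongrightarrow> (\<integral>\<^sup>+ s. 0 \<partial>n)"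
      unfolding Dst_def
    proof (rule nn_integral_dominated_convergence[where w="\<lambda>s. ennreal (10 * (h s)\<^sup>2)"])
      show "AE s in n. ennreal ((g k s - h s)\<^sup>2) \<le> ennreal (10 * (h s)\<^sup>2)" for k
      proof (rule AE_I2, rule ennreal_leI)
        fix s assume "s \<in> space n"
        then show "(g k s - h s)\<^sup>2 \<le> 10 * (h s)\<^sup>2" using square_diff_le[of "g k s" "h s" 0] bd2[of s k] by simp
      qed
      show "(\<integral>\<^sup>+ s. ennreal (10 * (h s)\<^sup>2) \<partial>n) < \<infinity>" by (rule sq4) simp
      show "AE s in n. (\<lambda>k. ennreal ((g k s - h s)\<^sup>2)) \<longlonglongrightarrow> 0"
      proof (rule AE_I2)
        fix s assume "s \<in> space n"
        then have "(\<lambda>k. (g k s - h s)\<^sup>2) \<longlonglongrightarrow> (h s - h s)\<^sup>2" by (intro tendsto_intros lim)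
        then show "(\<lambda>k. ennreal ((g k s - h s)\<^sup>2)) \<longlonglongrightarrow> 0"
          using tendsto_ennrealI by fastforce
      qed
    qed auto
    then show ?thesis by simp
  qed
  let ?Z = "\<lambda>k. simple_integral_compensated n N (g k)"
  have Zm[measurable]: "?Z k \<in> borel_measurable M" for k by (rule simple_integrals_measurable(2)[OF fs])
  have ZZ: "(\<integral>\<^sup>+ w. ennreal ((?Z k w - ?Z l w)\<^sup>2) \<partial>M) \<le> 2 * Dst k + 2 * Dst l" for k l
  proof -
    have "(\<integral>\<^sup>+ w. ennreal ((?Z k w - ?Z l w)\<^sup>2) \<partial>M) = (\<integral>\<^sup>+ s. ennreal ((g k s - g l s)\<^sup>2) \<partial>n)"
      by (rule simple_compensated_isometry[OF fs fs])
    also have "\<dots> \<le> (\<integral>\<^sup>+ s. 2 * ennreal ((g k s - h s)\<^sup>2) + 2 * ennreal ((g l s - h s)\<^sup>2) \<partial>n)"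
    proof (rule nn_integral_mono)
      fix s
      have "ennreal ((g k s - g l s)\<^sup>2) \<le> ennreal (2 * (g k s - h s)\<^sup>2 + 2 * (g l s - h s)\<^sup>2)"
        by (intro ennreal_leI square_diff_le)
      also have "\<dots> = 2 * ennreal ((g k s - h s)\<^sup>2) + 2 * ennreal ((g l s - h s)\<^sup>2)"
        by (simp add: ennreal_plus ennreal_mult)
      finally show "ennreal ((g k s - g l s)\<^sup>2) \<le> 2 * ennreal ((g k s - h s)\<^sup>2) + 2 * ennreal ((g l s - h s)\<^sup>2)" .
    qed
    also have "\<dots> = 2 * Dst k + 2 * Dst l"
      unfolding Dst_def by (subst nn_integral_add) (simp_all add: nn_integral_cmult)
    finally show ?thesis .
  qed
  \<comment> \<open>\<open>min |x| 1 \<le> \<epsilon>/2 + 2 x^2 / \<epsilon>\<close>, and the mean square is at most \<open>\<epsilon>^2 / 4\<close> eventually\<close>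
  have cauchy: "\<exists>K. \<forall>k\<ge>K. \<forall>l\<ge>K. expectation (\<lambda>w. min \<bar>?Z k w - ?Z l w\<bar> 1) \<le> \<epsilon>" if e: "0 < \<epsilon>" for \<epsilon>
  proof -
    have "eventually (\<lambda>k. Dst k < ennreal (\<epsilon>\<^sup>2 / 16)) sequentially"
      using e by (intro order_tendstoD(2)[OF Dst0]) simp
    then obtain K where K: "\<And>k. K \<le> k \<Longrightarrow> Dst k < ennreal (\<epsilon>\<^sup>2 / 16)" unfolding eventually_sequentially by blast
    have "expectation (\<lambda>w. min \<bar>?Z k w - ?Z l w\<bar> 1) \<le> \<epsilon>" if kl: "K \<le> k" "K \<le> l" for k l
    proof -
      have "(\<integral>\<^sup>+ w. ennreal (min \<bar>?Z k w - ?Z l w\<bar> 1) \<partial>M) \<le> (\<integral>\<^sup>+ w. ennreal (\<epsilon>/2) + ennreal (2/\<epsilon>) * ennreal ((?Z k w - ?Z l w)\<^sup>2) \<partial>M)"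
      proof (rule nn_integral_mono)
        fix w
        have "ennreal (min \<bar>?Z k w - ?Z l w\<bar> 1) \<le> ennreal (\<epsilon>/2 + (2/\<epsilon>) * (?Z k w - ?Z l w)\<^sup>2)"
          using min_le_square[of "\<epsilon>/2" "?Z k w - ?Z l w"] e by (intro ennreal_leI) (simp add: mult.commute)
        also have "\<dots> = ennreal (\<epsilon>/2) + ennreal (2/\<epsilon>) * ennreal ((?Z k w - ?Z l w)\<^sup>2)"
          using e by (subst ennreal_plus) (auto simp: ennreal_mult'[symmetric])
        finally show "ennreal (min \<bar>?Z k w - ?Z l w\<bar> 1) \<le> ennreal (\<epsilon>/2) + ennreal (2/\<epsilon>) * ennreal ((?Z k w - ?Z l w)\<^sup>2)" .
      qed
      also have "\<dots> = ennreal (\<epsilon>/2) + ennreal (2/\<epsilon>) * (\<integral>\<^sup>+ w. ennreal ((?Z k w - ?Z l w)\<^sup>2) \<partial>M)"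
        by (subst nn_integral_add) (simp_all add: nn_integral_cmult emeasure_space_1)
      also have "\<dots> \<le> ennreal (\<epsilon>/2) + ennreal (2/\<epsilon>) * (2 * Dst k + 2 * Dst l)"
        by (intro add_left_mono mult_left_mono ZZ) simp
      also have "\<dots> \<le> ennreal (\<epsilon>/2) + ennreal (2/\<epsilon>) * (2 * ennreal (\<epsilon>\<^sup>2 / 16) + 2 * ennreal (\<epsilon>\<^sup>2 / 16))"
        using K[OF kl(1)] K[OF kl(2)] by (intro add_mono mult_left_mono order_refl less_imp_le) (use e in auto)
      also have "\<dots> = ennreal (\<epsilon>/2) + ennreal (2/\<epsilon>) * ennreal (\<epsilon>\<^sup>2 / 4)"
      proof -
        have "2 * ennreal (\<epsilon>\<^sup>2 / 16) = ennreal (\<epsilon>\<^sup>2 / 8)"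
          using ennreal_mult[of 2 "\<epsilon>\<^sup>2/16"] by simp
        then show ?thesis by (simp flip: ennreal_plus)
      qed
      also have "\<dots> = ennreal (\<epsilon>/2 + (2/\<epsilon>) * (\<epsilon>\<^sup>2 / 4))"
        using e by (subst ennreal_plus) (auto simp: ennreal_mult'[symmetric])
      also have "\<epsilon>/2 + (2/\<epsilon>) * (\<epsilon>\<^sup>2 / 4) = \<epsilon>" using e by (simp add: power2_eq_square)
      finally have "(\<integral>\<^sup>+ w. ennreal (min \<bar>?Z k w - ?Z l w\<bar> 1) \<partial>M) \<le> ennreal \<epsilon>" .
      moreover have "(\<integral>\<^sup>+ w. ennreal (min \<bar>?Z k w - ?Z l w\<bar> 1) \<partial>M) = ennreal (expectation (\<lambda>w. min \<bar>?Z k w - ?Z l w\<bar> 1))"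
        by (intro nn_integral_eq_integral integrable_const_bound[where B=1]) auto
      ultimately show ?thesis using e by simp
    qed
    then show ?thesis by blast
  qed
  obtain Y r where Y[measurable]: "Y \<in> borel_measurable M" and r: "strict_mono (r :: nat \<Rightarrow> nat)"
    and ae: "AE w in M. (\<lambda>j. ?Z (r j) w) \<longlonglongrightarrow> Y w" and ZY: "(\<lambda>k. expectation (\<lambda>w. min \<bar>?Z k w - Y w\<bar> 1)) \<longlonglongrightarrow> 0"
    by (rule cauchy_in_prob_limit[OF Zm cauchy])
  have L2: "(\<integral>\<^sup>+ w. ennreal ((?Z k w - Y w)\<^sup>2) \<partial>M) \<le> 2 * Dst k" for k
  proof -
    have "(\<integral>\<^sup>+ w. ennreal ((?Z k w - Y w)\<^sup>2) \<partial>M) = (\<integral>\<^sup>+ w. liminf (\<lambda>j. ennreal ((?Z k w - ?Z (r j) w)\<^sup>2)) \<partial>M)"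
    proof (rule nn_integral_cong_AE)
      show "AE w in M. ennreal ((?Z k w - Y w)\<^sup>2) = liminf (\<lambda>j. ennreal ((?Z k w - ?Z (r j) w)\<^sup>2))"
        using ae
      proof eventually_elim
        case (elim w)
        then have "(\<lambda>j. ennreal ((?Z k w - ?Z (r j) w)\<^sup>2)) \<longlonglongrightarrow> ennreal ((?Z k w - Y w)\<^sup>2)"
          by (intro tendsto_ennrealI tendsto_intros)
        then show ?case by (intro lim_imp_Liminf[symmetric]) auto
      qed
    qed
    also have "\<dots> \<le> liminf (\<lambda>j. \<integral>\<^sup>+ w. ennreal ((?Z k w - ?Z (r j) w)\<^sup>2) \<partial>M)"
      by (rule nn_integral_liminf) simp
    also have "\<dots> \<le> liminf (\<lambda>j. 2 * Dst k + 2 * Dst (r j))"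
      by (intro Liminf_mono always_eventually allI ZZ)
    also have "\<dots> = 2 * Dst k + 2 * 0"
    proof (rule lim_imp_Liminf)
      have "(\<lambda>j. Dst (r j)) \<longlonglongrightarrow> 0" using LIMSEQ_subseq_LIMSEQ[OF Dst0 r] by (simp add: comp_def)
      then show "(\<lambda>j. 2 * Dst k + 2 * Dst (r j)) \<longlonglongrightarrow> 2 * Dst k + 2 * 0"
        by (intro tendsto_add tendsto_const ennreal_tendsto_cmult) auto
    qed simp
    finally show ?thesis by simp
  qed
  have "(\<lambda>k. 2 * Dst k) \<longlonglongrightarrow> 2 * 0" by (intro ennreal_tendsto_cmult Dst0) simp
  then have D20: "(\<lambda>k. 2 * Dst k) \<longlonglongrightarrow> 0" by simp
  have "(\<lambda>k. \<integral>\<^sup>+ w. ennreal ((?Z k w - Y w)\<^sup>2) \<partial>M) \<longlonglongrightarrow> 0"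
    by (rule tendsto_sandwich[OF always_eventually always_eventually tendsto_const D20]) (use L2 in auto)
  then have "compensated_integral M n N h Y"
    unfolding compensated_integral_def using Y fs Dst0[unfolded Dst_def] by blast
  then show "\<exists>Y. compensated_integral M n N h Y \<and> (\<lambda>k. expectation (\<lambda>w. min \<bar>?Z k w - Y w\<bar> 1)) \<longlonglongrightarrow> 0"
    using ZY by blast
qed

text \<open>
  The same with the contraction property of integrals with respect to \<open>N\<close>: the truncated distances
  \<open>min |g k - h| 1\<close> are dominated by the indicator of a set of finite measure.
\<close>

lemma N_integral_exists:
  assumes h[measurable]: "h \<in> borel_measurable n" and supp: "emeasure n {s \<in> space n. h s \<noteq> 0} < \<infinity>"
    and g: "\<And>k. simple_function n (g k)" and lim: "\<And>s. s \<in> space n \<Longrightarrow> (\<lambda>k. g k s) \<longlonglongrightarrow> h s"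
    and bd: "\<And>k s. s \<in> space n \<Longrightarrow> \<bar>g k s\<bar> \<le> 2 * \<bar>h s\<bar>"
  shows "\<And>k. finite_simple n (g k)"
    "\<exists>Y. N_integral M n N h Y \<and> (\<lambda>k. expectation (\<lambda>w. min \<bar>simple_integral_N n N (g k) w - Y w\<bar> 1)) \<longlonglongrightarrow> 0"
proof -
  have gm[measurable]: "g k \<in> borel_measurable n" for k by (rule borel_measurable_simple_function[OF g])
  have g0: "g k s = 0" if "s \<in> space n" "h s = 0" for k s using bd[OF that(1), of k] that(2) by simp
  show fs: "finite_simple n (g k)" for k
  proof -
    have "emeasure n {s \<in> space n. g k s \<noteq> 0} \<le> emeasure n {s \<in> space n. h s \<noteq> 0}"
      using g0 by (intro emeasure_mono) auto
    then show ?thesis using g supp by (auto simp: finite_simple_def intro: order.strict_trans1)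
  qed
  have wi: "integrable n (indicat_real {s \<in> space n. h s \<noteq> 0})"
    using supp by (intro integrable_real_indicator) auto
  have ei: "integrable n (\<lambda>s. min \<bar>g k s - h s\<bar> 1)" for k
    by (rule Bochner_Integration.integrable_bound[OF wi]) (auto simp: indicator_def g0)
  define e where "e = (\<lambda>k. \<integral>s. min \<bar>g k s - h s\<bar> 1 \<partial>n)"
  have e0: "e \<longlonglongrightarrow> 0"
  proof -
    have "e \<longlonglongrightarrow> (\<integral>s. 0 \<partial>n)"
      unfolding e_def
    proof (rule integral_dominated_convergence[OF _ _ wi])
      show "AE s in n. (\<lambda>k. min \<bar>g k s - h s\<bar> 1) \<longlonglongrightarrow> 0"
      proof (rule AE_I2)
        fix s assume "s \<in> space n"
        then have "(\<lambda>k. min \<bar>g k s - h s\<bar> 1) \<longlonglongrightarrow> min \<bar>h s - h s\<bar> 1" by (intro tendsto_intros lim)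
        then show "(\<lambda>k. min \<bar>g k s - h s\<bar> 1) \<longlonglongrightarrow> 0" by simp
      qed
      show "AE s in n. norm (min \<bar>g k s - h s\<bar> 1) \<le> indicat_real {s \<in> space n. h s \<noteq> 0} s" for k
        by (auto simp: indicator_def g0)
    qed auto
    then show ?thesis by simp
  qed
  let ?Z = "\<lambda>k. simple_integral_N n N (g k)"
  have Zm[measurable]: "?Z k \<in> borel_measurable M" for k by (rule simple_integrals_measurable(1)[OF fs])
  have ZZ: "expectation (\<lambda>w. min \<bar>?Z k w - ?Z l w\<bar> 1) \<le> e k + e l" for k l
  proof -
    have "expectation (\<lambda>w. min \<bar>?Z k w - ?Z l w\<bar> 1) \<le> (\<integral>s. min \<bar>g k s - g l s\<bar> 1 \<partial>n)"
      by (rule simple_N_contraction(1)[OF fs fs])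
    also have "\<dots> \<le> (\<integral>s. min \<bar>g k s - h s\<bar> 1 + min \<bar>g l s - h s\<bar> 1 \<partial>n)"
      by (intro integral_mono simple_N_contraction(2)[OF fs fs] Bochner_Integration.integrable_add ei) (auto simp: min_def)
    also have "\<dots> = e k + e l" unfolding e_def by (intro Bochner_Integration.integral_add ei)
    finally show ?thesis .
  qed
  have cauchy: "\<exists>K. \<forall>k\<ge>K. \<forall>l\<ge>K. expectation (\<lambda>w. min \<bar>?Z k w - ?Z l w\<bar> 1) \<le> \<epsilon>" if "0 < \<epsilon>" for \<epsilon>
  proof -
    have "eventually (\<lambda>k. e k < \<epsilon> / 2) sequentially"
      using that by (intro order_tendstoD(2)[OF e0]) simp
    then obtain K where K: "\<And>k. K \<le> k \<Longrightarrow> e k < \<epsilon> / 2" unfolding eventually_sequentially by blast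
    have "expectation (\<lambda>w. min \<bar>?Z k w - ?Z l w\<bar> 1) \<le> \<epsilon>" if "K \<le> k" "K \<le> l" for k l
      using ZZ[of k l] K[OF that(1)] K[OF that(2)] by linarith
    then show ?thesis by blast
  qed
  obtain Y and r :: "nat \<Rightarrow> nat" where Y[measurable]: "Y \<in> borel_measurable M"
    and ZY: "(\<lambda>k. expectation (\<lambda>w. min \<bar>?Z k w - Y w\<bar> 1)) \<longlonglongrightarrow> 0"
    by (rule cauchy_in_prob_limit[OF Zm cauchy])
  have "tendsto_in_prob M ?Z Y" by (rule tendsto_in_prob_of_min[OF Zm Y ZY])
  then have "N_integral M n N h Y"
    unfolding N_integral_def using Y supp fs g0 lim by (intro conjI exI[of _ g]) auto
  then show "\<exists>Y. N_integral M n N h Y \<and> (\<lambda>k. expectation (\<lambda>w. min \<bar>?Z k w - Y w\<bar> 1)) \<longlonglongrightarrow> 0"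
    using ZY by blast
qed

text \<open>
  The step functions approximating \<open>f\<close> are provided together with the integral, since the joint
  characteristic function of several integrals is computed by passing to the limit in \<open>simple_char\<close>.
\<close>

lemma poissonian_integral_approx:
  assumes f[measurable]: "f \<in> borel_measurable n" and fin: "(\<integral>\<^sup>+ s. ennreal (min ((f s)\<^sup>2) 1) \<partial>n) < \<infinity>"
  shows "\<exists>Y F. Y \<in> borel_measurable M \<and>
    poissonian_integral chi M n N f (\<lambda>w. Y w + (\<integral>s. f s * (indicator {s. \<bar>f s\<bar> \<le> 1} s - chi (f s)) \<partial>n)) \<and>
    (\<forall>k. simple_function n (F k)) \<and> (\<forall>s\<in>space n. (\<lambda>k. F k s) \<longlonglongrightarrow> f s) \<and> (\<forall>k. \<forall>s\<in>space n. \<bar>F k s\<bar> \<le> 2 * \<bar>f s\<bar>) \<and>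
    (\<forall>k. finite_simple n (small_part f (F k)) \<and> finite_simple n (large_part f (F k))) \<and>
    (\<lambda>k. expectation (\<lambda>w. min \<bar>simple_integral_compensated n N (small_part f (F k)) w
        + simple_integral_N n N (large_part f (F k)) w - Y w\<bar> 1)) \<longlonglongrightarrow> 0"
proof -
  obtain F where F: "\<And>k. simple_function n (F k)" "\<And>s. s \<in> space n \<Longrightarrow> (\<lambda>k. F k s) \<longlonglongrightarrow> f s"
    "\<And>k s. s \<in> space n \<Longrightarrow> \<bar>F k s\<bar> \<le> 2 * \<bar>f s\<bar>"
  proof -
    from borel_measurable_implies_sequence_metric[OF f, of 0]
    obtain F where "\<forall>i. simple_function n (F i)" "\<forall>s\<in>space n. (\<lambda>i. F i s) \<longlonglongrightarrow> f s"
      "\<forall>i. \<forall>s\<in>space n. dist (F i s) 0 \<le> 2 * dist (f s) 0" by blast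
    then show thesis by (intro that[of F]) (simp_all add: dist_real_def)
  qed
  have simple: "simple_function n (small_part f (F k))" "simple_function n (large_part f (F k))" for k
  proof -
    have s: "simple_function n (\<lambda>s. if P s then F k s else 0)" if "{s \<in> space n. P s} \<in> sets n" for P
      by (rule simple_function_If[OF F(1) simple_function_const that])
    have "small_part f (F k) = (\<lambda>s. if \<bar>f s\<bar> \<le> 1 then F k s else 0)" "large_part f (F k) = (\<lambda>s. if \<bar>f s\<bar> > 1 then F k s else 0)"
      by (auto simp: small_part_def large_part_def fun_eq_iff)
    then show "simple_function n (small_part f (F k))" "simple_function n (large_part f (F k))"
      by (auto intro!: s)
  qed
  have m: "small_part f f \<in> borel_measurable n" "large_part f f \<in> borel_measurable n"
    unfolding small_part_def large_part_def by measurable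
  have lims: "(\<lambda>k. small_part f (F k) s) \<longlonglongrightarrow> small_part f f s" "(\<lambda>k. large_part f (F k) s) \<longlonglongrightarrow> large_part f f s"
    if "s \<in> space n" for s
    unfolding small_part_def large_part_def by (intro tendsto_intros F(2) that)+
  have bds: "\<bar>small_part f (F k) s\<bar> \<le> 2 * \<bar>small_part f f s\<bar>" "\<bar>large_part f (F k) s\<bar> \<le> 2 * \<bar>large_part f f s\<bar>"
    if "s \<in> space n" for k s
    using F(3)[OF that, of k] by (auto simp: small_part_def large_part_def indicator_def)
  have "(\<integral>\<^sup>+ s. ennreal ((small_part f f s)\<^sup>2) \<partial>n) \<le> (\<integral>\<^sup>+ s. ennreal (min ((f s)\<^sup>2) 1) \<partial>n)"
    by (intro nn_integral_mono ennreal_leI) (auto simp: small_part_def indicator_def abs_square_le_1)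
  then have sq: "(\<integral>\<^sup>+ s. ennreal ((small_part f f s)\<^sup>2) \<partial>n) < \<infinity>" using fin by (rule order.strict_trans1)
  have supp: "emeasure n {s \<in> space n. large_part f f s \<noteq> 0} < \<infinity>"
  proof -
    have "emeasure n {s \<in> space n. large_part f f s \<noteq> 0} = (\<integral>\<^sup>+ s. indicator {s \<in> space n. large_part f f s \<noteq> 0} s \<partial>n)"
      using m(2) by simp
    also have "\<dots> \<le> (\<integral>\<^sup>+ s. ennreal (min ((f s)\<^sup>2) 1) \<partial>n)"
    proof (rule nn_integral_mono)
      fix s
      have "1 \<le> (f s)\<^sup>2" if "1 < \<bar>f s\<bar>" using abs_square_le_1[of "f s"] that by linarith
      then show "indicator {s \<in> space n. large_part f f s \<noteq> 0} s \<le> ennreal (min ((f s)\<^sup>2) 1)"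
        by (auto simp: large_part_def indicator_def min_absorb2)
    qed
    finally show ?thesis using fin by (rule order.strict_trans1)
  qed
  note c = compensated_integral_exists[OF m(1) sq simple(1) lims(1) bds(1)]
  note d = N_integral_exists[OF m(2) supp simple(2) lims(2) bds(2)]
  obtain Y1 where Y1: "compensated_integral M n N (small_part f f) Y1"
    "(\<lambda>k. expectation (\<lambda>w. min \<bar>simple_integral_compensated n N (small_part f (F k)) w - Y1 w\<bar> 1)) \<longlonglongrightarrow> 0"
    using c(2) by blast
  obtain Y2 where Y2: "N_integral M n N (large_part f f) Y2"
    "(\<lambda>k. expectation (\<lambda>w. min \<bar>simple_integral_N n N (large_part f (F k)) w - Y2 w\<bar> 1)) \<longlonglongrightarrow> 0"
    using d(2) by blast
  have Ym[measurable]: "Y1 \<in> borel_measurable M" "Y2 \<in> borel_measurable M"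
    using Y1(1) Y2(1) by (auto simp: compensated_integral_def N_integral_def)
  have Zm[measurable]: "simple_integral_compensated n N (small_part f (F k)) \<in> borel_measurable M"
    "simple_integral_N n N (large_part f (F k)) \<in> borel_measurable M" for k
    by (rule simple_integrals_measurable(2)[OF c(1)], assumption+, rule simple_integrals_measurable(1)[OF d(1)], assumption+)
  let ?E = "\<lambda>k. expectation (\<lambda>w. min \<bar>simple_integral_compensated n N (small_part f (F k)) w
        + simple_integral_N n N (large_part f (F k)) w - (Y1 w + Y2 w)\<bar> 1)"
  have "?E k \<le> expectation (\<lambda>w. min \<bar>simple_integral_compensated n N (small_part f (F k)) w - Y1 w\<bar> 1)
      + expectation (\<lambda>w. min \<bar>simple_integral_N n N (large_part f (F k)) w - Y2 w\<bar> 1)" for k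
  proof -
    have i: "integrable M (\<lambda>w. min \<bar>simple_integral_compensated n N (small_part f (F k)) w - Y1 w\<bar> 1)"
      "integrable M (\<lambda>w. min \<bar>simple_integral_N n N (large_part f (F k)) w - Y2 w\<bar> 1)"
      "integrable M (\<lambda>w. min \<bar>simple_integral_compensated n N (small_part f (F k)) w
        + simple_integral_N n N (large_part f (F k)) w - (Y1 w + Y2 w)\<bar> 1)"
      by (rule integrable_const_bound[where B=1]; simp)+
    have "?E k \<le> expectation (\<lambda>w. min \<bar>simple_integral_compensated n N (small_part f (F k)) w - Y1 w\<bar> 1
        + min \<bar>simple_integral_N n N (large_part f (F k)) w - Y2 w\<bar> 1)"
      by (intro integral_mono i Bochner_Integration.integrable_add) (auto simp: min_def)
    then show ?thesis using i by (simp only: Bochner_Integration.integral_add)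
  qed
  note Ele = this
  have E0': "(\<lambda>k. expectation (\<lambda>w. min \<bar>simple_integral_compensated n N (small_part f (F k)) w - Y1 w\<bar> 1)
      + expectation (\<lambda>w. min \<bar>simple_integral_N n N (large_part f (F k)) w - Y2 w\<bar> 1)) \<longlonglongrightarrow> 0"
    using tendsto_add[OF Y1(2) Y2(2)] by simp
  have E0: "?E \<longlonglongrightarrow> 0"
    by (rule tendsto_sandwich[OF always_eventually always_eventually tendsto_const E0'])
      (use Ele in \<open>auto intro!: integral_nonneg_AE\<close>)
  have "poissonian_integral chi M n N f (\<lambda>w. (Y1 w + Y2 w) + (\<integral>s. f s * (indicator {s. \<bar>f s\<bar> \<le> 1} s - chi (f s)) \<partial>n))"
    unfolding poissonian_integral_def
    using f fin Y1(1) Y2(1) Ym by (intro conjI exI[of _ Y1] exI[of _ Y2]) (auto simp: small_part_def large_part_def)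
  then show ?thesis
    using F c(1) d(1) E0 by (intro exI[of _ "\<lambda>w. Y1 w + Y2 w"] exI[of _ F] conjI allI ballI) auto
qed

text \<open>
  The exponent of the approximating step functions converges by dominated convergence. It compensates at
  the level \<open>|V t| \<le> 1\<close>; the drift that belongs to the cutoff function moves the compensation to
  \<open>V t * \<chi> (V t)\<close>.
\<close>

theorem poissonian_integrals_exist:
  fixes V :: "'t \<Rightarrow> 's \<Rightarrow> real"
  assumes chi: "cutoff chi"
    and V: "\<And>t. t \<in> T \<Longrightarrow> V t \<in> borel_measurable n" "\<And>t. t \<in> T \<Longrightarrow> (\<integral>\<^sup>+ s. ennreal (min ((V t s)\<^sup>2) 1) \<partial>n) < \<infinity>"
  obtains H where "\<And>t. t \<in> T \<Longrightarrow> poissonian_integral chi M n N (V t) (H t)"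
    "\<And>I (a :: 't \<Rightarrow> real). finite I \<Longrightarrow> I \<subseteq> T \<Longrightarrow> expectation (\<lambda>w. iexp (\<Sum>t\<in>I. a t * H t w)) =
      exp (\<integral>s. (iexp (\<Sum>t\<in>I. a t * V t s) - 1 - \<i> * complex_of_real (\<Sum>t\<in>I. a t * (V t s * chi (V t s)))) \<partial>n)"
proof -
  define drift where "drift = (\<lambda>t. \<integral>s. V t s * (indicator {s. \<bar>V t s\<bar> \<le> 1} s - chi (V t s)) \<partial>n)"
  define appr where "appr = (\<lambda>t Y F. Y \<in> borel_measurable M \<and>
    poissonian_integral chi M n N (V t) (\<lambda>w. Y w + drift t) \<and>
    (\<forall>k. simple_function n (F k)) \<and> (\<forall>s\<in>space n. (\<lambda>k. F k s) \<longlonglongrightarrow> V t s) \<and> (\<forall>k. \<forall>s\<in>space n. \<bar>F k s\<bar> \<le> 2 * \<bar>V t s\<bar>) \<and>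
    (\<forall>k. finite_simple n (small_part (V t) (F k)) \<and> finite_simple n (large_part (V t) (F k))) \<and>
    (\<lambda>k. expectation (\<lambda>w. min \<bar>simple_integral_compensated n N (small_part (V t) (F k)) w
        + simple_integral_N n N (large_part (V t) (F k)) w - Y w\<bar> 1)) \<longlonglongrightarrow> 0)"
  have "\<forall>t\<in>T. \<exists>YF. appr t (fst YF) (snd YF)"
  proof
    fix t assume t: "t \<in> T"
    then obtain Y F where "appr t Y F"
      using poissonian_integral_approx[OF V(1)[OF t] V(2)[OF t], of chi] unfolding appr_def drift_def by blast
    then show "\<exists>YF. appr t (fst YF) (snd YF)" by (intro exI[of _ "(Y, F)"]) simp
  qed
  from bchoice[OF this] obtain YF where "\<forall>t\<in>T. appr t (fst (YF t)) (snd (YF t))" by (rule exE)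
  then have YF: "appr t (fst (YF t)) (snd (YF t))" if "t \<in> T" for t using that by (rule bspec)
  define Y where "Y = (\<lambda>t. fst (YF t))"
  define F where "F = (\<lambda>t. snd (YF t))"
  have ap: "appr t (Y t) (F t)" if "t \<in> T" for t using YF[OF that] by (simp add: Y_def F_def)
  define H where "H = (\<lambda>t w. Y t w + drift t)"
  show thesis
  proof (rule that[of H])
    show "poissonian_integral chi M n N (V t) (H t)" if "t \<in> T" for t
      using ap[OF that] by (simp add: appr_def H_def)
    fix I and a :: "'t \<Rightarrow> real" assume I: "finite I" "I \<subseteq> T"
    have apI: "appr t (Y t) (F t)" if "t \<in> I" for t using ap I that by blast
    have Vm: "V t \<in> borel_measurable n" if "t \<in> I" for t using V I that by blast
    have Fm: "F t k \<in> borel_measurable n" if "t \<in> I" for t k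
      using apI[OF that] by (auto simp: appr_def intro: borel_measurable_simple_function)
    have chim: "chi \<in> borel_measurable borel" using chi by (simp add: cutoff_def)
    \<comment> \<open>the exponent with the sharp cutoff at 1; it is determined by \<open>V\<close> also when \<open>x\<close> is an approximation of \<open>V\<close>\<close>
    define \<phi> where "\<phi> = (\<lambda>x s. iexp (\<Sum>t\<in>I. a t * x t) - 1 - \<i> * complex_of_real (\<Sum>t\<in>I. a t * (x t * indicator {y. \<bar>y\<bar> \<le> 1} (V t s))))"
    define W where "W = (\<lambda>s. \<Sum>t\<in>I. (2 + 2 * real (card I) * (a t)\<^sup>2) * min ((V t s)\<^sup>2) 1)"
    have mi: "integrable n (\<lambda>s. min ((V t s)\<^sup>2) 1)" if "t \<in> I" for t
    proof (rule integrableI_nonneg)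
      show "(\<lambda>s. min ((V t s)\<^sup>2) 1) \<in> borel_measurable n" using Vm[OF that] by measurable
      show "(\<integral>\<^sup>+ s. ennreal (min ((V t s)\<^sup>2) 1) \<partial>n) < \<infinity>" using V(2) I that by blast
    qed simp
    have Wi: "integrable n W"
      unfolding W_def by (intro Bochner_Integration.integrable_sum integrable_mult_right mi)
    have indm: "(\<lambda>s. indicat_real {y. \<bar>y\<bar> \<le> 1} (V t s)) \<in> borel_measurable n" if "t \<in> I" for t
      by (rule measurable_compose[OF Vm[OF that]]) simp
    have phim: "(\<lambda>s. \<phi> (\<lambda>t. X t s) s) \<in> borel_measurable n" if X: "\<And>t. t \<in> I \<Longrightarrow> X t \<in> borel_measurable n" for X
    proof -
      have [measurable]: "(\<lambda>s. \<Sum>t\<in>I. a t * X t s) \<in> borel_measurable n"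
        "(\<lambda>s. \<Sum>t\<in>I. a t * (X t s * indicator {y. \<bar>y\<bar> \<le> 1} (V t s))) \<in> borel_measurable n"
        using X by (auto intro!: borel_measurable_sum borel_measurable_times indm)
      show ?thesis unfolding \<phi>_def by measurable
    qed
    have phi_lim: "(\<lambda>k. \<integral>s. \<phi> (\<lambda>t. F t k s) s \<partial>n) \<longlonglongrightarrow> (\<integral>s. \<phi> (\<lambda>t. V t s) s \<partial>n)"
    proof (rule integral_dominated_convergence[OF phim[OF Vm] phim[OF Fm] Wi])
      show "AE s in n. (\<lambda>k. \<phi> (\<lambda>t. F t k s) s) \<longlonglongrightarrow> \<phi> (\<lambda>t. V t s) s"
      proof (rule AE_I2)
        fix s assume "s \<in> space n"
        then have "(\<lambda>k. F t k s) \<longlonglongrightarrow> V t s" if "t \<in> I" for t using apI[OF that] by (simp add: appr_def)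
        then show "(\<lambda>k. \<phi> (\<lambda>t. F t k s) s) \<longlonglongrightarrow> \<phi> (\<lambda>t. V t s) s"
          unfolding \<phi>_def by (intro tendsto_intros)
      qed
      show "AE s in n. norm (\<phi> (\<lambda>t. F t k s) s) \<le> W s" for k
      proof (rule AE_I2)
        fix s assume "s \<in> space n"
        then have "\<bar>F t k s\<bar> \<le> 2 * \<bar>V t s\<bar>" if "t \<in> I" for t using apI[OF that] by (simp add: appr_def)
        then show "norm (\<phi> (\<lambda>t. F t k s) s) \<le> W s"
          unfolding \<phi>_def W_def by (rule levy_exponent_bound[OF I(1)])
      qed
    qed
    have phi_int: "integrable n (\<lambda>s. \<phi> (\<lambda>t. V t s) s)"
    proof (rule Bochner_Integration.integrable_bound[OF Wi phim[OF Vm]])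
      have "norm (\<phi> (\<lambda>t. V t s) s) \<le> W s" for s
        unfolding \<phi>_def W_def by (rule levy_exponent_bound[OF I(1)]) simp
      then show "AE s in n. norm (\<phi> (\<lambda>t. V t s) s) \<le> norm (W s)" by (intro AE_I2) (simp add: order_trans[OF _ abs_ge_self])
    qed
    let ?Z = "\<lambda>t k w. simple_integral_compensated n N (small_part (V t) (F t k)) w + simple_integral_N n N (large_part (V t) (F t k)) w"
    have "(\<lambda>k. expectation (\<lambda>w. iexp (\<Sum>t\<in>I. a t * ?Z t k w))) \<longlonglongrightarrow> expectation (\<lambda>w. iexp (\<Sum>t\<in>I. a t * Y t w))"
    proof (rule char_tendsto[OF I(1)])
      fix t assume t: "t \<in> I"
      show "?Z t k \<in> borel_measurable M" for k
        using apI[OF t] by (intro borel_measurable_add simple_integrals_measurable) (auto simp: appr_def)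
      show "Y t \<in> borel_measurable M" "(\<lambda>k. expectation (\<lambda>w. min \<bar>?Z t k w - Y t w\<bar> 1)) \<longlonglongrightarrow> 0"
        using apI[OF t] by (auto simp: appr_def)
    qed
    moreover have "expectation (\<lambda>w. iexp (\<Sum>t\<in>I. a t * ?Z t k w)) = exp (\<integral>s. \<phi> (\<lambda>t. F t k s) s \<partial>n)" for k
    proof -
      have "expectation (\<lambda>w. iexp (\<Sum>t\<in>I. a t * ?Z t k w)) =
        exp (\<integral>s. (iexp (\<Sum>t\<in>I. a t * (small_part (V t) (F t k) s + large_part (V t) (F t k) s)) - 1
          - \<i> * complex_of_real (\<Sum>t\<in>I. a t * small_part (V t) (F t k) s)) \<partial>n)"
        using apI by (intro simple_char I(1)) (auto simp: appr_def)
      moreover have "small_part (V t) (F t k) s + large_part (V t) (F t k) s = F t k s"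
        "small_part (V t) (F t k) s = F t k s * indicator {y. \<bar>y\<bar> \<le> 1} (V t s)" for t s
        by (auto simp: small_part_def large_part_def indicator_def)
      ultimately show ?thesis unfolding \<phi>_def by (simp only:)
    qed
    ultimately have charY: "expectation (\<lambda>w. iexp (\<Sum>t\<in>I. a t * Y t w)) = exp (\<integral>s. \<phi> (\<lambda>t. V t s) s \<partial>n)"
      using tendsto_exp[OF phi_lim] by (simp only:) (rule LIMSEQ_unique)
    obtain C where C: "0 \<le> C" "\<And>v. \<bar>v * (indicator {x. \<bar>x\<bar> \<le> 1} v - chi v)\<bar> \<le> C * min (v\<^sup>2) 1"
      using cutoff_bound[OF chi] by blast
    have di: "integrable n (\<lambda>s. V t s * (indicator {y. \<bar>y\<bar> \<le> 1} (V t s) - chi (V t s)))" if t: "t \<in> I" for t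
    proof (rule Bochner_Integration.integrable_bound)
      show "integrable n (\<lambda>s. C * min ((V t s)\<^sup>2) 1)" by (intro integrable_mult_right mi t)
      show "(\<lambda>s. V t s * (indicator {y. \<bar>y\<bar> \<le> 1} (V t s) - chi (V t s))) \<in> borel_measurable n"
        by (intro borel_measurable_times borel_measurable_diff Vm indm t measurable_compose[OF Vm[OF t] chim])
      show "AE s in n. norm (V t s * (indicator {y. \<bar>y\<bar> \<le> 1} (V t s) - chi (V t s))) \<le> norm (C * min ((V t s)\<^sup>2) 1)"
        using C by (intro AE_I2) (simp only: real_norm_def, rule order_trans[OF C(2) abs_ge_self])
    qed
    have dr: "drift t = (\<integral>s. V t s * (indicator {y. \<bar>y\<bar> \<le> 1} (V t s) - chi (V t s)) \<partial>n)" for t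
      unfolding drift_def by (intro Bochner_Integration.integral_cong) (auto simp: indicator_def)
    have "(\<integral>s. (iexp (\<Sum>t\<in>I. a t * V t s) - 1 - \<i> * complex_of_real (\<Sum>t\<in>I. a t * (V t s * chi (V t s)))) \<partial>n)
        = (\<integral>s. \<phi> (\<lambda>t. V t s) s + \<i> * complex_of_real (\<Sum>t\<in>I. a t * (V t s * (indicator {y. \<bar>y\<bar> \<le> 1} (V t s) - chi (V t s)))) \<partial>n)"
    proof (intro Bochner_Integration.integral_cong refl)
      fix s
      have "(\<Sum>t\<in>I. a t * (V t s * (indicator {y. \<bar>y\<bar> \<le> 1} (V t s) - chi (V t s)))) =
        (\<Sum>t\<in>I. a t * (V t s * indicator {y. \<bar>y\<bar> \<le> 1} (V t s))) - (\<Sum>t\<in>I. a t * (V t s * chi (V t s)))"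
        by (simp only: right_diff_distrib sum_subtractf)
      then show "iexp (\<Sum>t\<in>I. a t * V t s) - 1 - \<i> * complex_of_real (\<Sum>t\<in>I. a t * (V t s * chi (V t s)))
          = \<phi> (\<lambda>t. V t s) s + \<i> * complex_of_real (\<Sum>t\<in>I. a t * (V t s * (indicator {y. \<bar>y\<bar> \<le> 1} (V t s) - chi (V t s))))"
        unfolding \<phi>_def by (simp only: of_real_diff right_diff_distrib) simp
    qed
    also have "\<dots> = (\<integral>s. \<phi> (\<lambda>t. V t s) s \<partial>n) + (\<integral>s. \<i> * complex_of_real (\<Sum>t\<in>I. a t * (V t s * (indicator {y. \<bar>y\<bar> \<le> 1} (V t s) - chi (V t s)))) \<partial>n)"
      by (intro Bochner_Integration.integral_add phi_int integrable_mult_right integrable_of_real Bochner_Integration.integrable_sum di)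
    also have "(\<integral>s. \<i> * complex_of_real (\<Sum>t\<in>I. a t * (V t s * (indicator {y. \<bar>y\<bar> \<le> 1} (V t s) - chi (V t s)))) \<partial>n)
        = \<i> * complex_of_real (\<Sum>t\<in>I. a t * drift t)"
    proof -
      have "(\<integral>s. (\<Sum>t\<in>I. a t * (V t s * (indicator {y. \<bar>y\<bar> \<le> 1} (V t s) - chi (V t s)))) \<partial>n) = (\<Sum>t\<in>I. a t * drift t)"
        unfolding dr by (subst Bochner_Integration.integral_sum) (auto intro!: integrable_mult_right di)
      then show ?thesis by (simp only: integral_mult_right_zero integral_complex_of_real)
    qed
    finally have expo: "(\<integral>s. (iexp (\<Sum>t\<in>I. a t * V t s) - 1 - \<i> * complex_of_real (\<Sum>t\<in>I. a t * (V t s * chi (V t s)))) \<partial>n)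
        = (\<integral>s. \<phi> (\<lambda>t. V t s) s \<partial>n) + \<i> * complex_of_real (\<Sum>t\<in>I. a t * drift t)" .
    have "expectation (\<lambda>w. iexp (\<Sum>t\<in>I. a t * H t w)) = expectation (\<lambda>w. iexp (\<Sum>t\<in>I. a t * drift t) * iexp (\<Sum>t\<in>I. a t * Y t w))"
    proof (intro Bochner_Integration.integral_cong refl)
      fix w
      have "(\<Sum>t\<in>I. a t * H t w) = (\<Sum>t\<in>I. a t * drift t) + (\<Sum>t\<in>I. a t * Y t w)"
        by (simp add: H_def distrib_left sum.distrib add.commute)
      then show "iexp (\<Sum>t\<in>I. a t * H t w) = iexp (\<Sum>t\<in>I. a t * drift t) * iexp (\<Sum>t\<in>I. a t * Y t w)"
        by (simp only: of_real_add distrib_left exp_add)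
    qed
    also have "\<dots> = iexp (\<Sum>t\<in>I. a t * drift t) * exp (\<integral>s. \<phi> (\<lambda>t. V t s) s \<partial>n)"
      by (simp only: integral_mult_right_zero charY)
    also have "\<dots> = exp ((\<integral>s. \<phi> (\<lambda>t. V t s) s \<partial>n) + \<i> * complex_of_real (\<Sum>t\<in>I. a t * drift t))"
      by (simp only: exp_add mult.commute)
    finally show "expectation (\<lambda>w. iexp (\<Sum>t\<in>I. a t * H t w)) =
      exp (\<integral>s. (iexp (\<Sum>t\<in>I. a t * V t s) - 1 - \<i> * complex_of_real (\<Sum>t\<in>I. a t * (V t s * chi (V t s)))) \<partial>n)"
      unfolding expo .
  qed
qed

end

section \<open>Representations\<close>

lemma origin_sets: "finite I \<Longrightarrow> {origin I} \<in> sets (path_space I)"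
proof -
  assume I: "finite I"
  have "{origin I} = (\<Pi>\<^sub>E t\<in>I. {0})"
    by (auto simp: PiE_iff extensional_def fun_eq_iff)
  then show ?thesis by (simp only:) (intro sets_PiM_I_finite I, simp)
qed

lemma off_origin_measurable:
  assumes "finite I"
  shows "(indicator (- {origin I}) :: _ \<Rightarrow> 'b::{topological_space, zero_neq_one}) \<in> borel_measurable (path_space I)"
proof -
  have "(indicator (space (path_space I) - {origin I}) :: _ \<Rightarrow> 'b) \<in> borel_measurable (path_space I)"
    by (intro borel_measurable_indicator sets.compl_sets origin_sets assms)
  also have "?this \<longleftrightarrow> ?thesis" by (rule measurable_cong) (auto simp: indicator_def)
  finally show ?thesis .
qed

text \<open>
  The images of \<open>n\<close> and \<open>\<nu>\<close> under evaluation on \<open>I\<close> may have different masses at the origin, so they are compared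
  after restriction to its complement.
\<close>

lemma representation_law:
  assumes rep: "representation_of T \<nu> n V" and \<nu>: "sets \<nu> = sets (path_space T)"
    and I: "finite I" "I \<subseteq> T" "I \<noteq> {}"
  shows "joint I V \<in> measurable n (path_space I)" "(\<lambda>x. restrict x I) \<in> measurable \<nu> (path_space I)"
    "density (distr n (path_space I) (joint I V)) (indicator (- {origin I})) =
     density (distr \<nu> (path_space I) (\<lambda>x. restrict x I)) (indicator (- {origin I}))"
proof -
  show V: "joint I V \<in> measurable n (path_space I)"
    using rep I by (intro measurable_joint) (auto simp: representation_of_def real_process_def)
  show R: "(\<lambda>x. restrict x I) \<in> measurable \<nu> (path_space I)"
    unfolding measurable_cong_sets[OF \<nu> refl] by (rule measurable_restrict_subset[OF I(2)])
  let ?f = "indicator (- {origin I}) :: _ \<Rightarrow> ennreal"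
  have fm: "?f \<in> borel_measurable (path_space I)" by (rule off_origin_measurable[OF I(1)])
  show "density (distr n (path_space I) (joint I V)) ?f = density (distr \<nu> (path_space I) (\<lambda>x. restrict x I)) ?f"
  proof (rule measure_eqI)
    fix A assume "A \<in> sets (density (distr n (path_space I) (joint I V)) ?f)"
    then have A: "A \<in> sets (path_space I)" by simp
    define B where "B = A - {origin I}"
    have B: "B \<in> sets (path_space I)" "origin I \<notin> B" using A origin_sets[OF I(1)] by (auto simp: B_def)
    have dens: "emeasure (density (distr \<mu> (path_space I) f) ?f) A = emeasure \<mu> (f -` B \<inter> space \<mu>)"
      if f: "f \<in> measurable \<mu> (path_space I)" for \<mu> :: "'z measure" and f
    proof -
      have "emeasure (density (distr \<mu> (path_space I) f) ?f) A = (\<integral>\<^sup>+ x. ?f x * indicator A x \<partial>distr \<mu> (path_space I) f)"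
        using A fm by (intro emeasure_density) auto
      also have "\<dots> = (\<integral>\<^sup>+ x. indicator B x \<partial>distr \<mu> (path_space I) f)"
        by (intro nn_integral_cong) (auto simp: B_def indicator_def)
      also have "\<dots> = emeasure (distr \<mu> (path_space I) f) B" using B by simp
      finally show ?thesis using f B by (simp add: emeasure_distr)
    qed
    have "emeasure n {s \<in> space n. joint I V s \<in> B} = emeasure \<nu> {x \<in> space \<nu>. restrict x I \<in> B}"
      using rep I B unfolding representation_of_def by blast
    moreover have "joint I V -` B \<inter> space n = {s \<in> space n. joint I V s \<in> B}"
      "(\<lambda>x. restrict x I) -` B \<inter> space \<nu> = {x \<in> space \<nu>. restrict x I \<in> B}" by auto
    ultimately show "emeasure (density (distr n (path_space I) (joint I V)) ?f) A
        = emeasure (density (distr \<nu> (path_space I) (\<lambda>x. restrict x I)) ?f) A"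
      by (simp only: dens[OF V] dens[OF R])
  qed simp
qed

lemma representation_integral:
  fixes q :: "('t \<Rightarrow> real) \<Rightarrow> 'b::{banach, second_countable_topology}"
  assumes rep: "representation_of T \<nu> n V" and \<nu>: "sets \<nu> = sets (path_space T)"
    and I: "finite I" "I \<subseteq> T" "I \<noteq> {}"
    and q: "q \<in> borel_measurable (path_space I)" "q (origin I) = 0"
  shows "(\<integral>s. q (joint I V s) \<partial>n) = (\<integral>x. q (restrict x I) \<partial>\<nu>)"
proof -
  note law = representation_law[OF rep \<nu> I]
  have dens: "(\<integral>s. q (f s) \<partial>\<mu>) = (\<integral>x. q x \<partial>density (distr \<mu> (path_space I) f) (indicator (- {origin I})))"
    if f: "f \<in> measurable \<mu> (path_space I)" for \<mu> :: "'z measure" and f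
  proof -
    have fm: "indicat_real (- {origin I}) \<in> borel_measurable (path_space I)" by (rule off_origin_measurable[OF I(1)])
    have eqi: "(indicator (- {origin I}) :: _ \<Rightarrow> ennreal) = (\<lambda>x. ennreal (indicat_real (- {origin I}) x))"
      by (simp add: fun_eq_iff ennreal_indicator)
    have "(\<integral>x. q x \<partial>density (distr \<mu> (path_space I) f) (indicator (- {origin I})))
        = (\<integral>x. indicat_real (- {origin I}) x *\<^sub>R q x \<partial>distr \<mu> (path_space I) f)"
      unfolding eqi using q fm by (intro integral_density) auto
    also have "\<dots> = (\<integral>x. q x \<partial>distr \<mu> (path_space I) f)"
      using q(2) by (intro Bochner_Integration.integral_cong) (auto simp: indicator_def)
    also have "\<dots> = (\<integral>s. q (f s) \<partial>\<mu>)" by (rule integral_distr[OF f q(1)])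
    finally show ?thesis by simp
  qed
  show ?thesis unfolding dens[OF law(1)] dens[OF law(2)] law(3) ..
qed

lemma representation_nn_integral:
  assumes rep: "representation_of T \<nu> n V" and \<nu>: "sets \<nu> = sets (path_space T)"
    and I: "finite I" "I \<subseteq> T" "I \<noteq> {}"
    and q: "q \<in> borel_measurable (path_space I)" "q (origin I) = 0"
  shows "(\<integral>\<^sup>+ s. q (joint I V s) \<partial>n) = (\<integral>\<^sup>+ x. q (restrict x I) \<partial>\<nu>)"
proof -
  note law = representation_law[OF rep \<nu> I]
  have dens: "(\<integral>\<^sup>+ s. q (f s) \<partial>\<mu>) = (\<integral>\<^sup>+ x. q x \<partial>density (distr \<mu> (path_space I) f) (indicator (- {origin I})))"
    if f: "f \<in> measurable \<mu> (path_space I)" for \<mu> :: "'z measure" and f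
  proof -
    have fm: "(indicator (- {origin I}) :: _ \<Rightarrow> ennreal) \<in> borel_measurable (path_space I)" by (rule off_origin_measurable[OF I(1)])
    have "(\<integral>\<^sup>+ x. q x \<partial>density (distr \<mu> (path_space I) f) (indicator (- {origin I})))
        = (\<integral>\<^sup>+ x. indicator (- {origin I}) x * q x \<partial>distr \<mu> (path_space I) f)"
      using q fm by (intro nn_integral_density) auto
    also have "\<dots> = (\<integral>\<^sup>+ x. q x \<partial>distr \<mu> (path_space I) f)"
      using q(2) by (intro nn_integral_cong) (auto simp: indicator_def)
    also have "\<dots> = (\<integral>\<^sup>+ s. q (f s) \<partial>\<mu>)" by (rule nn_integral_distr[OF f]) (simp add: q(1))
    finally show ?thesis by simp
  qed
  show ?thesis unfolding dens[OF law(1)] dens[OF law(2)] law(3) ..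
qed

section \<open>Pulling back along measure preserving maps\<close>

text \<open>
  A probability space \<open>M'\<close> on which the random measure is a function of a variable \<open>p\<close> with law \<open>M\<close>. Everything
  that is said about \<open>N\<close> in terms of measurable functions on \<open>M\<close> then holds for \<open>N\<close> composed with \<open>p\<close>.
\<close>

locale noise_factor = poisson_noise M n N for M :: "'v measure" and n :: "'s measure" and N :: "'s set \<Rightarrow> 'v \<Rightarrow> ennreal" +
  fixes M' :: "'w measure" and p :: "'w \<Rightarrow> 'v"
  assumes M': "prob_space M'" and p: "p \<in> measurable M' M" and law: "distr M' M p = M"
begin

sublocale M': prob_space M' by (rule M')

abbreviation N' :: "'s set \<Rightarrow> 'w \<Rightarrow> ennreal" where "N' A w \<equiv> N A (p w)"

lemma pull_measurable: "f \<in> borel_measurable M \<Longrightarrow> (\<lambda>w. f (p w)) \<in> borel_measurable M'"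
  by (rule measurable_compose[OF p])

lemma pull_prob: "{v \<in> space M. Q v} \<in> sets M \<Longrightarrow> measure M' {w \<in> space M'. Q (p w)} = measure M {v \<in> space M. Q v}"
proof -
  assume Q: "{v \<in> space M. Q v} \<in> sets M"
  have "measure M {v \<in> space M. Q v} = measure (distr M' M p) {v \<in> space M. Q v}" by (simp add: law)
  also have "\<dots> = measure M' (p -` {v \<in> space M. Q v} \<inter> space M')" by (rule measure_distr[OF p Q])
  also have "p -` {v \<in> space M. Q v} \<inter> space M' = {w \<in> space M'. Q (p w)}" using measurable_space[OF p] by auto
  finally show ?thesis by simp
qed

lemma pull_AE: "AE v in M. Q v \<Longrightarrow> AE w in M'. Q (p w)"
proof -
  assume "AE v in M. Q v"
  then have "AE v in distr M' M p. Q v" unfolding law .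
  then show ?thesis by (rule AE_distrD[OF p])
qed

lemma pull_nn_integral: "f \<in> borel_measurable M \<Longrightarrow> (\<integral>\<^sup>+ w. f (p w) \<partial>M') = (\<integral>\<^sup>+ v. f v \<partial>M)"
  using nn_integral_distr[OF p, of f] by (simp add: law)

lemma pull_indep_vars:
  fixes X :: "'i \<Rightarrow> 'v \<Rightarrow> ennreal"
  assumes ind: "indep_vars (\<lambda>_. borel) X I"
  shows "M'.indep_vars (\<lambda>_. borel) (\<lambda>i w. X i (p w)) I"
proof (cases "I = {}")
  case True
  then show ?thesis unfolding M'.indep_vars_def2 M'.indep_sets_def by simp
next
  case False
  have X: "X i \<in> borel_measurable M" if "i \<in> I" for i using ind that by (simp add: indep_vars_def2)
  have pX: "(\<lambda>w. X i (p w)) \<in> borel_measurable M'" if "i \<in> I" for i by (rule pull_measurable[OF X[OF that]])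
  have d: "distr M' borel (\<lambda>w. X i (p w)) = distr M borel (X i)" if "i \<in> I" for i
    using distr_distr[OF X[OF that] p] by (simp add: law comp_def)
  have J: "(\<lambda>v. \<lambda>i\<in>I. X i v) \<in> measurable M (Pi\<^sub>M I (\<lambda>_. borel))" by (intro measurable_restrict X)
  have "distr M' (Pi\<^sub>M I (\<lambda>_. borel)) (\<lambda>w. \<lambda>i\<in>I. X i (p w)) = distr M (Pi\<^sub>M I (\<lambda>_. borel)) (\<lambda>v. \<lambda>i\<in>I. X i v)"
    using distr_distr[OF J p] by (simp add: law comp_def)
  also have "\<dots> = (\<Pi>\<^sub>M i\<in>I. distr M borel (X i))"
    using indep_vars_iff_distr_eq_PiM'[OF False X] ind by simp
  also have "\<dots> = (\<Pi>\<^sub>M i\<in>I. distr M' borel (\<lambda>w. X i (p w)))"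
    by (rule PiM_cong) (simp_all add: d)
  finally show ?thesis using M'.indep_vars_iff_distr_eq_PiM'[OF False pX] by simp
qed

lemma pull_poisson_random_measure: "poisson_random_measure M' n N'"
  unfolding poisson_random_measure_def
proof (intro conjI ballI allI impI; (elim conjE)?)
  show "N' A \<in> borel_measurable M'" if "A \<in> sets n" for A by (rule pull_measurable[OF N_measurable[OF that]])
  show "measure M' {w \<in> space M'. N' A w = of_nat k} = measure n A ^ k / fact k * exp (- measure n A)"
    if A: "A \<in> sets n" "emeasure n A < \<infinity>" for A k
  proof -
    have "{v \<in> space M. N A v = of_nat k} \<in> sets M" using N_measurable[OF A(1)] by measurable
    then show ?thesis using pull_prob[of "\<lambda>v. N A v = of_nat k"] N_pmf[OF A, of k] by simp
  qed
  show "AE w in M'. N' A w = \<infinity>" if "A \<in> sets n" "emeasure n A = \<infinity>" for A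
  proof (rule pull_AE)
    show "AE v in M. N A v = \<infinity>" using prm that unfolding poisson_random_measure_def by blast
  qed
  show "M'.indep_vars (\<lambda>_. borel) N' \<A>" if "\<A> \<subseteq> sets n" "disjoint \<A>" for \<A>
    by (rule pull_indep_vars[OF N_indep[OF that]])
  show "AE w in M'. N' (\<Union>i. A i) w = (\<Sum>i. N' (A i) w)"
    if "range A \<subseteq> sets n" "disjoint_family A" for A
    by (rule pull_AE[OF N_additive[OF that]])
qed

lemma simple_integral_pull:
  "simple_integral_N n N' g w = simple_integral_N n N g (p w)"
  "simple_integral_compensated n N' g w = simple_integral_compensated n N g (p w)"
  by (simp_all add: simple_integral_N_def simple_integral_compensated_def)

lemma pull_tendsto_in_prob:
  assumes Z: "\<And>k. Z k \<in> borel_measurable M" "Y \<in> borel_measurable M" and lim: "tendsto_in_prob M Z Y"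
  shows "tendsto_in_prob M' (\<lambda>k w. Z k (p w)) (\<lambda>w. Y (p w))"
proof -
  have "{v \<in> space M. \<bar>Z k v - Y v\<bar> > \<epsilon>} \<in> sets M" for k \<epsilon> using Z by measurable
  note eq = pull_prob[OF this]
  show ?thesis using lim unfolding tendsto_in_prob_def eq .
qed

lemma pull_poissonian_integral:
  assumes "poissonian_integral chi M n N f Y"
  shows "poissonian_integral chi M' n N' f (\<lambda>w. Y (p w))"
proof -
  obtain Y1 Y2 where f: "f \<in> borel_measurable n" "(\<integral>\<^sup>+ s. ennreal (min ((f s)\<^sup>2) 1) \<partial>n) < \<infinity>" and Y: "Y \<in> borel_measurable M"
    and Y1: "compensated_integral M n N (\<lambda>s. f s * indicator {s. \<bar>f s\<bar> \<le> 1} s) Y1"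
    and Y2: "N_integral M n N (\<lambda>s. f s * indicator {s. \<bar>f s\<bar> > 1} s) Y2"
    and ae: "AE w in M. Y w = Y1 w + Y2 w + (\<integral>s. f s * (indicator {s. \<bar>f s\<bar> \<le> 1} s - chi (f s)) \<partial>n)"
    using assms unfolding poissonian_integral_def by blast
  have "compensated_integral M' n N' (\<lambda>s. f s * indicator {s. \<bar>f s\<bar> \<le> 1} s) (\<lambda>w. Y1 (p w))"
  proof -
    let ?h = "\<lambda>s. f s * indicator {s. \<bar>f s\<bar> \<le> 1} s"
    obtain g where Y1m: "Y1 \<in> borel_measurable M" and g: "\<And>k. finite_simple n (g k)"
      and gh: "(\<lambda>k. \<integral>\<^sup>+ s. ennreal ((g k s - ?h s)\<^sup>2) \<partial>n) \<longlonglongrightarrow> 0"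
      and lim: "(\<lambda>k. \<integral>\<^sup>+ w. ennreal ((simple_integral_compensated n N (g k) w - Y1 w)\<^sup>2) \<partial>M) \<longlonglongrightarrow> 0"
      using Y1 unfolding compensated_integral_def by blast
    have "(\<integral>\<^sup>+ w. ennreal ((simple_integral_compensated n N' (g k) w - Y1 (p w))\<^sup>2) \<partial>M')
        = (\<integral>\<^sup>+ w. ennreal ((simple_integral_compensated n N (g k) w - Y1 w)\<^sup>2) \<partial>M)" for k
    proof -
      have "(\<lambda>v. ennreal ((simple_integral_compensated n N (g k) v - Y1 v)\<^sup>2)) \<in> borel_measurable M"
        using simple_integrals_measurable(2)[OF g] Y1m by measurable
      from pull_nn_integral[OF this] show ?thesis by (simp only: simple_integral_pull)
    qed
    then show ?thesis
      unfolding compensated_integral_def using pull_measurable[OF Y1m] g gh lim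
      by (intro conjI exI[of _ g]) simp_all
  qed
  moreover have "N_integral M' n N' (\<lambda>s. f s * indicator {s. \<bar>f s\<bar> > 1} s) (\<lambda>w. Y2 (p w))"
  proof -
    let ?h = "\<lambda>s. f s * indicator {s. \<bar>f s\<bar> > 1} s"
    obtain g where Y2m: "Y2 \<in> borel_measurable M" and supp: "emeasure n {s \<in> space n. ?h s \<noteq> 0} < \<infinity>"
      and g: "\<And>k. finite_simple n (g k)" and gh: "\<forall>k. \<forall>s\<in>space n. ?h s = 0 \<longrightarrow> g k s = 0"
        "\<forall>s\<in>space n. (\<lambda>k. g k s) \<longlonglongrightarrow> ?h s"
      and lim: "tendsto_in_prob M (\<lambda>k. simple_integral_N n N (g k)) Y2"
      using Y2 unfolding N_integral_def by blast
    have "tendsto_in_prob M' (\<lambda>k. simple_integral_N n N' (g k)) (\<lambda>w. Y2 (p w))"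
      using pull_tendsto_in_prob[OF simple_integrals_measurable(1)[OF g] Y2m lim] by (simp only: simple_integral_pull[abs_def])
    then show ?thesis
      unfolding N_integral_def using pull_measurable[OF Y2m] g gh supp
      by (intro conjI exI[of _ g]) blast+
  qed
  ultimately show ?thesis
    unfolding poissonian_integral_def
    using f pull_measurable[OF Y] pull_AE[OF ae] by blast
qed

end

section \<open>The decomposition\<close>

lemma coded_partition_exists:
  fixes n :: "'s measure"
  assumes sf: "sigma_finite_measure n" and cg: "countably_generated_mod n"
  obtains S h D where "coded_partition n S h D"
proof -
  obtain S :: "nat \<Rightarrow> 's set" where S: "range S \<subseteq> sets n" "(\<Union>j. S j) = space n" "\<And>j. emeasure n (S j) \<noteq> \<infinity>" "disjoint_family S"
    using sigma_finite_measure.sigma_finite_disjoint[OF sf] by metis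
  obtain h :: "'s \<Rightarrow> real" where h: "h \<in> borel_measurable n"
    "\<And>A. A \<in> sets n \<Longrightarrow> \<exists>D\<in>sets borel. sym_diff A (h -` D \<inter> space n) \<in> null_sets n"
    using countably_generated_separating_map[OF cg] by metis
  define D where "D A = (SOME D. D \<in> sets borel \<and> sym_diff A (h -` D \<inter> space n) \<in> null_sets n)" for A
  have D: "D A \<in> sets borel \<and> sym_diff A (h -` D A \<inter> space n) \<in> null_sets n" if "A \<in> sets n" for A
    unfolding D_def by (rule someI_ex) (use h(2)[OF that] in blast)
  have "coded_partition n S h D"
    using S h(1) D by unfold_locales (auto simp: less_top[symmetric])
  then show thesis by (rule that)
qed

lemma char_product:
  fixes f :: "'a \<Rightarrow> real" and g :: "'b \<Rightarrow> real"
  assumes P: "prob_space P" "prob_space Q" and f: "f \<in> borel_measurable P" and g: "g \<in> borel_measurable Q"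
  shows "(\<integral>z. iexp (f (fst z) + g (snd z)) \<partial>(P \<Otimes>\<^sub>M Q)) = (\<integral>x. iexp (f x) \<partial>P) * (\<integral>y. iexp (g y) \<partial>Q)"
proof -
  interpret P: prob_space P by fact
  interpret Q: prob_space Q by fact
  interpret PQ: pair_prob_space P Q ..
  have [measurable]: "(\<lambda>z. f (fst z)) \<in> borel_measurable (P \<Otimes>\<^sub>M Q)" "(\<lambda>z. g (snd z)) \<in> borel_measurable (P \<Otimes>\<^sub>M Q)"
    by (rule measurable_compose[OF measurable_fst f], rule measurable_compose[OF measurable_snd g])
  have "integrable (P \<Otimes>\<^sub>M Q) (\<lambda>z. iexp (f (fst z) + g (snd z)))"
    by (rule PQ.integrable_iexp_real) measurable
  then have "(\<integral>z. iexp (f (fst z) + g (snd z)) \<partial>(P \<Otimes>\<^sub>M Q)) = (\<integral>x. \<integral>y. iexp (f x + g y) \<partial>Q \<partial>P)"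
    using PQ.integral_fst'[of "\<lambda>z. iexp (f (fst z) + g (snd z))"] by (simp only: fst_conv snd_conv)
  also have "\<dots> = (\<integral>x. iexp (f x) * (\<integral>y. iexp (g y) \<partial>Q) \<partial>P)"
    by (simp only: of_real_add distrib_left exp_add integral_mult_right_zero)
  also have "\<dots> = (\<integral>x. iexp (f x) \<partial>P) * (\<integral>y. iexp (g y) \<partial>Q)"
    by (simp only: integral_mult_left_zero)
  finally show ?thesis .
qed

text \<open>
  The triplet provides the covariance and the exponents of the auxiliary process, and agreement of the
  characteristic functions then identifies the law of this process with the law of \<open>X\<close>. From there on only the
  equality of laws is used.
\<close>

theorem theorem3p2:
  fixes T T0 :: "'t set"
    and M :: "'w measure"
    and X :: "'t \<Rightarrow> 'w \<Rightarrow> real"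
    and chi :: "real \<Rightarrow> real"
    and K :: "'t \<Rightarrow> 't \<Rightarrow> real"
    and \<nu> :: "('t \<Rightarrow> real) measure"
    and b :: "'t \<Rightarrow> real"
    and n :: "'s measure"
    and V :: "'t \<Rightarrow> 's \<Rightarrow> real"
  assumes "T \<noteq> {}"
    and "cutoff chi"
    and "prob_space M"
    and "infinitely_divisible_process M T X"
    and "separable_in_prob M T X T0"
    and "generating_triplet chi M T X K \<nu> b"
    and "supports_independent_uniform M T X"
    and "sigma_finite_measure n"
    and "countably_generated_mod n"
    and "representation_of T \<nu> n V"
  shows "\<exists>(G :: 't \<Rightarrow> 'w \<Rightarrow> real) (N :: 's set \<Rightarrow> 'w \<Rightarrow> ennreal).
           centered_gaussian_process M T G K \<and>
           poisson_random_measure M n N \<and>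
           indep_elements M (Pi\<^sub>M (sets n) (\<lambda>_. borel)) (joint (sets n) N) (path_space T) (joint T G) \<and>
           (\<forall>t\<in>T. \<exists>Y. poissonian_integral chi M n N (V t) Y \<and>
                      (AE w in M. X t w = G t w + Y w + b t))"
proof -
  note chi = assms(2) and M = assms(3) and rep = assms(10)
  interpret M: prob_space M by (rule M)
  have X: "real_process M T X" using assms(4) by (simp add: infinitely_divisible_process_def)
  have K: "nonneg_definite_on T K" and levy: "levy_measure T \<nu>"
    using assms(6) by (auto simp: generating_triplet_def)
  have \<nu>: "sets \<nu> = sets (path_space T)" using levy by (simp add: levy_measure_def)
  have chim: "chi \<in> borel_measurable borel" using chi by (simp add: cutoff_def)
  obtain U :: "'w \<Rightarrow> real" where U: "indep_elements M borel U (path_space T) (joint T X)"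
    "distr M borel U = uniform_measure lborel {0..1}"
    using assms(7) unfolding supports_independent_uniform_def by blast
  obtain \<Gamma> :: "('t \<Rightarrow> real) measure" where \<Gamma>: "prob_space \<Gamma>" "sets \<Gamma> = sets (path_space T)"
    "\<And>I (a :: 't \<Rightarrow> real). finite I \<Longrightarrow> I \<subseteq> T \<Longrightarrow> (\<integral>x. iexp (\<Sum>t\<in>I. a t * x t) \<partial>\<Gamma>)
       = exp (- (1/2) * complex_of_real (\<Sum>s\<in>I. \<Sum>t\<in>I. a s * K s t * a t))"
  proof -
    from gaussian_law_exists[OF K] obtain \<Gamma> :: "('t \<Rightarrow> real) measure" where
      \<Gamma>: "prob_space \<Gamma> \<and> sets \<Gamma> = sets (path_space T) \<and>
        (\<forall>I (a :: 't \<Rightarrow> real). finite I \<and> I \<subseteq> T \<longrightarrow> (\<integral>x. iexp (\<Sum>t\<in>I. a t * x t) \<partial>\<Gamma>)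
          = exp (- (1/2) * complex_of_real (\<Sum>s\<in>I. \<Sum>t\<in>I. a s * K s t * a t)))" by (rule exE)
    show thesis
      by (rule that[OF \<Gamma>[THEN conjunct1] \<Gamma>[THEN conjunct2, THEN conjunct1] \<Gamma>[THEN conjunct2, THEN conjunct2, rule_format, OF conjI]])
  qed
  obtain S h D where cp: "coded_partition n S h D"
    using coded_partition_exists[OF assms(8,9)] by blast
  interpret cp: coded_partition n S h D by (rule cp)
  let ?R = "cp.points"
  interpret noise: poisson_noise ?R n cp.N
    by unfold_locales (rule cp.N_poisson_random_measure)
  have Vm: "V t \<in> borel_measurable n" if "t \<in> T" for t using rep that by (simp add: representation_of_def)
  have Vfin: "(\<integral>\<^sup>+ s. ennreal (min ((V t s)\<^sup>2) 1) \<partial>n) < \<infinity>" if t: "t \<in> T" for t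
  proof -
    define q where "q = (\<lambda>x :: 't \<Rightarrow> real. ennreal (min (\<bar>x t\<bar>\<^sup>2) 1))"
    have qm: "q \<in> borel_measurable (path_space {t})" unfolding q_def by measurable
    have q0: "q (origin {t}) = 0" by (simp add: q_def)
    have "(\<integral>\<^sup>+ s. q (joint {t} V s) \<partial>n) = (\<integral>\<^sup>+ x. q (restrict x {t}) \<partial>\<nu>)"
      by (rule representation_nn_integral[OF rep \<nu> _ _ _ qm q0]) (use t in auto)
    moreover have "(\<integral>\<^sup>+ x. q (restrict x {t}) \<partial>\<nu>) < \<infinity>"
      using levy t by (simp add: q_def levy_measure_def)
    ultimately show ?thesis by (simp add: q_def joint_def)
  qed
  obtain H where H: "\<And>t. t \<in> T \<Longrightarrow> poissonian_integral chi ?R n cp.N (V t) (H t)"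
    and H_char: "\<And>I (a :: 't \<Rightarrow> real). finite I \<Longrightarrow> I \<subseteq> T \<Longrightarrow> (\<integral>\<omega>. iexp (\<Sum>t\<in>I. a t * H t \<omega>) \<partial>?R) =
      exp (\<integral>s. (iexp (\<Sum>t\<in>I. a t * V t s) - 1 - \<i> * complex_of_real (\<Sum>t\<in>I. a t * (V t s * chi (V t s)))) \<partial>n)"
  proof (rule noise.poissonian_integrals_exist[OF chi])
    show "V t \<in> borel_measurable n" "(\<integral>\<^sup>+ s. ennreal (min ((V t s)\<^sup>2) 1) \<partial>n) < \<infinity>" if "t \<in> T" for t
      by (rule Vm[OF that], rule Vfin[OF that])
  qed (rule that)
  have Hm: "H t \<in> borel_measurable ?R" if "t \<in> T" for t
    using H[OF that] by (simp add: poissonian_integral_def)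
  let ?\<Omega> = "\<Gamma> \<Otimes>\<^sub>M ?R"
  interpret \<Gamma>: prob_space \<Gamma> by (rule \<Gamma>(1))
  interpret \<Omega>: pair_prob_space \<Gamma> ?R ..
  have coord_\<Gamma>: "(\<lambda>x. x t) \<in> borel_measurable \<Gamma>" if "t \<in> T" for t
    unfolding measurable_cong_sets[OF \<Gamma>(2) refl] using that by (rule measurable_component_singleton)
  have space_\<Gamma>: "space \<Gamma> = space (path_space T)" by (rule sets_eq_imp_space_eq[OF \<Gamma>(2)])
  \<comment> \<open>the decomposition on the auxiliary space\<close>
  define X' where "X' = (\<lambda>t z. fst z t + H t (snd z) + b t)"
  have X': "real_process ?\<Omega> T X'"
    unfolding real_process_def X'_def
    by (intro ballI borel_measurable_add borel_measurable_const measurable_compose[OF measurable_fst coord_\<Gamma>]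
        measurable_compose[OF measurable_snd Hm])
  have law: "distr M (path_space T) (joint T X) = distr ?\<Omega> (path_space T) (joint T X')"
  proof (rule path_law_eqI[OF M \<Omega>.prob_space_axioms X X'])
    fix I and a :: "'t \<Rightarrow> real" assume I: "finite I" "I \<subseteq> T" "I \<noteq> {}"
    let ?G = "- (1/2) * complex_of_real (\<Sum>s\<in>I. \<Sum>t\<in>I. a s * K s t * a t)"
    let ?B = "\<i> * complex_of_real (\<Sum>t\<in>I. a t * b t)"
    \<comment> \<open>the integrand of the Levy exponent, as a function on the paths over \<open>I\<close>\<close>
    define q where "q = (\<lambda>x :: 't \<Rightarrow> real. iexp (\<Sum>t\<in>I. a t * x t) - 1 - \<i> * complex_of_real (\<Sum>t\<in>I. a t * truncation chi x t))"
    have qm: "q \<in> borel_measurable (path_space I)"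
    proof -
      have c: "(\<lambda>x. x t) \<in> borel_measurable (path_space I)" if "t \<in> I" for t
        using that by (rule measurable_component_singleton)
      have [measurable]: "(\<lambda>x. \<Sum>t\<in>I. a t * x t) \<in> borel_measurable (path_space I)"
        "(\<lambda>x. \<Sum>t\<in>I. a t * truncation chi x t) \<in> borel_measurable (path_space I)"
        unfolding truncation_def
        by (intro borel_measurable_sum borel_measurable_times borel_measurable_const c measurable_compose[OF c chim]; assumption)+
      show ?thesis unfolding q_def by measurable
    qed
    have q_restrict: "q x = q y" if "\<And>t. t \<in> I \<Longrightarrow> x t = y t" for x y
    proof -
      have "(\<Sum>t\<in>I. a t * x t) = (\<Sum>t\<in>I. a t * y t)" "(\<Sum>t\<in>I. a t * truncation chi x t) = (\<Sum>t\<in>I. a t * truncation chi y t)"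
        by (intro sum.cong refl; simp add: that truncation_def)+
      then show ?thesis by (simp only: q_def)
    qed
    have q0: "q (origin I) = 0"
    proof -
      have "(\<Sum>t\<in>I. a t * origin I t) = 0" "(\<Sum>t\<in>I. a t * truncation chi (origin I) t) = 0"
        by (intro sum.neutral ballI; simp add: truncation_def)+
      then show ?thesis by (simp only: q_def) simp
    qed
    have "(\<integral>s. q (joint I V s) \<partial>n) = (\<integral>x. q (restrict x I) \<partial>\<nu>)"
      by (rule representation_integral[OF rep \<nu> I qm q0])
    moreover have "q (restrict x I) = q x" for x by (rule q_restrict) simp
    moreover have "q (joint I V s) = q (\<lambda>t. V t s)" for s by (rule q_restrict) (simp add: joint_def)
    ultimately have rep_q: "(\<integral>s. q (\<lambda>t. V t s) \<partial>n) = (\<integral>x. q x \<partial>\<nu>)" by simp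
    have f: "(\<lambda>x. \<Sum>t\<in>I. a t * x t) \<in> borel_measurable \<Gamma>"
      using I(2) by (intro borel_measurable_sum borel_measurable_times borel_measurable_const coord_\<Gamma>) auto
    have g: "(\<lambda>\<omega>. (\<Sum>t\<in>I. a t * H t \<omega>) + (\<Sum>t\<in>I. a t * b t)) \<in> borel_measurable ?R"
      using I(2) by (intro borel_measurable_add borel_measurable_sum borel_measurable_times borel_measurable_const Hm) auto
    have "(\<Sum>t\<in>I. a t * X' t z) = (\<Sum>t\<in>I. a t * fst z t) + ((\<Sum>t\<in>I. a t * H t (snd z)) + (\<Sum>t\<in>I. a t * b t))" for z
      by (simp only: X'_def distrib_left sum.distrib add.assoc)
    then have "(\<integral>z. iexp (\<Sum>t\<in>I. a t * X' t z) \<partial>?\<Omega>)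
        = (\<integral>x. iexp (\<Sum>t\<in>I. a t * x t) \<partial>\<Gamma>) * (\<integral>\<omega>. iexp ((\<Sum>t\<in>I. a t * H t \<omega>) + (\<Sum>t\<in>I. a t * b t)) \<partial>?R)"
      using char_product[OF \<Gamma>(1) cp.P.prob_space_axioms f g] by (simp only:)
    also have "(\<integral>\<omega>. iexp ((\<Sum>t\<in>I. a t * H t \<omega>) + (\<Sum>t\<in>I. a t * b t)) \<partial>?R)
        = (\<integral>\<omega>. iexp (\<Sum>t\<in>I. a t * H t \<omega>) \<partial>?R) * exp ?B"
      by (simp only: of_real_add distrib_left exp_add integral_mult_left_zero)
    also have "(\<integral>\<omega>. iexp (\<Sum>t\<in>I. a t * H t \<omega>) \<partial>?R) = exp (\<integral>s. q (\<lambda>t. V t s) \<partial>n)"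
      unfolding H_char[OF I(1,2)] by (simp only: q_def truncation_def)
    also have "(\<integral>x. iexp (\<Sum>t\<in>I. a t * x t) \<partial>\<Gamma>) = exp ?G" by (rule \<Gamma>(3)[OF I(1,2)])
    also have "exp ?G * (exp (\<integral>s. q (\<lambda>t. V t s) \<partial>n) * exp ?B) = exp (?G + (\<integral>x. q x \<partial>\<nu>) + ?B)"
      unfolding rep_q by (simp only: exp_add mult.assoc)
    also have "\<dots> = (\<integral>w. iexp (\<Sum>t\<in>I. a t * X t w) \<partial>M)"
      using assms(6) I unfolding generating_triplet_def q_def by simp
    finally show "(\<integral>w. iexp (\<Sum>t\<in>I. a t * X t w) \<partial>M) = (\<integral>z. iexp (\<Sum>t\<in>I. a t * X' t z) \<partial>?\<Omega>)" by (rule sym)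
  qed
  have enc: "encode_reals \<in> borel_measurable ?R"
    unfolding measurable_cong_sets[OF cp.sets_points refl] by (rule measurable_encode_reals)
  have dec: "decode_reals \<in> measurable borel ?R"
    unfolding measurable_cong_sets[OF refl cp.sets_points] by (rule measurable_decode_reals)
  note jX = measurable_joint[OF X] and jX' = measurable_joint[OF X']
  have enc_snd: "(\<lambda>z. encode_reals (snd z)) \<in> borel_measurable ?\<Omega>"
    by (rule measurable_compose[OF measurable_snd enc])
  obtain \<eta> where \<eta>: "\<eta> \<in> borel_measurable M"
    and \<eta>_law: "distr M (path_space T \<Otimes>\<^sub>M borel) (\<lambda>w. (joint T X w, \<eta> w)) =
      distr ?\<Omega> (path_space T \<Otimes>\<^sub>M borel) (\<lambda>z. (joint T X' z, encode_reals (snd z)))"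
    by (rule transfer_real[OF M \<Omega>.prob_space_axioms U jX' enc_snd encode_reals_bounds law])
  \<comment> \<open>the noise transferred to the space of \<open>X\<close>\<close>
  define p where "p = (\<lambda>w. decode_reals (\<eta> w) :: nat \<times> nat \<Rightarrow> real)"
  have p: "p \<in> measurable M ?R" unfolding p_def by (rule measurable_compose[OF \<eta> dec])
  define G where "G = (\<lambda>t w. X t w - H t (p w) - b t)"
  have Xm: "X t \<in> borel_measurable M" if "t \<in> T" for t using X that by (simp add: real_process_def)
  have G: "real_process M T G"
    unfolding real_process_def G_def
    by (intro ballI borel_measurable_diff borel_measurable_const Xm measurable_compose[OF p Hm])
  note jG = measurable_joint[OF G]
  \<comment> \<open>this map recovers \<open>(g, \<omega>)\<close> from the auxiliary process and the code of \<open>\<omega>\<close>, and maps \<open>(X, \<eta>)\<close> to \<open>(G, p)\<close>\<close>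
  define \<psi> where "\<psi> = (\<lambda>(x, y). (\<lambda>t\<in>T. x t - H t (decode_reals y) - b t, decode_reals y :: nat \<times> nat \<Rightarrow> real))"
  have \<psi>: "\<psi> \<in> measurable (path_space T \<Otimes>\<^sub>M borel) (\<Gamma> \<Otimes>\<^sub>M ?R)"
  proof -
    have d: "(\<lambda>z :: ('t \<Rightarrow> real) \<times> real. decode_reals (snd z)) \<in> measurable (path_space T \<Otimes>\<^sub>M borel) ?R"
      by (rule measurable_compose[OF measurable_snd dec])
    have "(\<lambda>z. \<lambda>t\<in>T. fst z t - H t (decode_reals (snd z)) - b t) \<in> measurable (path_space T \<Otimes>\<^sub>M borel) (path_space T)"
      by (intro measurable_restrict borel_measurable_diff borel_measurable_const measurable_compose[OF d Hm]
          measurable_compose[OF measurable_fst measurable_component_singleton])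
    then have "(\<lambda>z. \<lambda>t\<in>T. fst z t - H t (decode_reals (snd z)) - b t) \<in> measurable (path_space T \<Otimes>\<^sub>M borel) \<Gamma>"
      unfolding measurable_cong_sets[OF refl \<Gamma>(2)] .
    from measurable_Pair[OF this d] show ?thesis by (simp only: \<psi>_def case_prod_beta')
  qed
  have joint_law: "distr M ?\<Omega> (\<lambda>w. (joint T G w, p w)) = ?\<Omega>"
  proof -
    have m: "(\<lambda>w. (joint T X w, \<eta> w)) \<in> measurable M (path_space T \<Otimes>\<^sub>M borel)"
      by (rule measurable_Pair[OF jX \<eta>])
    have m': "(\<lambda>z. (joint T X' z, encode_reals (snd z))) \<in> measurable ?\<Omega> (path_space T \<Otimes>\<^sub>M borel)"
      by (rule measurable_Pair[OF jX' enc_snd])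
    have "\<psi> \<circ> (\<lambda>w. (joint T X w, \<eta> w)) = (\<lambda>w. (joint T G w, p w))"
      by (auto simp: \<psi>_def joint_def G_def p_def fun_eq_iff)
    then have "distr M ?\<Omega> (\<lambda>w. (joint T G w, p w)) = distr (distr M (path_space T \<Otimes>\<^sub>M borel) (\<lambda>w. (joint T X w, \<eta> w))) ?\<Omega> \<psi>"
      using distr_distr[OF \<psi> m] by simp
    also have "\<dots> = distr ?\<Omega> ?\<Omega> (\<psi> \<circ> (\<lambda>z. (joint T X' z, encode_reals (snd z))))"
      unfolding \<eta>_law by (rule distr_distr[OF \<psi> m'])
    also have "\<dots> = distr ?\<Omega> ?\<Omega> (\<lambda>z. z)"
    proof (rule distr_cong[OF refl refl])
      fix z assume "z \<in> space ?\<Omega>"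
      then have "fst z \<in> space (path_space T)" by (auto simp: space_pair_measure space_\<Gamma>)
      then have "(\<lambda>t\<in>T. fst z t) = fst z" by (auto simp: space_PiM PiE_def extensional_restrict)
      moreover have "(\<lambda>t\<in>T. joint T X' z t - H t (snd z) - b t) = (\<lambda>t\<in>T. fst z t)"
        by (auto simp: joint_def X'_def restrict_def)
      ultimately show "(\<psi> \<circ> (\<lambda>z. (joint T X' z, encode_reals (snd z)))) z = z"
        by (simp add: \<psi>_def decode_encode_reals prod_eq_iff)
    qed
    also have "\<dots> = ?\<Omega>" by (rule distr_id)
    finally show ?thesis .
  qed
  have jG\<Gamma>: "joint T G \<in> measurable M \<Gamma>" unfolding measurable_cong_sets[OF refl \<Gamma>(2)] by (rule jG)
  have product: "measure M {w \<in> space M. joint T G w \<in> A \<and> p w \<in> B} = measure \<Gamma> A * measure ?R B"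
    if A: "A \<in> sets \<Gamma>" and B: "B \<in> sets ?R" for A B
  proof -
    have "measure \<Gamma> A * measure ?R B = measure ?\<Omega> (A \<times> B)"
      by (simp only: measure_def cp.P.emeasure_pair_measure_Times[OF A B] enn2real_mult)
    also have "\<dots> = measure (distr M ?\<Omega> (\<lambda>w. (joint T G w, p w))) (A \<times> B)" by (simp only: joint_law)
    also have "\<dots> = measure M ((\<lambda>w. (joint T G w, p w)) -` (A \<times> B) \<inter> space M)"
      by (rule measure_distr[OF measurable_Pair[OF jG\<Gamma> p]]) (intro pair_measureI A B)
    also have "(\<lambda>w. (joint T G w, p w)) -` (A \<times> B) \<inter> space M = {w \<in> space M. joint T G w \<in> A \<and> p w \<in> B}" by auto
    finally show ?thesis by (rule sym)
  qed
  have law_p: "distr M ?R p = ?R"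
  proof (rule measure_eqI)
    fix B assume "B \<in> sets (distr M ?R p)"
    then have B: "B \<in> sets ?R" by simp
    have "measure M {w \<in> space M. joint T G w \<in> space \<Gamma> \<and> p w \<in> B} = measure ?R B"
      using product[OF sets.top B] by (simp add: \<Gamma>.prob_space)
    also have "{w \<in> space M. joint T G w \<in> space \<Gamma> \<and> p w \<in> B} = p -` B \<inter> space M"
      using measurable_space[OF jG\<Gamma>] by auto
    finally show "emeasure (distr M ?R p) B = emeasure ?R B"
      using B p by (simp add: emeasure_distr M.emeasure_eq_measure cp.P.emeasure_eq_measure)
  qed simp
  have law_G: "distr M \<Gamma> (joint T G) = \<Gamma>"
  proof (rule measure_eqI)
    fix A assume "A \<in> sets (distr M \<Gamma> (joint T G))"
    then have A: "A \<in> sets \<Gamma>" by simp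
    have "measure M {w \<in> space M. joint T G w \<in> A \<and> p w \<in> space ?R} = measure \<Gamma> A"
      using product[OF A sets.top] by (simp add: cp.P.prob_space)
    also have "{w \<in> space M. joint T G w \<in> A \<and> p w \<in> space ?R} = joint T G -` A \<inter> space M"
      using measurable_space[OF p] by auto
    finally show "emeasure (distr M \<Gamma> (joint T G)) A = emeasure \<Gamma> A"
      using A jG\<Gamma> by (simp add: emeasure_distr M.emeasure_eq_measure \<Gamma>.emeasure_eq_measure)
  qed simp
  interpret fac: noise_factor ?R n cp.N M p
    by unfold_locales (rule p, rule law_p)
  have "centered_gaussian_process M T G K"
  proof (rule centered_gaussian_process_of_char[OF M G K])
    fix I and a :: "'t \<Rightarrow> real" assume I: "finite I" "I \<subseteq> T"
    have f: "(\<lambda>x. iexp (\<Sum>t\<in>I. a t * x t)) \<in> borel_measurable \<Gamma>"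
    proof -
      have [measurable]: "(\<lambda>x. \<Sum>t\<in>I. a t * x t) \<in> borel_measurable \<Gamma>"
        using I(2) by (intro borel_measurable_sum borel_measurable_times borel_measurable_const coord_\<Gamma>) auto
      show ?thesis by measurable
    qed
    have "(\<integral>w. iexp (\<Sum>t\<in>I. a t * G t w) \<partial>M) = (\<integral>w. iexp (\<Sum>t\<in>I. a t * joint T G w t) \<partial>M)"
    proof -
      have "(\<Sum>t\<in>I. a t * G t w) = (\<Sum>t\<in>I. a t * joint T G w t)" for w
        using I(2) by (intro sum.cong refl) (auto simp: joint_def)
      then show ?thesis by (simp only:)
    qed
    also have "\<dots> = (\<integral>x. iexp (\<Sum>t\<in>I. a t * x t) \<partial>distr M \<Gamma> (joint T G))"
      by (rule integral_distr[symmetric, OF jG\<Gamma> f])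
    finally show "(\<integral>w. iexp (\<Sum>t\<in>I. a t * G t w) \<partial>M)
       = exp (- (1/2) * complex_of_real (\<Sum>s\<in>I. \<Sum>t\<in>I. a s * K s t * a t))"
      unfolding law_G \<Gamma>(3)[OF I] .
  qed
  moreover have "poisson_random_measure M n fac.N'" by (rule fac.pull_poisson_random_measure)
  moreover have "indep_elements M (Pi\<^sub>M (sets n) (\<lambda>_. borel)) (joint (sets n) fac.N') (path_space T) (joint T G)"
  proof -
    have jN: "joint (sets n) cp.N \<in> measurable ?R (Pi\<^sub>M (sets n) (\<lambda>_. borel))"
      unfolding joint_def by (intro measurable_restrict cp.measurable_N)
    have jN': "joint (sets n) fac.N' = (\<lambda>w. joint (sets n) cp.N (p w))" by (simp add: joint_def fun_eq_iff)
    have jN'm: "joint (sets n) fac.N' \<in> measurable M (Pi\<^sub>M (sets n) (\<lambda>_. borel))"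
      unfolding jN' by (rule measurable_compose[OF p jN])
    show ?thesis
      unfolding indep_elements_def
    proof (intro conjI jN'm jG M.indep_setI)
      show "{joint (sets n) fac.N' -` A \<inter> space M | A. A \<in> sets (Pi\<^sub>M (sets n) (\<lambda>_. borel))} \<subseteq> M.events"
        using jN'm by (auto intro: measurable_sets)
      show "{joint T G -` B \<inter> space M | B. B \<in> sets (path_space T)} \<subseteq> M.events"
        using jG by (auto intro: measurable_sets)
      fix E F assume "E \<in> {joint (sets n) fac.N' -` A \<inter> space M | A. A \<in> sets (Pi\<^sub>M (sets n) (\<lambda>_. borel))}"
        and "F \<in> {joint T G -` B \<inter> space M | B. B \<in> sets (path_space T)}"
      then obtain A B where A: "A \<in> sets (Pi\<^sub>M (sets n) (\<lambda>_. borel))" "E = joint (sets n) fac.N' -` A \<inter> space M"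
        and B: "B \<in> sets \<Gamma>" "F = joint T G -` B \<inter> space M" unfolding \<Gamma>(2) by blast
      define A' where "A' = joint (sets n) cp.N -` A \<inter> space ?R"
      have A': "A' \<in> sets ?R" unfolding A'_def by (rule measurable_sets[OF jN A(1)])
      have E: "E = {w \<in> space M. joint T G w \<in> space \<Gamma> \<and> p w \<in> A'}"
        unfolding A(2) jN' A'_def using measurable_space[OF p] measurable_space[OF jG\<Gamma>] by auto
      have F: "F = {w \<in> space M. joint T G w \<in> B \<and> p w \<in> space ?R}"
        unfolding B(2) using measurable_space[OF p] by auto
      have EF: "E \<inter> F = {w \<in> space M. joint T G w \<in> B \<and> p w \<in> A'}"
        unfolding E F using measurable_space[OF p] measurable_space[OF jG\<Gamma>] by auto
      show "M.prob (E \<inter> F) = M.prob E * M.prob F"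
        unfolding EF product[OF B(1) A'] unfolding E F product[OF sets.top A'] product[OF B(1) sets.top]
        by (simp add: \<Gamma>.prob_space cp.P.prob_space)
    qed
  qed
  moreover have "\<exists>Y. poissonian_integral chi M n fac.N' (V t) Y \<and> (AE w in M. X t w = G t w + Y w + b t)" if "t \<in> T" for t
    by (intro exI[of _ "\<lambda>w. H t (p w)"] conjI fac.pull_poissonian_integral[OF H[OF that]]) (simp add: G_def)
  ultimately show ?thesis by blast
qed

end
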